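(* Let $D$ be a belief database over the set of users $U=\{1,\dots,m\}$, and let $K(D)$ be its canonical Kripke structure. Then: (1) For any belief statement $\varphi$, $D \models \varphi$ if and only if $K(D) \models \varphi$. (2) $K(D)$ can be computed in time $O(m^d n)$, where $n$ is the size of the belief database $D$, $m$ is the number of users, and $d$ is the maximum depth of any belief path in $D$.
   Context: **Tuples and instances.** Fix a relational schema $\mathcal R=(R_1,\dots,R_r)$; each relation $R_i$ has a distinguished key attribute. $Tup_i$ is the set of typed ground tuples of $R_i$, the sets $Tup_i$ are pairwise disjoint, $Tup=\bigcup_i Tup_i$, and $key(t)$ is the typed value of the key attribute of $t\in Tup$. A database instance is a set $I\subseteq Tup$. It satisfies the key constraints, written $\Gamma(I)$, iff for all $i$ and all $t,t'\in Tup_i$: $t,t'\in I$ and $t\ne t'$ imply $key(t)\neq key(t')$. **Belief worlds.** A belief world is a pair $W=(I^+,I^-)$ of database instances (not required a priori to satisfy the key constraints). Its semantics is $[\![W]\!]=\{I \mid I^+\subseteq I,\ I\cap I^-=\emptyset,\ \Gamma(I)\}$. $W$ is consistent iff $[\![W]\!]\ne\emptyset$. Write $W\models t^+$ iff $t\in I$ for all $I\in[\![W]\!]$, and $W\models t^-$ iff $t\notin I$ for all $I\in[\![W]\!]$. **Belief databases.** $U=\{1,\dots,m\}$ is the set of users. $\hat U^*$ is the set of finite words $w=w_{[1]}\cdots w_{[d]}$ over $U$ (including the empty word $\varepsilon$) with $w_{[i]}\neq w_{[i+1]}$ for all $i$; its elements are belief paths, and $|w|=d$ is the depth of $w$. A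 belief statement is an expression $\Box_w t^s$ with $w\in\hat U^*$, $t\in Tup$, $s\in\{+,-\}$; here $\Box_w=\Box_{w_{[1]}}\cdots\Box_{w_{[d]}}$, and $\Box_\varepsilon t^s$ is $t^s$. If $\varphi=\Box_w t^s$ and $i\in U$, then $\Box_i\varphi=\Box_{i\cdot w}t^s$. A belief database is a set $D$ of belief statements. For $w\in\hat U^*$, the explicit belief world at $w$ is $D_w=(I_w^+,I_w^-)$ with $I_w^+=\{t\mid\Box_w t^+\in D\}$ and $I_w^-=\{t\mid \Box_w t^-\in D\}$. $D$ is consistent iff $D_w$ is consistent for all $w\in\hat U^*$. **Closure and entailment.** Put $D^{(0)}=D$ and $$D^{(k+1)}=D^{(k)}\cup\{\Box_i\varphi\mid \varphi\in D^{(k)},\ i\in U,\ \text{the belief path of } \Box_i\varphi \text{ is in } \hat U^*,\ D^{(k)}\cup\{\Box_i\varphi\}\text{ is consistent}\}.$$ The theory (closure) of $D$ is $\bar D=\bigcup_{k\ge0}D^{(k)}$, and $\bar D_w$ denotes the belief world at $w$ of the belief database $\bar D$. $D$ entails a belief statement $\varphi$, written $D\models\varphi$, iff $\varphi\in\bar D$. **Kripke structures.** A rooted Kripke structure is $K=(V,(W_v)_{v\in V},(E_i)_{i\in U},v_0)$ with $V$ a finite set of states, $W_v$ a belief world for each $v\in V$, $E_i\subseteq V\times V$ a set of edges for each $i\in U$, and root $v_0\in V$. Entailment at a state is defined recursively: $(K,v)\models t^+$ if $W_v\models t^+$; $(K,v)\models t^-$ if $W_v\models t^-$; $(K,v)\models\Box_i\varphi$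 if $(K,v')\models\varphi$ for all $(v,v')\in E_i$. $K\models\varphi$ means $(K,v_0)\models\varphi$. **Canonical Kripke structure.** Let $Supp(D)=\{w\in\hat U^*\mid D_w\neq(\emptyset,\emptyset)\}$ and $States(D)=\{w\in\hat U^*\mid \exists u\in U^*: w\cdot u\in Supp(D)\}$. For $w\in\hat U^*$, let $SuffixStates(w)=\{v\in States(D)\mid\exists u\in U^*: u\cdot v=w\}$, and let $dss(w)$ (the deepest suffix state) be the element $v$ of $SuffixStates(w)$ with maximal $|v|$. The canonical Kripke structure of $D$ is $K(D)=(V,(\bar D_v)_{v\in V},(E_i)_{i\in U},\varepsilon)$ with $V=States(D)$ and $$E_i=\{(w,dss(w\cdot i))\mid w\in States(D),\ w\cdot i\in\hat U^*\}.$$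
   Formalization: D is assumed nonempty, and consistent in (1). (1) holds for every φ with entailment by the closure's world at w in place of D ⊨ φ, and literally except for negatives □_w t⁻ whose t key-conflicts with a positive in the closure at w. In (2), for d = 0 the bound is O(n + m). *)

theory Defs
  imports Main
begin

section \<open>Schemas, tuples and belief worlds\<close>

text \<open>The type \<open>'t\<close> is the set of all typed ground tuples of the schema, and \<open>rel_of\<close> gives the
  relation a tuple belongs to; this makes the sets \<open>Tup\<^sub>i\<close> pairwise disjoint.\<close>

record ('t, 'v) schema =
  nrel :: nat
  rel_of :: "'t \<Rightarrow> nat"
  key_of :: "'t \<Rightarrow> 'v"

definition wf_schema :: "('t, 'v) schema \<Rightarrow> bool" where
  "wf_schema S \<longleftrightarrow> (\<forall>t. rel_of S t \<in> {1..nrel S})"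

definition key_conflict :: "('t, 'v) schema \<Rightarrow> 't \<Rightarrow> 't \<Rightarrow> bool" where
  "key_conflict S t t' \<longleftrightarrow> t \<noteq> t' \<and> rel_of S t = rel_of S t' \<and> key_of S t = key_of S t'"

definition key_constraints :: "('t, 'v) schema \<Rightarrow> 't set \<Rightarrow> bool" where
  "key_constraints S I \<longleftrightarrow>
     (\<forall>t\<in>I. \<forall>t'\<in>I. rel_of S t = rel_of S t' \<and> t \<noteq> t' \<longrightarrow> key_of S t \<noteq> key_of S t')"

type_synonym 't world = "'t set \<times> 't set"

definition instances :: "('t, 'v) schema \<Rightarrow> 't world \<Rightarrow> 't set set" where
  "instances S W = {I. fst W \<subseteq> I \<and> I \<inter> snd W = {} \<and> key_constraints S I}"

datatype sign = Pos | Neg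

fun world_entails :: "('t, 'v) schema \<Rightarrow> 't world \<Rightarrow> 't \<Rightarrow> sign \<Rightarrow> bool" where
  "world_entails S W t Pos \<longleftrightarrow> (\<forall>I\<in>instances S W. t \<in> I)"
| "world_entails S W t Neg \<longleftrightarrow> (\<forall>I\<in>instances S W. t \<notin> I)"


section \<open>Belief databases and their closure\<close>

text \<open>\<open>paths m\<close> is the set of belief paths over the users \<open>{1..m}\<close>; the statement
  \<open>Stmt w t s\<close> stands for \<open>\<box>\<^sub>w t\<^sup>s\<close>.\<close>

definition paths :: "nat \<Rightarrow> nat list set" where
  "paths m = {w. set w \<subseteq> {1..m} \<and> (\<forall>i. Suc i < length w \<longrightarrow> w ! i \<noteq> w ! Suc i)}"

datatype 't stmt = Stmt (path_of: "nat list") (tuple_of: 't) (sign_of: sign)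

fun box :: "nat \<Rightarrow> 't stmt \<Rightarrow> 't stmt" where
  "box i (Stmt w t s) = Stmt (i # w) t s"

definition belief_db :: "nat \<Rightarrow> 't stmt set \<Rightarrow> bool" where
  "belief_db m D \<longleftrightarrow> path_of ` D \<subseteq> paths m"

definition world_at :: "'t stmt set \<Rightarrow> nat list \<Rightarrow> 't world" where
  "world_at D w = ({t. Stmt w t Pos \<in> D}, {t. Stmt w t Neg \<in> D})"

definition consistent :: "('t, 'v) schema \<Rightarrow> nat \<Rightarrow> 't stmt set \<Rightarrow> bool" where
  "consistent S m D \<longleftrightarrow> (\<forall>w\<in>paths m. instances S (world_at D w) \<noteq> {})"

primrec closure_step ::
  "('t, 'v) schema \<Rightarrow> nat \<Rightarrow> 't stmt set \<Rightarrow> nat \<Rightarrow> 't stmt set" where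
  "closure_step S m D 0 = D"
| "closure_step S m D (Suc k) = closure_step S m D k \<union>
     {box i \<phi> | i \<phi>. \<phi> \<in> closure_step S m D k \<and> i \<in> {1..m} \<and> path_of (box i \<phi>) \<in> paths m
        \<and> consistent S m (closure_step S m D k \<union> {box i \<phi>})}"

definition theory_of :: "('t, 'v) schema \<Rightarrow> nat \<Rightarrow> 't stmt set \<Rightarrow> 't stmt set" where
  "theory_of S m D = (\<Union>k. closure_step S m D k)"

definition entails :: "('t, 'v) schema \<Rightarrow> nat \<Rightarrow> 't stmt set \<Rightarrow> 't stmt \<Rightarrow> bool" where
  "entails S m D \<phi> \<longleftrightarrow> \<phi> \<in> theory_of S m D"


section \<open>Kripke structures\<close>

record ('s, 't) kripke =
  states :: "'s set"
  world :: "'s \<Rightarrow> 't world"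
  edges :: "nat \<Rightarrow> ('s \<times> 's) set"
  root :: 's

function entails_at :: "('t, 'v) schema \<Rightarrow> ('s, 't) kripke \<Rightarrow> 's \<Rightarrow> 't stmt \<Rightarrow> bool" where
  "entails_at S K v (Stmt [] t s) \<longleftrightarrow> world_entails S (world K v) t s"
| "entails_at S K v (Stmt (i # w) t s) \<longleftrightarrow>
     (\<forall>v'. (v, v') \<in> edges K i \<longrightarrow> entails_at S K v' (Stmt w t s))"
  by pat_completeness auto
termination
  by (relation "measure (\<lambda>(S, K, v, \<phi>). length (path_of \<phi>))") auto

definition kripke_entails :: "('t, 'v) schema \<Rightarrow> ('s, 't) kripke \<Rightarrow> 't stmt \<Rightarrow> bool" where
  "kripke_entails S K \<phi> \<longleftrightarrow> entails_at S K (root K) \<phi>"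

definition support :: "nat \<Rightarrow> 't stmt set \<Rightarrow> nat list set" where
  "support m D = {w \<in> paths m. world_at D w \<noteq> ({}, {})}"

definition db_states :: "nat \<Rightarrow> 't stmt set \<Rightarrow> nat list set" where
  "db_states m D = {w \<in> paths m. \<exists>u. w @ u \<in> support m D}"

definition suffix_states :: "nat \<Rightarrow> 't stmt set \<Rightarrow> nat list \<Rightarrow> nat list set" where
  "suffix_states m D w = {v \<in> db_states m D. \<exists>u. u @ v = w}"

definition dss :: "nat \<Rightarrow> 't stmt set \<Rightarrow> nat list \<Rightarrow> nat list" where
  "dss m D w = (ARG_MAX length v. v \<in> suffix_states m D w)"

definition canonical ::
  "('t, 'v) schema \<Rightarrow> nat \<Rightarrow> 't stmt set \<Rightarrow> (nat list, 't) kripke" where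
  "canonical S m D =
     \<lparr> states = db_states m D,
       world = world_at (theory_of S m D),
       edges = (\<lambda>i. {(w, dss m D (w @ [i])) | w. w \<in> db_states m D \<and> w @ [i] \<in> paths m}),
       root = [] \<rparr>"

definition depth :: "'t stmt set \<Rightarrow> nat" where
  "depth D = Max ((\<lambda>\<phi>. length (path_of \<phi>)) ` D)"


section \<open>A random access machine\<close>

text \<open>The uniform-cost random access machine with addition and truncated subtraction (no
  multiplication), with structured control flow.  The memory consists of arrays of natural
  numbers. Since array names are constants of the program, only finitely many arrays are used by a
  program, and they could be interleaved in one memory at the price of a constant factor.  Every
  operator, memory access and command costs one time unit.\<close>

type_synonym memory = "nat \<Rightarrow> nat \<Rightarrow> nat"

datatype exp = Num nat | Cell nat exp | Add exp exp | Sub exp exp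

primrec val :: "exp \<Rightarrow> memory \<Rightarrow> nat" where
  "val (Num n) \<sigma> = n"
| "val (Cell a e) \<sigma> = \<sigma> a (val e \<sigma>)"
| "val (Add e e') \<sigma> = val e \<sigma> + val e' \<sigma>"
| "val (Sub e e') \<sigma> = val e \<sigma> - val e' \<sigma>"

primrec cost :: "exp \<Rightarrow> nat" where
  "cost (Num n) = 1"
| "cost (Cell a e) = Suc (cost e)"
| "cost (Add e e') = Suc (cost e + cost e')"
| "cost (Sub e e') = Suc (cost e + cost e')"

text \<open>\<open>Store a e e'\<close> writes the value of \<open>e'\<close> to the cell of array \<open>a\<close> with index the value of \<open>e\<close>.
  Tests succeed on nonzero values.\<close>

datatype com = Skip | Store nat exp exp | Seq com com | If exp com com | While exp com

inductive exec :: "com \<Rightarrow> memory \<Rightarrow> nat \<Rightarrow> memory \<Rightarrow> bool" where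
  Skip: "exec Skip \<sigma> 1 \<sigma>"
| Store: "exec (Store a e e') \<sigma> (Suc (cost e + cost e'))
            (\<sigma>(a := (\<sigma> a)(val e \<sigma> := val e' \<sigma>)))"
| Seq: "\<lbrakk>exec c \<sigma> T \<sigma>'; exec c' \<sigma>' T' \<sigma>''\<rbrakk> \<Longrightarrow> exec (Seq c c') \<sigma> (Suc (T + T')) \<sigma>''"
| IfTrue: "\<lbrakk>val e \<sigma> \<noteq> 0; exec c \<sigma> T \<sigma>'\<rbrakk> \<Longrightarrow> exec (If e c c') \<sigma> (Suc (cost e + T)) \<sigma>'"
| IfFalse: "\<lbrakk>val e \<sigma> = 0; exec c' \<sigma> T \<sigma>'\<rbrakk> \<Longrightarrow> exec (If e c c') \<sigma> (Suc (cost e + T)) \<sigma>'"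
| WhileFalse: "val e \<sigma> = 0 \<Longrightarrow> exec (While e c) \<sigma> (Suc (cost e)) \<sigma>"
| WhileTrue: "\<lbrakk>val e \<sigma> \<noteq> 0; exec c \<sigma> T \<sigma>'; exec (While e c) \<sigma>' T' \<sigma>''\<rbrakk>
    \<Longrightarrow> exec (While e c) \<sigma> (Suc (cost e + T + T')) \<sigma>''"

text \<open>Input is supplied in array 0 and output is delivered in array 1; all other cells are
  initially 0.\<close>

definition runs :: "com \<Rightarrow> nat list \<Rightarrow> nat \<Rightarrow> nat list \<Rightarrow> bool" where
  "runs p xs T ys \<longleftrightarrow>
     (\<exists>\<sigma>. exec p (\<lambda>a k. if a = 0 \<and> k < length xs then xs ! k else 0) T \<sigma> \<and>
          (\<forall>k < length ys. \<sigma> 1 k = ys ! k))"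


section \<open>Belief databases and Kripke structures as machine data\<close>

text \<open>Tuples and key values are atomic data represented by numbers, \<open>tc\<close> and \<open>kc\<close> being the
  numberings.  A belief database is presented as a repetition-free list of its statements.\<close>

primrec sign_code :: "sign \<Rightarrow> nat" where
  "sign_code Pos = 1"
| "sign_code Neg = 0"

fun stmt_code ::
  "('t, 'v) schema \<Rightarrow> ('t \<Rightarrow> nat) \<Rightarrow> ('v \<Rightarrow> nat) \<Rightarrow> 't stmt \<Rightarrow> nat list" where
  "stmt_code S tc kc (Stmt w t s) =
     length w # w @ [sign_code s, rel_of S t, kc (key_of S t), tc t]"

definition db_code ::
  "('t, 'v) schema \<Rightarrow> ('t \<Rightarrow> nat) \<Rightarrow> ('v \<Rightarrow> nat) \<Rightarrow> nat \<Rightarrow> 't stmt list \<Rightarrow> nat list" where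
  "db_code S tc kc m xs = m # length xs # concat (map (stmt_code S tc kc) xs)"

text \<open>A Kripke structure with words as states is described by the number of states, the position of
  the root in an enumeration \<open>vs\<close> of the states, and for each state in turn: its word, the
  positive and the negative tuples of its world, and its outgoing edges, each given by its user and
  the position of its target.  Every list is preceded by its length.\<close>

definition state_code ::
  "('t \<Rightarrow> nat) \<Rightarrow> (nat list, 't) kripke \<Rightarrow> nat list list \<Rightarrow> nat list \<Rightarrow> nat list \<Rightarrow> bool" where
  "state_code tc K vs v ys \<longleftrightarrow>
     (\<exists>ps ns es.
        distinct ps \<and> set ps = tc ` fst (world K v) \<and>
        distinct ns \<and> set ns = tc ` snd (world K v) \<and>
        distinct es \<and> set es = {(i, j). j < length vs \<and> (v, vs ! j) \<in> edges K i} \<and>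
        ys = length v # v @ length ps # ps @ length ns # ns @
             length es # concat (map (\<lambda>(i, j). [i, j]) es))"

definition kripke_code ::
  "('t \<Rightarrow> nat) \<Rightarrow> (nat list, 't) kripke \<Rightarrow> nat list \<Rightarrow> bool" where
  "kripke_code tc K ys \<longleftrightarrow>
     (\<exists>vs r yss.
        distinct vs \<and> set vs = states K \<and> r < length vs \<and> vs ! r = root K \<and>
        length yss = length vs \<and>
        (\<forall>k < length vs. state_code tc K vs (vs ! k) (yss ! k)) \<and>
        ys = length vs # r # concat yss)"

end

theory Submission
  imports Defs "HOL-Library.Sublist"
begin

text \<open>For consistent \<open>D\<close>, the closure has at \<open>i # u\<close> the explicit statements at \<open>i # u\<close> together with
  all statements of the closure at \<open>u\<close> that do not contradict them. So the world at \<open>w\<close> is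
  determined by the explicit statements at the suffixes of \<open>w\<close>, where deeper suffixes take
  precedence, and it agrees with the world at the deepest suffix state. Following \<open>w\<close> in the
  canonical structure leads to exactly this state.

  The machine stores the states in a trie. For every state it marks the suffix states and then finds
  in three passes over the \<open>n\<close> statements which of them survive. This takes
  \<open>O(n + (d + 1)\<^sup>2 + m (d + 1))\<close> steps per state. The number \<open>N\<close> of states is at most \<open>1 + m^d\<close>,
  which bounds \<open>N n\<close>, and at most \<open>1 + n d\<close>, which bounds the other terms because polynomials in \<open>d\<close>
  are dominated by \<open>2^d\<close>, and \<open>d \<le> 1\<close> if \<open>m \<le> 1\<close>.\<close>

section \<open>Closure\<close>

text \<open>A closure step tests each candidate against the whole previous stage and then adds all
  admissible candidates at once. This stays tractable because inconsistency is always a clash of two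
  statements at one path, and a clash of two boxed statements at \<open>i # u\<close> is already a
  clash at \<open>u\<close>. Hence only explicit statements at \<open>i # u\<close> can stop
  inheritance.

  Membership in the closure is syntactic, entailment by a world is not: a positive tuple excludes
  every other tuple with its key, without any negative statement in the closure. The first claim is
  therefore proved for \<open>world_entails\<close> and transferred to \<open>entails\<close> under
  the assumption that no such key conflict makes a negative statement true.

  In the program, the codes of tuples, relations and key values serve directly as array addresses.
  They are unbounded, so arrays are never cleared as a whole, only at the cells that the
  \<open>n\<close> statements address. At depth 0 the root still has \<open>m\<close> loops to
  print, while \<open>m ^ 0 * n\<close> does not depend on \<open>m\<close>; this is the origin of
  the extra summand \<open>m\<close>.\<close>

lemma path_of_box [simp]: "path_of (box i \<phi>) = i # path_of \<phi>"
  by (cases \<phi>) auto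

lemma paths_suffix: "u @ v \<in> paths m \<Longrightarrow> v \<in> paths m"
proof -
  assume a: "u @ v \<in> paths m"
  have "v ! i \<noteq> v ! Suc i" if "Suc i < length v" for i
    using a that unfolding paths_def
    by (auto dest!: spec[where x = "length u + i"] simp: nth_append)
  with a show ?thesis by (auto simp: paths_def)
qed

lemma paths_prefix: "u @ v \<in> paths m \<Longrightarrow> u \<in> paths m"
proof -
  assume a: "u @ v \<in> paths m"
  have "u ! i \<noteq> u ! Suc i" if "Suc i < length u" for i
    using a that unfolding paths_def by (auto dest!: spec[where x = i] simp: nth_append)
  with a show ?thesis by (auto simp: paths_def)
qed

lemma Nil_in_paths [simp]: "[] \<in> paths m"
  by (simp add: paths_def)

lemma paths_tl: "i # w \<in> paths m \<Longrightarrow> w \<in> paths m"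
  using paths_suffix[of "[i]" w m] by simp

lemma paths_hd: "i # w \<in> paths m \<Longrightarrow> i \<in> {1..m}"
  by (auto simp: paths_def)

section \<open>Consistency as absence of conflicting pairs\<close>

fun conflict :: "('t, 'v) schema \<Rightarrow> 't stmt \<Rightarrow> 't stmt \<Rightarrow> bool" where
  "conflict S (Stmt w t s) (Stmt w' t' s') \<longleftrightarrow> w = w' \<and>
     (s = Pos \<and> s' = Pos \<and> key_conflict S t t' \<or> s \<noteq> s' \<and> t = t')"

lemma conflict_path: "conflict S x y \<Longrightarrow> path_of x = path_of y"
  by (cases x; cases y) auto

lemma conflict_sym: "conflict S x y \<Longrightarrow> conflict S y x"
  by (cases x; cases y) (auto simp: key_conflict_def)

lemma conflict_box: "conflict S (box i x) (box j y) \<longleftrightarrow> i = j \<and> conflict S x y"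
  by (cases x; cases y) auto

text \<open>Every instance contains \<open>fst W\<close>, and shrinking an instance preserves both
  disjointness from \<open>snd W\<close> and the key constraints, so \<open>fst W\<close> is the
  least candidate.\<close>

lemma instances_nonempty:
  "instances S W \<noteq> {} \<longleftrightarrow> fst W \<in> instances S W"
  by (fastforce simp: instances_def key_constraints_def)

lemma sign_neq: "s \<noteq> s' \<longleftrightarrow> s = Pos \<and> s' = Neg \<or> s = Neg \<and> s' = Pos"
  by (cases s; cases s') auto

text \<open>Testing only the least candidate, the positive part of each world, leaves conditions on
  pairs of statements at a common path. All later consistency arguments use this local form.\<close>

lemma consistent_iff:
  "consistent S m D \<longleftrightarrow> (\<forall>x\<in>D. \<forall>y\<in>D. path_of x \<in> paths m \<longrightarrow> \<not> conflict S x y)"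
proof
  assume c: "consistent S m D"
  have "\<not> conflict S (Stmt w t s) (Stmt w' t' s')"
    if "Stmt w t s \<in> D" "Stmt w' t' s' \<in> D" "w \<in> paths m" for w t s w' t' s'
  proof -
    have "fst (world_at D w) \<in> instances S (world_at D w)"
      using c that(3) by (auto simp: consistent_def instances_nonempty)
    with that show ?thesis
      by (auto simp: world_at_def instances_def key_constraints_def key_conflict_def sign_neq)
  qed
  then show "\<forall>x\<in>D. \<forall>y\<in>D. path_of x \<in> paths m \<longrightarrow> \<not> conflict S x y"
    by (metis stmt.collapse)
next
  assume nc: "\<forall>x\<in>D. \<forall>y\<in>D. path_of x \<in> paths m \<longrightarrow> \<not> conflict S x y"
  have "fst (world_at D w) \<in> instances S (world_at D w)" if w: "w \<in> paths m" for w
  proof -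
    have "\<not> conflict S (Stmt w t s) (Stmt w t' s')" 
      if "Stmt w t s \<in> D" "Stmt w t' s' \<in> D" for t s t' s'
      using nc that w by fastforce
    then show ?thesis
      by (fastforce simp: world_at_def instances_def key_constraints_def key_conflict_def)
  qed
  then show "consistent S m D"
    by (auto simp: consistent_def)
qed

lemma consistent_mono: "consistent S m D \<Longrightarrow> D' \<subseteq> D \<Longrightarrow> consistent S m D'"
  by (auto simp: consistent_iff subset_iff)

section \<open>Stages of the closure and inheritance from the tail of a path\<close>

lemma closure_step_mono: "k \<le> l \<Longrightarrow> closure_step S m D k \<subseteq> closure_step S m D l"
  by (rule lift_Suc_mono_le) auto

lemma theory_of_base: "D \<subseteq> theory_of S m D"
  unfolding theory_of_def using closure_step.simps(1)[of S m D] by blast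

text \<open>Supersets of an inconsistent database are inconsistent, so the test in the closure step
  always fails. This is the case for which the program carries a flag.\<close>

lemma theory_of_inconsistent:
  assumes "\<not> consistent S m D"
  shows "theory_of S m D = D"
proof -
  have "closure_step S m D k = D" for k
  proof (induction k)
    case (Suc k)
    have "\<not> consistent S m (D \<union> {x})" for x using assms consistent_mono by blast
    with Suc show ?case by auto
  qed simp
  then show ?thesis
    by (simp add: theory_of_def)
qed

text \<open>Additions are tested against the previous stage but not against each other. If two of
  them clashed, deleting their common first letter would give a clash inside the previous
  stage.\<close>

lemma closure_step_consistent:
  assumes "consistent S m D"
  shows "consistent S m (closure_step S m D k)"
proof (induction k)
  case (Suc k)
  let ?E = "closure_step S m D k"
  have new: "y \<in> ?E \<or> (\<exists>i \<phi>. y = box i \<phi> \<and> \<phi> \<in> ?E \<and> consistent S m (?E \<union> {y}))"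
    if "y \<in> closure_step S m D (Suc k)" for y
    using that by auto
  have "\<not> conflict S x y"
    if "x \<in> closure_step S m D (Suc k)" "y \<in> closure_step S m D (Suc k)" "path_of x \<in> paths m" for x y
  proof
    assume xy: "conflict S x y"
    note p = conflict_path[OF xy] conflict_sym[OF xy]
    from new[OF that(1)] new[OF that(2)] show False
    proof (elim disjE exE conjE)
      assume "x \<in> ?E" "y \<in> ?E" then show False using Suc xy that(3) by (auto simp: consistent_iff)
    next
      fix i \<phi> assume "x \<in> ?E" "consistent S m (?E \<union> {y})"
      then show False using xy that(3) by (auto simp: consistent_iff)
    next
      fix i \<phi> assume "y \<in> ?E" "consistent S m (?E \<union> {x})"
      then show False using xy that(3) by (auto simp: consistent_iff)
    next
      fix i \<phi> j \<psi> assume a: "x = box i \<phi>" "\<phi> \<in> ?E" "y = box j \<psi>" "\<psi> \<in> ?E"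
      then have "conflict S \<phi> \<psi>" using xy by (simp add: conflict_box)
      moreover have "path_of \<phi> \<in> paths m" using a that(3) by (auto intro: paths_tl)
      ultimately show False using Suc a by (auto simp: consistent_iff)
    qed
  qed
  then show ?case unfolding consistent_iff by blast
qed (simp add: assms)

lemma theory_of_consistent:
  assumes "consistent S m D"
  shows "consistent S m (theory_of S m D)"
  unfolding consistent_iff
proof (intro ballI impI)
  fix x y assume "x \<in> theory_of S m D" "y \<in> theory_of S m D" "path_of x \<in> paths m"
  then obtain k l where "x \<in> closure_step S m D k" "y \<in> closure_step S m D l"
    by (auto simp: theory_of_def)
  then have "x \<in> closure_step S m D (max k l)" "y \<in> closure_step S m D (max k l)"
    by (meson closure_step_mono max.cobounded1 max.cobounded2 subsetD)+
  with closure_step_consistent[OF assms, of "max k l"] \<open>path_of x \<in> paths m\<close>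
  show "\<not> conflict S x y" by (auto simp: consistent_iff)
qed

text \<open>The test passed when the statement enters some stage covers all of \<open>D\<close>,
  because \<open>D\<close> is contained in every stage.\<close>

lemma theory_of_cases:
  assumes "Stmt w t s \<in> theory_of S m D" "w \<in> paths m"
  shows "Stmt w t s \<in> D \<or> (\<exists>i u. w = i # u \<and> Stmt u t s \<in> theory_of S m D \<and>
     (\<forall>y\<in>D. \<not> conflict S (Stmt w t s) y))"
proof -
  obtain k where "Stmt w t s \<in> closure_step S m D k"
    using assms by (auto simp: theory_of_def)
  then show ?thesis
  proof (induction k)
    case (Suc k)
    show ?case
    proof (cases "Stmt w t s \<in> closure_step S m D k")
      case False
      then obtain i \<phi> where b: "Stmt w t s = box i \<phi>" "\<phi> \<in> closure_step S m D k"
        "consistent S m (closure_step S m D k \<union> {Stmt w t s})"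
        using Suc.prems by auto
      then obtain u where u: "\<phi> = Stmt u t s" "w = i # u" by (cases \<phi>) auto
      have "\<not> conflict S (Stmt w t s) y" if "y \<in> D" for y
        using b(3) closure_step_mono[of 0 k S m D] that assms(2) by (auto simp: consistent_iff)
      with b u show ?thesis by (auto simp: theory_of_def)
    qed (use Suc in auto)
  qed simp
qed

lemma theory_of_Nil: "Stmt [] t s \<in> theory_of S m D \<longleftrightarrow> Stmt [] t s \<in> D"
  using theory_of_cases[of "[]" t s S m D] theory_of_base[of D S m] by auto

text \<open>Replaces the stages by a recursion on the path. The work lies in the converse direction,
  where freedom from conflicts with \<open>D\<close> has to yield consistency with a whole
  stage.\<close>

lemma theory_of_Cons:
  assumes D: "consistent S m D" and w: "i # u \<in> paths m"
  shows "Stmt (i # u) t s \<in> theory_of S m D \<longleftrightarrow>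
     Stmt (i # u) t s \<in> D \<or>
     Stmt u t s \<in> theory_of S m D \<and> (\<forall>y\<in>D. \<not> conflict S (Stmt (i # u) t s) y)"
proof
  assume "Stmt (i # u) t s \<in> theory_of S m D"
  from theory_of_cases[OF this w] show "Stmt (i # u) t s \<in> D \<or>
     Stmt u t s \<in> theory_of S m D \<and> (\<forall>y\<in>D. \<not> conflict S (Stmt (i # u) t s) y)"
    by auto
next
  let ?x = "Stmt (i # u) t s"
  assume "?x \<in> D \<or> Stmt u t s \<in> theory_of S m D \<and> (\<forall>y\<in>D. \<not> conflict S ?x y)"
  then show "?x \<in> theory_of S m D"
  proof
    assume a: "Stmt u t s \<in> theory_of S m D \<and> (\<forall>y\<in>D. \<not> conflict S ?x y)"
    then obtain k where k: "Stmt u t s \<in> closure_step S m D k" by (auto simp: theory_of_def)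
    let ?E = "closure_step S m D k"
    \<comment> \<open>A member of the stage at \<open>i # u\<close> that is not explicit was
      inherited from \<open>u\<close>; a clash with it would already be a clash within the closure
      at \<open>u\<close>.\<close>
    have nc: "\<not> conflict S ?x y" if y: "y \<in> ?E" for y
    proof
      assume c: "conflict S ?x y"
      then obtain t' s' where y': "y = Stmt (i # u) t' s'" by (cases y) auto
      have "y \<in> theory_of S m D" using y by (auto simp: theory_of_def)
      with theory_of_cases[of "i # u" t' s' S m D] y' w c a
      have "Stmt u t' s' \<in> theory_of S m D" by auto
      moreover have "conflict S (Stmt u t s) (Stmt u t' s')" using c y' by auto
      moreover have "u \<in> paths m" using w by (rule paths_tl)
      ultimately show False
        using theory_of_consistent[OF D] a by (fastforce simp: consistent_iff)
    qed
    have "\<not> conflict S ?x ?x" by (simp add: key_conflict_def)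
    then have "consistent S m (?E \<union> {?x})"
      using closure_step_consistent[OF D, of k] nc conflict_sym
      unfolding consistent_iff by blast
    then have "?x \<in> closure_step S m D (Suc k)"
      using k w paths_hd[OF w] by (auto intro!: exI[of _ i] exI[of _ "Stmt u t s"])
    then show ?thesis unfolding theory_of_def by blast
  qed (use theory_of_base in blast)
qed

text \<open>A statement made at a suffix of \<open>w\<close> survives at \<open>w\<close> iff no deeper suffix decides its
  tuple or, for positive statements, its key. Repeating a statement at a deeper suffix
  blocks its shallower copy, so every member of the world at \<open>w\<close> has a unique witness.\<close>

fun blocks :: "('t, 'v) schema \<Rightarrow> 't stmt \<Rightarrow> 't stmt \<Rightarrow> bool" where
  "blocks S (Stmt u' t' s') (Stmt u t s) \<longleftrightarrow> length u < length u' \<and>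
     (s = Pos \<and> (s' = Pos \<and> rel_of S t' = rel_of S t \<and> key_of S t' = key_of S t
                 \<or> s' = Neg \<and> t' = t)
      \<or> s = Neg \<and> t' = t)"

definition survives :: "('t, 'v) schema \<Rightarrow> 't stmt set \<Rightarrow> nat list \<Rightarrow> 't stmt \<Rightarrow> bool" where
  "survives S D w x \<longleftrightarrow> x \<in> D \<and> suffix (path_of x) w \<and>
     (\<forall>y\<in>D. suffix (path_of y) w \<longrightarrow> \<not> blocks S y x)"

text \<open>Prepending a letter creates one new suffix, the whole word. Explicit statements there
  are deepest and hence unblocked, and inherited ones meet new blockers only there; this is what
  \<open>theory_of_Cons\<close> says.\<close>

lemma theory_of_survives:
  assumes "consistent S m D" "w \<in> paths m"
  shows "Stmt w t s \<in> theory_of S m D \<longleftrightarrow> (\<exists>u. survives S D w (Stmt u t s))"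
  using assms(2)
proof (induction w)
  case Nil
  show ?case
    by (auto simp: theory_of_Nil survives_def) (metis blocks.simps list.size(3) not_less0 stmt.collapse)
next
  case (Cons i w)
  note w = paths_tl[OF Cons.prems]
  note IH = Cons.IH[OF w]
  show ?case
  proof
    assume a: "Stmt (i # w) t s \<in> theory_of S m D"
    show "\<exists>u. survives S D (i # w) (Stmt u t s)"
    proof (cases "Stmt (i # w) t s \<in> D")
      case True
      have "\<not> blocks S y (Stmt (i # w) t s)" if "suffix (path_of y) (i # w)" for y
        using that suffix_length_le[OF that] by (cases y) auto
      with True have "survives S D (i # w) (Stmt (i # w) t s)" by (auto simp: survives_def)
      then show ?thesis ..
    next
      case False
      with a theory_of_Cons[OF assms(1) Cons.prems] IH obtain u where
        u: "survives S D w (Stmt u t s)" and nc: "\<forall>y\<in>D. \<not> conflict S (Stmt (i # w) t s) y" by auto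
      have "\<not> blocks S y (Stmt u t s)" if y: "y \<in> D" "suffix (path_of y) (i # w)" for y
      proof (cases "path_of y = i # w")
        case True
        then obtain t' s' where y': "y = Stmt (i # w) t' s'" by (cases y) auto
        with nc y(1) have "\<not> conflict S (Stmt (i # w) t s) (Stmt (i # w) t' s')" by blast
        \<comment> \<open>An exact repetition blocks without being a conflict; it is excluded
          because the statement is not explicit at \<open>i # w\<close>.\<close>
        moreover have "\<not> (t = t' \<and> s = s')" using False y(1) y' by blast
        ultimately show ?thesis using y' by (auto simp: key_conflict_def sign_neq)
      next
        case False
        then have "suffix (path_of y) w" using y(2) by (auto simp: suffix_Cons)
        with u y(1) show ?thesis by (auto simp: survives_def)
      qed
      with u have "survives S D (i # w) (Stmt u t s)" by (auto simp: survives_def suffix_Cons)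
      then show ?thesis ..
    qed
  next
    assume "\<exists>u. survives S D (i # w) (Stmt u t s)"
    then obtain u where u: "survives S D (i # w) (Stmt u t s)" ..
    show "Stmt (i # w) t s \<in> theory_of S m D"
    proof (cases "u = i # w")
      case True
      with u theory_of_base[of D S m] show ?thesis by (auto simp: survives_def)
    next
      case False
      then have su: "suffix u w" using u by (auto simp: survives_def suffix_Cons)
      then have "survives S D w (Stmt u t s)" using u by (auto simp: survives_def suffix_Cons)
      with IH have "Stmt w t s \<in> theory_of S m D" by auto
      moreover have "\<not> conflict S (Stmt (i # w) t s) y" if y: "y \<in> D" for y
      proof
        assume "conflict S (Stmt (i # w) t s) y"
        then have "suffix (path_of y) (i # w)" "blocks S y (Stmt u t s)"
          using suffix_length_le[OF su] by (cases y; auto simp: key_conflict_def sign_neq)+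
        with u y show False by (auto simp: survives_def)
      qed
      ultimately show ?thesis using theory_of_Cons[OF assms(1) Cons.prems] by auto
    qed
  qed
qed


section \<open>The canonical Kripke structure\<close>

lemma db_states_iff:
  assumes "belief_db m D"
  shows "w \<in> db_states m D \<longleftrightarrow> (\<exists>x\<in>D. prefix w (path_of x))"
proof
  assume "w \<in> db_states m D"
  then obtain u where "w @ u \<in> support m D" by (auto simp: db_states_def)
  then obtain t s where "Stmt (w @ u) t s \<in> D" by (auto simp: support_def world_at_def)
  then show "\<exists>x\<in>D. prefix w (path_of x)" by (auto intro!: bexI)
next
  assume "\<exists>x\<in>D. prefix w (path_of x)"
  then obtain u t s where x: "Stmt (w @ u) t s \<in> D" 
    by (metis prefixE stmt.collapse)
  then have p: "w @ u \<in> paths m" using assms by (force simp: belief_db_def)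
  with x have "w @ u \<in> support m D" by (cases s) (auto simp: support_def world_at_def)
  with paths_prefix[OF p] show "w \<in> db_states m D" by (auto simp: db_states_def)
qed

lemma db_states_butlast: "w @ u \<in> db_states m D \<Longrightarrow> w \<in> db_states m D"
  using paths_prefix by (auto simp: db_states_def)

lemma suffix_states_iff: "v \<in> suffix_states m D w \<longleftrightarrow> v \<in> db_states m D \<and> suffix v w"
  by (auto simp: suffix_states_def suffix_def)

text \<open>\<open>ARG_MAX\<close> is a Hilbert choice; its value is determined because suffixes of
  one word that have equal length coincide.\<close>

lemma dss_eqI:
  assumes "v \<in> db_states m D" "suffix v w"
    "\<And>u. u \<in> db_states m D \<Longrightarrow> suffix u w \<Longrightarrow> length u \<le> length v"
  shows "dss m D w = v"
proof -
  have "is_arg_max length (\<lambda>v. v \<in> suffix_states m D w) v"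
    using assms by (force simp: is_arg_max_def suffix_states_iff)
  then have "is_arg_max length (\<lambda>v. v \<in> suffix_states m D w) (dss m D w)"
    unfolding dss_def arg_max_def by (rule someI)
  then have "dss m D w \<in> db_states m D" "suffix (dss m D w) w" "\<not> length (dss m D w) < length v"
    using assms(1,2) by (auto simp: is_arg_max_def suffix_states_iff)
  with assms(3)[of "dss m D w"] assms(2) show ?thesis
    by (metis le_antisym not_less suffix_same_cases suffix_length_suffix
        suffix_order.antisym)
qed

lemma Nil_in_db_states: "belief_db m D \<Longrightarrow> D \<noteq> {} \<Longrightarrow> [] \<in> db_states m D"
  by (auto simp: db_states_iff)

lemma dss_exists:
  assumes "[] \<in> db_states m D"
  shows "dss m D w \<in> db_states m D" "suffix (dss m D w) w"
    "u \<in> db_states m D \<Longrightarrow> suffix u w \<Longrightarrow> length u \<le> length (dss m D w)"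
proof -
  let ?P = "\<lambda>v. v \<in> suffix_states m D w"
  have "?P []" using assms by (simp add: suffix_states_iff)
  moreover have "\<forall>v. ?P v \<longrightarrow> length v < Suc (length w)"
    by (auto simp: suffix_states_iff dest: suffix_length_le)
  ultimately have "?P (dss m D w) \<and> (\<forall>v. ?P v \<longrightarrow> length v \<le> length (dss m D w))"
    unfolding dss_def by (rule arg_max_nat_lemma)
  then show "dss m D w \<in> db_states m D" "suffix (dss m D w) w"
    "u \<in> db_states m D \<Longrightarrow> suffix u w \<Longrightarrow> length u \<le> length (dss m D w)"
    by (auto simp: suffix_states_iff)
qed

lemma dss_Nil: "[] \<in> db_states m D \<Longrightarrow> dss m D [] = []"
  using dss_exists(2)[of m D "[]"] by simp

text \<open>A nonempty state that is a suffix of \<open>w @ [i]\<close> has the form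
  \<open>y @ [i]\<close>. States are closed under prefixes, so \<open>y\<close> is a state and thus
  a suffix of \<open>dss m D w\<close>: passing to the deepest suffix state loses no
  candidate.\<close>

lemma dss_dss_snoc:
  assumes "[] \<in> db_states m D"
  shows "dss m D (dss m D w @ [i]) = dss m D (w @ [i])"
proof (rule dss_eqI)
  let ?v = "dss m D (w @ [i])"
  note d = dss_exists[OF assms]
  show v: "?v \<in> db_states m D" by (rule d)
  have le: "suffix x (dss m D w @ [i])" if x: "suffix x (w @ [i])" "x \<in> db_states m D" for x
  proof (cases x rule: rev_cases)
    case (snoc y j)
    with x have "suffix y w" "j = i" by auto
    moreover have "y \<in> db_states m D" using x(2) snoc db_states_butlast by blast
    ultimately have "suffix y (dss m D w)"
      using d(2)[of w] d(3)[of y w] suffix_length_suffix by blast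
    with snoc \<open>j = i\<close> show ?thesis by simp
  qed simp
  show "suffix ?v (dss m D w @ [i])" using le d by blast
  fix u assume u: "u \<in> db_states m D" "suffix u (dss m D w @ [i])"
  then have "suffix u (w @ [i])" using d(2)[of w] by (meson suffix_order.trans same_suffix_suffix)
  with u(1) d(3) show "length u \<le> length ?v" by blast
qed

text \<open>The path of every statement is itself a state, so the suffixes of \<open>w\<close> that
  carry statements are all suffixes of \<open>dss m D w\<close>, and \<open>survives\<close>
  inspects nothing else.\<close>

lemma theory_of_dss:
  assumes "consistent S m D" "belief_db m D" "[] \<in> db_states m D" "w \<in> paths m"
  shows "world_at (theory_of S m D) (dss m D w) = world_at (theory_of S m D) w"
proof -
  let ?v = "dss m D w"
  note d = dss_exists[OF assms(3)]
  have v: "?v \<in> paths m" using d(1) by (auto simp: db_states_def)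
  have "suffix (path_of x) w \<longleftrightarrow> suffix (path_of x) ?v" if "x \<in> D" for x
  proof
    assume a: "suffix (path_of x) w"
    have "path_of x \<in> db_states m D" using that assms(2) by (auto simp: db_states_iff)
    with a d show "suffix (path_of x) ?v" by (meson suffix_length_suffix)
  qed (use d(2) suffix_order.trans in blast)
  then have "survives S D w x = survives S D ?v x" for x
    by (auto simp: survives_def)
  then show ?thesis
    using theory_of_survives[OF assms(1)] v assms(4) by (auto simp: world_at_def)
qed

text \<open>Generalized over the part \<open>u\<close> of the word already read, after which the
  walk stands at \<open>dss m D u\<close>. Each step has exactly one successor, so the universal
  quantifier over edges is harmless.\<close>

lemma entails_at_canonical:
  assumes "[] \<in> db_states m D" "u @ w \<in> paths m"
  shows "entails_at S (canonical S m D) (dss m D u) (Stmt w t s) \<longleftrightarrow>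
     world_entails S (world_at (theory_of S m D) (dss m D (u @ w))) t s"
  using assms(2)
proof (induction w arbitrary: u)
  case Nil
  then show ?case by (simp add: canonical_def)
next
  case (Cons i w)
  \<comment> \<open>This guarantees that the edge exists; without it the modality would hold
    vacuously.\<close>
  have "dss m D u @ [i] \<in> paths m"
  proof -
    obtain a where a: "u = a @ dss m D u" using dss_exists(2)[OF assms(1)] by (auto simp: suffix_def)
    have "u @ [i] \<in> paths m" using paths_prefix[of "u @ [i]" w m] Cons.prems by simp
    then show ?thesis using paths_suffix[of a "dss m D u @ [i]" m] by (metis a append.assoc)
  qed
  then have "(dss m D u, v') \<in> edges (canonical S m D) i \<longleftrightarrow> v' = dss m D (u @ [i])" for v'
    using dss_exists(1)[OF assms(1), of u] dss_dss_snoc[OF assms(1)] by (auto simp: canonical_def)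
  then show ?case using Cons.IH[of "u @ [i]"] Cons.prems by simp
qed

lemma kripke_entails_canonical:
  assumes "consistent S m D" "belief_db m D" "D \<noteq> {}" "w \<in> paths m"
  shows "kripke_entails S (canonical S m D) (Stmt w t s) \<longleftrightarrow>
     world_entails S (world_at (theory_of S m D) w) t s"
proof -
  have n: "[] \<in> db_states m D" using assms by (simp add: Nil_in_db_states)
  show ?thesis
    using entails_at_canonical[OF n, of "[]" w S t s] dss_Nil[OF n] assms theory_of_dss[OF assms(1,2) n assms(4)]
    by (simp add: kripke_entails_def) (simp add: canonical_def)
qed

text \<open>The instance \<open>fst W\<close> refutes every other positive statement, and
  \<open>insert t (fst W)\<close> is an instance refuting the negative one unless \<open>t\<close>
  is forbidden or shares its key with a tuple of \<open>fst W\<close>.\<close>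

lemma world_entails_iff:
  assumes "instances S W \<noteq> {}"
  shows "world_entails S W t Pos \<longleftrightarrow> t \<in> fst W"
    and "world_entails S W t Neg \<longleftrightarrow> t \<in> snd W \<or> (\<exists>t'\<in>fst W. key_conflict S t t')"
proof -
  have i: "fst W \<in> instances S W" using assms by (simp add: instances_nonempty)
  show "world_entails S W t Pos \<longleftrightarrow> t \<in> fst W"
    using i by (auto simp: instances_def)
  have "insert t (fst W) \<in> instances S W" if "t \<notin> snd W" "\<not> (\<exists>t'\<in>fst W. key_conflict S t t')"
    using i that by (auto simp: instances_def key_constraints_def key_conflict_def)
  moreover have "t \<notin> I" if "t \<in> snd W \<or> (\<exists>t'\<in>fst W. key_conflict S t t')" "I \<in> instances S W" for I
    using that by (auto simp: instances_def key_constraints_def key_conflict_def)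
  ultimately show "world_entails S W t Neg \<longleftrightarrow> t \<in> snd W \<or> (\<exists>t'\<in>fst W. key_conflict S t t')"
    unfolding world_entails.simps by (metis insertI1)
qed

text \<open>The premise for \<open>Neg\<close> removes the second disjunct of
  \<open>world_entails_iff\<close>: from a single positive \<open>t'\<close> the structure also
  concludes the absence of each \<open>t\<close> with the same key, although no negative statement
  belongs to the closure.\<close>

lemma entails_iff_kripke_entails:
  assumes "consistent S m D" "belief_db m D" "D \<noteq> {}" "w \<in> paths m"
    and "s = Neg \<Longrightarrow> \<not> (\<exists>t'. key_conflict S t t' \<and> entails S m D (Stmt w t' Pos))"
  shows "entails S m D (Stmt w t s) \<longleftrightarrow> kripke_entails S (canonical S m D) (Stmt w t s)"
proof -
  let ?W = "world_at (theory_of S m D) w"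
  have "instances S ?W \<noteq> {}"
    using theory_of_consistent[OF assms(1)] assms(4) by (auto simp: consistent_def)
  from world_entails_iff[OF this, of t] show ?thesis
    unfolding kripke_entails_canonical[OF assms(1-4)]
    using assms(5) by (cases s) (auto simp: entails_def world_at_def)
qed

section \<open>Counting states\<close>

text \<open>Repeating the last letter up to length \<open>d\<close> is injective on nonempty belief paths, because
  in a belief path neighbouring letters differ.\<close>

lemma inj_on_pad:
  "inj_on (\<lambda>w. w @ replicate (d - length w) (last w)) {w \<in> paths m. w \<noteq> [] \<and> length w \<le> d}"
    (is "inj_on ?f ?A")
proof -
  have nth: "?f w ! k = last w" if "length w - 1 \<le> k" "k < d" "w \<in> ?A" for w k
    using that by (cases "k = length w - 1") (auto simp: nth_append last_conv_nth)
  have False if "?f w = ?f w'" "w \<in> ?A" "w' \<in> ?A" "length w < length w'" for w w'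
  proof -
    have "0 < length w" and le: "length w' \<le> d" using that by auto
    \<comment> \<open>Positions \<open>k\<close> and \<open>Suc k\<close> hold the last two letters
      of the longer word and lie in the constant tail of the padded shorter word, so these
      neighbours would be equal.\<close>
    define k where "k = length w' - 2"
    have k: "Suc k < length w'" "length w - 1 \<le> k" "Suc k < d"
      unfolding k_def using \<open>0 < length w\<close> \<open>length w < length w'\<close> le by linarith+
    have "?f w' ! k = ?f w' ! Suc k" using nth[of w k] nth[of w "Suc k"] k that by simp
    then have "w' ! k = w' ! Suc k" using k(1) by (simp add: nth_append)
    with k(1) that(3) show False by (auto simp: paths_def)
  qed
  then have "length w = length w'" if "?f w = ?f w'" "w \<in> ?A" "w' \<in> ?A" for w w'
    using that by (metis (no_types, lifting) nat_neq_iff)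
  then show ?thesis
    by (intro inj_onI) (metis (no_types, lifting) append_eq_append_conv)
qed

text \<open>The successor accounts for the empty word, which has no last letter to repeat.\<close>

lemma card_short_paths:
  "finite {w \<in> paths m. length w \<le> d}" "card {w \<in> paths m. length w \<le> d} \<le> Suc (m ^ d)"
proof -
  let ?A = "{w \<in> paths m. w \<noteq> [] \<and> length w \<le> d}"
  let ?L = "{w. set w \<subseteq> {1..m} \<and> length w = d}"
  let ?f = "\<lambda>w. w @ replicate (d - length w) (last w)"
  have sub: "?f ` ?A \<subseteq> ?L"
  proof
    fix y assume "y \<in> ?f ` ?A"
    then obtain w where w: "y = ?f w" "set w \<subseteq> {1..m}" "w \<noteq> []" "length w \<le> d"
      by (auto simp: paths_def)
    then have "last w \<in> {1..m}" using last_in_set by blast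
    with w show "y \<in> ?L" by auto
  qed
  have L: "finite ?L" "card ?L = m ^ d"
    using finite_lists_length_eq[of "{1..m}" d] card_lists_length_eq[of "{1..m}" d] by auto
  have fin: "finite ?A" by (rule inj_on_finite[OF inj_on_pad sub L(1)])
  have card: "card ?A \<le> m ^ d" using card_inj_on_le[OF inj_on_pad sub L(1)] L(2) by simp
  have eq: "{w \<in> paths m. length w \<le> d} = insert [] ?A" by auto
  show "finite {w \<in> paths m. length w \<le> d}" using fin by (simp add: eq)
  show "card {w \<in> paths m. length w \<le> d} \<le> Suc (m ^ d)"
    using fin card by (simp add: eq card_insert_if)
qed

lemma length_le_depth: "finite D \<Longrightarrow> x \<in> D \<Longrightarrow> length (path_of x) \<le> depth D"
  by (simp add: depth_def)

text \<open>States are prefixes of stated paths. They are thus short paths, and a nonempty one is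
  moreover determined by a statement and a prefix length.\<close>

lemma card_db_states:
  assumes "belief_db m D" "finite D" "D \<noteq> {}"
  shows "finite (db_states m D)" "card (db_states m D) \<le> Suc (m ^ depth D)"
    "card (db_states m D) \<le> Suc (card D * depth D)"
proof -
  have sub: "db_states m D \<subseteq> {w \<in> paths m. length w \<le> depth D}"
  proof
    fix w assume w: "w \<in> db_states m D"
    then obtain x where x: "x \<in> D" "prefix w (path_of x)" by (auto simp: db_states_iff[OF assms(1)])
    have "length w \<le> depth D"
      using length_le_depth[OF assms(2) x(1)] prefix_length_le[OF x(2)] by linarith
    with w show "w \<in> {w \<in> paths m. length w \<le> depth D}" by (simp add: db_states_def)
  qed
  show "finite (db_states m D)" using sub card_short_paths(1) finite_subset by blast
  show "card (db_states m D) \<le> Suc (m ^ depth D)"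
    using card_mono[OF card_short_paths(1) sub] card_short_paths(2) le_trans by blast
  have "db_states m D \<subseteq> insert [] ((\<lambda>(x, k). take k (path_of x)) ` (D \<times> {1..depth D}))"
  proof
    fix w assume "w \<in> db_states m D"
    then obtain x where x: "x \<in> D" "prefix w (path_of x)" by (auto simp: db_states_iff[OF assms(1)])
    then have "w = take (length w) (path_of x)" "length w \<le> depth D"
      using length_le_depth[OF assms(2) x(1)] prefix_length_le[OF x(2)]
      by (auto simp: prefix_def)
    with x(1) show "w \<in> insert [] ((\<lambda>(x, k). take k (path_of x)) ` (D \<times> {1..depth D}))"
      by (cases "w = []") (auto intro!: image_eqI[of _ _ "(x, length w)"] simp: Suc_le_eq simp del: length_take)
  qed
  then have "card (db_states m D) \<le> card (insert [] ((\<lambda>(x, k). take k (path_of x)) ` (D \<times> {1..depth D})))"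
    using assms(2) by (intro card_mono) auto
  also have "\<dots> \<le> Suc (card ((\<lambda>(x, k). take k (path_of x)) ` (D \<times> {1..depth D})))"
    by (simp add: card_insert_le_m1)
  also have "\<dots> \<le> Suc (card (D \<times> {1..depth D}))"
    using card_image_le[of "D \<times> {1..depth D}" "\<lambda>(x, k). take k (path_of x)"] assms(2) by simp
  finally show "card (db_states m D) \<le> Suc (card D * depth D)"
    by (simp add: card_cartesian_product)
qed

section \<open>Arithmetic of the time bound\<close>

text \<open>The factor 5 is forced by \<open>d = 1\<close>. Doubling dominates the growth of the
  square from \<open>d = 1\<close> on, so the first two values are settled directly.\<close>

lemma square_le_exp: "(d + 2)\<^sup>2 \<le> 5 * 2 ^ d" for d :: nat
proof (induction d)
  case (Suc d)
  show ?case
  proof (cases d)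
    case (Suc e)
    have "(Suc d + 2)\<^sup>2 \<le> 2 * (d + 2)\<^sup>2"
      unfolding Suc by (simp add: power2_eq_square algebra_simps)
    with Suc.IH show ?thesis by simp
  qed (simp add: power2_eq_square)
qed (simp add: power2_eq_square)

text \<open>The factor 8 is forced by \<open>d = 3\<close>, where equality holds and from where on
  doubling dominates the growth of the cube.\<close>

lemma cube_le_exp: "(d + 1) ^ 3 \<le> 8 * 2 ^ d" for d :: nat
proof (induction d)
  case (Suc d)
  show ?case
  proof (cases "d < 3")
    case False
    then obtain e where e: "d = e + 3" by (metis add.commute le_add_diff_inverse not_less)
    have "(Suc d + 1) ^ 3 \<le> 2 * (d + 1) ^ 3"
      unfolding e by (simp add: power3_eq_cube algebra_simps)
    with Suc.IH show ?thesis by simp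
  next
    case True
    then have "d = 0 \<or> d = 1 \<or> d = 2" by auto
    then show ?thesis by (auto simp: power3_eq_cube)
  qed
qed simp

text \<open>For \<open>d > 0\<close> the four products contribute 2 (reading), 2
  (\<open>N * n\<close>), 8 (\<open>N * (d + 1)\<^sup>2\<close>) and 5
  (\<open>N * m * (d + 1)\<close>) times \<open>m ^ d * n\<close>; hence 17. For
  \<open>d = 0\<close> there is just one state.\<close>

lemma time_bound:
  fixes m n d N :: nat
  assumes "0 < n" and d1: "d \<noteq> 0 \<Longrightarrow> 0 < m" and d2: "1 < d \<Longrightarrow> 1 < m"
    and "N \<le> Suc (m ^ d)" "N \<le> Suc (n * d)"
  shows "n * (d + 1) + N * (n + (d + 1)\<^sup>2 + m * (d + 1)) \<le> 17 * (m ^ d * n + (if d = 0 then m else 0))"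
proof (cases d)
  case 0
  then have "N \<le> 1" using assms by simp
  then have "N * (n + (d + 1)\<^sup>2 + m * (d + 1)) \<le> n + 1 + m" unfolding 0
    by (metis One_nat_def mult.commute mult.right_neutral mult_le_mono1 add_0 one_power2 mult_1)
  then show ?thesis using 0 assms(1) by simp
next
  case (Suc e)
  have m: "0 < m" using d1 Suc by simp
  have two: "2 ^ e \<le> m ^ e"
    using d2 Suc by (cases "e = 0") (auto intro: power_mono)
  have cube: "(d + 1) ^ 3 \<le> 8 * m ^ d"
  proof (cases e)
    case (Suc e')
    then have "2 \<le> m" using d2 \<open>d = Suc e\<close> by simp
    then have "2 ^ d \<le> m ^ d" by (rule power_mono) simp
    with cube_le_exp[of d] show ?thesis by linarith
  qed (use m Suc in \<open>simp add: power3_eq_cube\<close>)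
  \<comment> \<open>The exponential estimate is applied to \<open>e = d - 1\<close>; the factor
    \<open>m\<close> held back this way pays for the \<open>m\<close> on the left.\<close>
  have square: "(d + 1)\<^sup>2 * m \<le> 5 * m ^ d"
  proof -
    have "(d + 1)\<^sup>2 \<le> 5 * m ^ e" using square_le_exp[of e] two Suc by simp
    then show ?thesis using Suc mult_le_mono1[of "(d + 1)\<^sup>2" "5 * m ^ e" m] by (simp add: ac_simps)
  qed
  have "(d + 1) * 4 \<le> (d + 1) * (d + 1)\<^sup>2"
    using Suc by (intro mult_le_mono2) (simp add: power2_eq_square)
  also have "\<dots> = (d + 1) ^ 3" by (simp add: power3_eq_cube power2_eq_square)
  also note cube
  finally have lin: "d + 1 \<le> 2 * m ^ d" by simp
  have N: "N \<le> n * (d + 1)" using assms(1,5) by simp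
  have "N * n \<le> 2 * m ^ d * n"
    using assms(4) m by (intro mult_le_mono1) (metis One_nat_def Suc_leI add_Suc_right add_le_mono1
        le_trans mult_2 plus_1_eq_Suc zero_less_power)
  moreover have "N * (d + 1)\<^sup>2 \<le> n * (8 * m ^ d)"
  proof -
    have "N * (d + 1)\<^sup>2 \<le> n * (d + 1) * (d + 1)\<^sup>2" using N by (rule mult_le_mono1)
    also have "\<dots> = n * (d + 1) ^ 3" by (simp add: power3_eq_cube power2_eq_square algebra_simps)
    also have "\<dots> \<le> n * (8 * m ^ d)" using cube by simp
    finally show ?thesis .
  qed
  moreover have "N * (m * (d + 1)) \<le> n * (5 * m ^ d)"
  proof -
    have "N * (m * (d + 1)) \<le> n * (d + 1) * (m * (d + 1))" using N by (rule mult_le_mono1)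
    also have "\<dots> = n * ((d + 1)\<^sup>2 * m)" by (simp add: power2_eq_square algebra_simps)
    also have "\<dots> \<le> n * (5 * m ^ d)" using square by simp
    finally show ?thesis .
  qed
  moreover have "n * (d + 1) \<le> n * (2 * m ^ d)" using lin by (rule mult_le_mono2)
  ultimately have "n * (d + 1) + (N * n + N * (d + 1)\<^sup>2 + N * (m * (d + 1)))
      \<le> n * (2 * m ^ d) + (2 * m ^ d * n + n * (8 * m ^ d) + n * (5 * m ^ d))"
    by (intro add_mono)
  then show ?thesis using Suc by (simp only: distrib_left) (simp add: ac_simps)
qed

section \<open>Reasoning about timed programs\<close>

text \<open>The second argument of \<open>Q\<close> is the time elapsed so far, so time bounds are
  ordinary parts of invariants. Termination is included, since a finished execution is
  required.\<close>

definition wp :: "com \<Rightarrow> (memory \<Rightarrow> nat \<Rightarrow> bool) \<Rightarrow> memory \<Rightarrow> nat \<Rightarrow> bool" where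
  "wp c Q \<sigma> t \<longleftrightarrow> (\<exists>T \<sigma>'. exec c \<sigma> T \<sigma>' \<and> Q \<sigma>' (t + T))"

primrec writes :: "com \<Rightarrow> nat set" where
  "writes Skip = {}"
| "writes (Store a e e') = {a}"
| "writes (Seq c c') = writes c \<union> writes c'"
| "writes (If e c c') = writes c \<union> writes c'"
| "writes (While e c) = writes c"

definition same :: "nat set \<Rightarrow> memory \<Rightarrow> memory \<Rightarrow> bool" where
  "same A \<sigma> \<sigma>' \<longleftrightarrow> (\<forall>a. a \<notin> A \<longrightarrow> \<sigma>' a = \<sigma> a)"

lemma same_refl [simp]: "same A \<sigma> \<sigma>"
  by (simp add: same_def)

lemma exec_same: "exec c \<sigma> T \<sigma>' \<Longrightarrow> same (writes c) \<sigma> \<sigma>'"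
  by (induction rule: exec.induct) (auto simp: same_def)

inductive_cases exec_SkipE: "exec Skip \<sigma> T \<sigma>'"
inductive_cases exec_StoreE: "exec (Store a e e') \<sigma> T \<sigma>'"
inductive_cases exec_SeqE: "exec (Seq c c') \<sigma> T \<sigma>'"
inductive_cases exec_IfE: "exec (If e c c') \<sigma> T \<sigma>'"

lemma wp_Skip [simp]: "wp Skip Q \<sigma> t \<longleftrightarrow> Q \<sigma> (t + 1)"
proof -
  have "exec Skip \<sigma> T \<sigma>' \<longleftrightarrow> T = 1 \<and> \<sigma>' = \<sigma>" for T \<sigma>'
    by (metis exec.Skip exec_SkipE)
  then show ?thesis by (simp add: wp_def)
qed

lemma wp_Store [simp]:
  "wp (Store a e e') Q \<sigma> t \<longleftrightarrow>
     Q (\<sigma>(a := (\<sigma> a)(val e \<sigma> := val e' \<sigma>))) (t + Suc (cost e + cost e'))"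
proof -
  have "exec (Store a e e') \<sigma> T \<sigma>' \<longleftrightarrow> T = Suc (cost e + cost e') \<and>
      \<sigma>' = \<sigma>(a := (\<sigma> a)(val e \<sigma> := val e' \<sigma>))" for T \<sigma>'
    by (auto intro: exec.Store elim: exec_StoreE)
  then show ?thesis by (simp add: wp_def)
qed

lemma wp_Seq [simp]: "wp (Seq c c') Q \<sigma> t \<longleftrightarrow> wp c (wp c' (\<lambda>\<sigma>' t'. Q \<sigma>' (t' + 1))) \<sigma> t"
proof
  assume "wp (Seq c c') Q \<sigma> t"
  then obtain T \<sigma>'' where "exec (Seq c c') \<sigma> T \<sigma>''" "Q \<sigma>'' (t + T)"
    by (auto simp: wp_def)
  moreover from this(1) obtain T1 T2 \<sigma>' where "exec c \<sigma> T1 \<sigma>'" "exec c' \<sigma>' T2 \<sigma>''" "T = Suc (T1 + T2)"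
    by (rule exec_SeqE)
  ultimately show "wp c (wp c' (\<lambda>\<sigma>' t'. Q \<sigma>' (t' + 1))) \<sigma> t"
    unfolding wp_def by (intro exI[of _ T1] exI[of _ \<sigma>'] conjI exI[of _ T2] exI[of _ \<sigma>'']) (simp_all add: add.assoc)
next
  assume "wp c (wp c' (\<lambda>\<sigma>' t'. Q \<sigma>' (t' + 1))) \<sigma> t"
  then obtain T \<sigma>' T' \<sigma>'' where "exec c \<sigma> T \<sigma>'" "exec c' \<sigma>' T' \<sigma>''" "Q \<sigma>'' (t + T + T' + 1)"
    by (auto simp: wp_def)
  then show "wp (Seq c c') Q \<sigma> t"
    unfolding wp_def by (intro exI[of _ "Suc (T + T')"] exI[of _ \<sigma>'']) (auto simp: add.assoc intro: exec.Seq)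
qed

lemma wp_If [simp]:
  "wp (If e c c') Q \<sigma> t \<longleftrightarrow>
     (if val e \<sigma> \<noteq> 0 then wp c Q \<sigma> (t + Suc (cost e)) else wp c' Q \<sigma> (t + Suc (cost e)))"
proof -
  have "exec (If e c c') \<sigma> T \<sigma>' \<longleftrightarrow> (\<exists>T'. T = Suc (cost e + T') \<and>
      (if val e \<sigma> \<noteq> 0 then exec c \<sigma> T' \<sigma>' else exec c' \<sigma> T' \<sigma>'))" for T \<sigma>'
    by (auto intro: exec.IfTrue exec.IfFalse elim!: exec_IfE split: if_splits)
  then show ?thesis unfolding wp_def
    by (smt (verit) add.assoc add_Suc add_Suc_right)
qed

text \<open>The number of iterations is fixed in advance and indexes the invariant, so no separate
  variant is needed. The frame condition \<open>same\<close> supplies everything about arrays the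
  body does not write, which keeps invariants small.\<close>

lemma wp_while:
  assumes "I 0 \<sigma> t"
    and step: "\<And>k \<sigma>' t'. k < n \<Longrightarrow> same (writes c) \<sigma> \<sigma>' \<Longrightarrow> I k \<sigma>' t' \<Longrightarrow>
      val e \<sigma>' \<noteq> 0 \<and> wp c (I (Suc k)) \<sigma>' (t' + Suc (cost e))"
    and exit: "\<And>\<sigma>' t'. same (writes c) \<sigma> \<sigma>' \<Longrightarrow> I n \<sigma>' t' \<Longrightarrow>
      val e \<sigma>' = 0 \<and> Q \<sigma>' (t' + Suc (cost e))"
  shows "wp (While e c) Q \<sigma> t"
proof -
  have "wp (While e c) Q \<sigma>' t'" if "k \<le> n" "same (writes c) \<sigma> \<sigma>'" "I k \<sigma>' t'" for k \<sigma>' t'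
    using that
  proof (induction k arbitrary: \<sigma>' t' rule: inc_induct)
    case base
    with exit[of \<sigma>' t'] show ?case
      unfolding wp_def by (intro exI[of _ "Suc (cost e)"] exI[of _ \<sigma>']) (auto intro: exec.WhileFalse)
  next
    case (step k)
    with assms(2)[of k \<sigma>' t'] obtain T \<sigma>'' where v: "val e \<sigma>' \<noteq> 0" and e: "exec c \<sigma>' T \<sigma>''"
      and I: "I (Suc k) \<sigma>'' (t' + Suc (cost e) + T)"
      by (auto simp: wp_def)
    have "same (writes c) \<sigma> \<sigma>''"
      using exec_same[OF e] step.prems(1) by (auto simp: same_def)
    from step.IH[OF this I] obtain T' \<sigma>3 where "exec (While e c) \<sigma>'' T' \<sigma>3"
      "Q \<sigma>3 (t' + Suc (cost e) + T + T')" by (auto simp: wp_def)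
    with exec.WhileTrue[OF v e] show ?case
      unfolding wp_def
      by (intro exI[of _ "Suc (cost e + T + T')"] exI[of _ \<sigma>3]) (auto simp: add.assoc)
  qed
  from this[of 0 \<sigma> t] assms(1) show ?thesis by simp
qed

lemma wp_mono: "wp c Q \<sigma> t \<Longrightarrow> (\<And>\<sigma>' t'. same (writes c) \<sigma> \<sigma>' \<Longrightarrow> Q \<sigma>' t' \<Longrightarrow> R \<sigma>' t') \<Longrightarrow> wp c R \<sigma> t"
  unfolding wp_def using exec_same by blast

notation Seq (infixr ";;" 61)
notation Add (infixl "\<oplus>" 66)
notation Sub (infixl "\<ominus>" 66)

abbreviation var :: "nat \<Rightarrow> exp" where
  "var a \<equiv> Cell a (Num 0)"

abbreviation assign :: "nat \<Rightarrow> exp \<Rightarrow> com" (infix "::=" 63) where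
  "a ::= e \<equiv> Store a (Num 0) e"

abbreviation incr :: "nat \<Rightarrow> com" where
  "incr a \<equiv> a ::= var a \<oplus> Num 1"

section \<open>The arrays of the program\<close>

text \<open>Names with prefix \<open>v\<close> are scalar variables, arrays of which only cell 0 is used.
  A trie node \<open>x\<close> has its child for letter \<open>i\<close> in cell \<open>aBASE x + i\<close> of \<open>aCHILD\<close>, and its word starts
  in cell \<open>aSRC x\<close> of the input. The arrays \<open>aNODE\<close>, \<open>aSIGN\<close>, \<open>aPAIR\<close> (number of the pair of
  relation and key value) and \<open>aTUPLE\<close> describe the statements. While a state is processed,
  \<open>aSUFFIX\<close> holds the nodes of its suffixes by length, \<open>aLEVEL\<close> the levels of the nodes,
  and \<open>aKEYLEV\<close>, \<open>aPOSLEV\<close>, \<open>aNEGLEV\<close> the maximal levels of the positive statements with a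
  given pair and of the positive and the negative statements with a given tuple.\<close>

abbreviation (input) "aIN \<equiv> 0 :: nat"
abbreviation (input) "aOUT \<equiv> 1 :: nat"
abbreviation (input) "vOUT \<equiv> 2 :: nat"
abbreviation (input) "vNODES \<equiv> 3 :: nat"
abbreviation (input) "aBASE \<equiv> 4 :: nat"
abbreviation (input) "aCHILD \<equiv> 5 :: nat"
abbreviation (input) "aSRC \<equiv> 6 :: nat"
abbreviation (input) "aLEN \<equiv> 7 :: nat"
abbreviation (input) "aLAST \<equiv> 8 :: nat"
abbreviation (input) "vREL \<equiv> 9 :: nat"
abbreviation (input) "vKEY \<equiv> 10 :: nat"
abbreviation (input) "aRELID \<equiv> 11 :: nat"
abbreviation (input) "aKEYID \<equiv> 12 :: nat"
abbreviation (input) "aNODE \<equiv> 13 :: nat"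
abbreviation (input) "aSIGN \<equiv> 14 :: nat"
abbreviation (input) "aPAIR \<equiv> 15 :: nat"
abbreviation (input) "aTUPLE \<equiv> 16 :: nat"
abbreviation (input) "vPTR \<equiv> 17 :: nat"
abbreviation (input) "vSTMT \<equiv> 18 :: nat"
abbreviation (input) "vPOS \<equiv> 19 :: nat"
abbreviation (input) "vNODE \<equiv> 20 :: nat"
abbreviation (input) "vSLOT \<equiv> 21 :: nat"
abbreviation (input) "vCLASH \<equiv> 22 :: nat"
abbreviation (input) "vSTATE \<equiv> 23 :: nat"
abbreviation (input) "aKEYLEV \<equiv> 24 :: nat"
abbreviation (input) "aPOSLEV \<equiv> 25 :: nat"
abbreviation (input) "aNEGLEV \<equiv> 26 :: nat"
abbreviation (input) "aLEVEL \<equiv> 27 :: nat"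
abbreviation (input) "aSUFFIX \<equiv> 28 :: nat"
abbreviation (input) "vLEN \<equiv> 29 :: nat"
abbreviation (input) "aPOS \<equiv> 30 :: nat"
abbreviation (input) "vNPOS \<equiv> 31 :: nat"
abbreviation (input) "aNEG \<equiv> 32 :: nat"
abbreviation (input) "vNNEG \<equiv> 33 :: nat"
abbreviation (input) "aEDGE \<equiv> 34 :: nat"
abbreviation (input) "vNEDGE \<equiv> 35 :: nat"
abbreviation (input) "vUSER \<equiv> 36 :: nat"
abbreviation (input) "vTARGET \<equiv> 37 :: nat"

abbreviation (input) "eUSERS \<equiv> Cell aIN (Num 0)"
abbreviation (input) "eSTMTS \<equiv> Cell aIN (Num 1)"

section \<open>Positions in a list\<close>

text \<open>Counted from 1, so that 0, the initial content of all machine cells, can mean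
  absence.\<close>

definition ix :: "'a list \<Rightarrow> 'a \<Rightarrow> nat" where
  "ix xs x = (if x \<in> set xs then Suc (length (takeWhile (\<lambda>y. y \<noteq> x) xs)) else 0)"

lemma ix_eq_0 [simp]: "ix xs x = 0 \<longleftrightarrow> x \<notin> set xs"
  by (simp add: ix_def)

lemma ix_le: "ix xs x \<le> length xs"
proof (cases "x \<in> set xs")
  case True
  then obtain ys zs where "xs = ys @ x # zs" "x \<notin> set ys" by (meson split_list_first)
  moreover from this have "takeWhile (\<lambda>y. y \<noteq> x) (ys @ x # zs) = ys @ takeWhile (\<lambda>y. y \<noteq> x) (x # zs)"
    by (intro takeWhile_append2) auto
  ultimately show ?thesis by (simp add: ix_def)
qed (simp add: ix_def)

lemma nth_ix: "x \<in> set xs \<Longrightarrow> xs ! (ix xs x - 1) = x"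
proof -
  assume "x \<in> set xs"
  then obtain ys zs where "xs = ys @ x # zs" "x \<notin> set ys" by (meson split_list_first)
  moreover from this have "takeWhile (\<lambda>y. y \<noteq> x) (ys @ x # zs) = ys @ takeWhile (\<lambda>y. y \<noteq> x) (x # zs)"
    by (intro takeWhile_append2) auto
  ultimately show ?thesis by (simp add: ix_def)
qed

lemma ix_inj: "x \<in> set xs \<Longrightarrow> ix xs x = ix xs y \<longleftrightarrow> x = y"
  by (metis ix_eq_0 nth_ix)

lemma ix_nth: "distinct xs \<Longrightarrow> k < length xs \<Longrightarrow> ix xs (xs ! k) = Suc k"
proof -
  assume a: "distinct xs" "k < length xs"
  let ?j = "ix xs (xs ! k) - 1"
  have "xs ! k \<in> set xs" using a by simp
  then have "ix xs (xs ! k) \<noteq> 0" "xs ! ?j = xs ! k" using nth_ix by simp_all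
  moreover then have "?j < length xs" using ix_le[of xs "xs ! k"] by linarith
  ultimately have "?j = k" using a by (simp add: nth_eq_iff_index_eq)
  with \<open>ix xs (xs ! k) \<noteq> 0\<close> show ?thesis by linarith
qed

lemma ix_append [simp]: "x \<in> set xs \<Longrightarrow> ix (xs @ ys) x = ix xs x"
  by (simp add: ix_def)

lemma ix_snoc:
  "ix (xs @ [y]) x = (if x \<in> set xs then ix xs x else if x = y then Suc (length xs) else 0)"
proof (cases "x \<in> set xs")
  case False
  then have "takeWhile (\<lambda>z. z \<noteq> x) (xs @ [y]) = xs @ takeWhile (\<lambda>z. z \<noteq> x) [y]"
    by (intro takeWhile_append2) auto
  with False show ?thesis by (auto simp: ix_def)
qed simp

text \<open>Uniqueness of quotient and remainder. It separates the rows of the child table and also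
  decodes the pair numbers built from relations and key values.\<close>

lemma child_index_inj:
  fixes a b i j s :: nat
  assumes "a * s + i = b * s + j" "i < s" "j < s"
  shows "a = b" "i = j"
proof -
  have "(a * s + i) div s = a" "(b * s + j) div s = b" using assms(2,3) by simp_all
  with assms(1) show "a = b" by simp
  with assms(1) show "i = j" by simp
qed

section \<open>Reading the input and checking consistency\<close>

text \<open>Lacking multiplication, the machine gets the row of a new node by adding
  \<open>m + 1\<close> to the row of the previous node. A node's word is not copied: it is a prefix
  of the path being read, so a pointer into the input suffices.\<close>

definition insert_letter :: com where
  "insert_letter =
     vSLOT ::= Cell aBASE (var vNODE) \<oplus> Cell aIN (var vPTR \<oplus> Num 1 \<oplus> var vPOS) ;;
     If (Cell aCHILD (var vSLOT)) Skip
       (incr vNODES ;;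
        Store aCHILD (var vSLOT) (var vNODES) ;;
        Store aBASE (var vNODES) (Cell aBASE (var vNODES \<ominus> Num 1) \<oplus> eUSERS \<oplus> Num 1) ;;
        Store aSRC (var vNODES) (var vPTR \<oplus> Num 1) ;;
        Store aLEN (var vNODES) (var vPOS \<oplus> Num 1) ;;
        Store aLAST (var vNODES) (Cell aIN (var vPTR \<oplus> Num 1 \<oplus> var vPOS))) ;;
     vNODE ::= Cell aCHILD (var vSLOT) ;;
     incr vPOS"

definition insert_word :: com where
  "insert_word = vNODE ::= Num 1 ;; vPOS ::= Num 0 ;; While (Cell aIN (var vPTR) \<ominus> var vPOS) insert_letter"

definition read_atoms :: com where
  "read_atoms =
     vPTR ::= var vPTR \<oplus> Cell aIN (var vPTR) \<oplus> Num 1 ;;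
     Store aNODE (var vSTMT) (var vNODE) ;;
     Store aSIGN (var vSTMT) (Cell aIN (var vPTR)) ;;
     Store aTUPLE (var vSTMT) (Cell aIN (var vPTR \<oplus> Num 3)) ;;
     If (Cell aRELID (Cell aIN (var vPTR \<oplus> Num 1))) Skip
       (vREL ::= var vREL \<oplus> eSTMTS \<oplus> Num 1 ;; Store aRELID (Cell aIN (var vPTR \<oplus> Num 1)) (var vREL)) ;;
     If (Cell aKEYID (Cell aIN (var vPTR \<oplus> Num 2))) Skip
       (incr vKEY ;; Store aKEYID (Cell aIN (var vPTR \<oplus> Num 2)) (var vKEY)) ;;
     Store aPAIR (var vSTMT) (Cell aRELID (Cell aIN (var vPTR \<oplus> Num 1)) \<oplus> Cell aKEYID (Cell aIN (var vPTR \<oplus> Num 2))) ;;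
     vPTR ::= var vPTR \<oplus> Num 4 ;;
     incr vSTMT"

definition load :: com where
  "load = vNODES ::= Num 1 ;; Store aBASE (Num 1) (eUSERS \<oplus> Num 1) ;; vPTR ::= Num 2 ;; vSTMT ::= Num 0 ;;
     While (eSTMTS \<ominus> var vSTMT) (insert_word ;; read_atoms)"

lemma writes_insert_letter [simp]:
  "writes insert_letter = {vSLOT, vNODES, aCHILD, aBASE, aSRC, aLEN, aLAST, vNODE, vPOS}"
  by (auto simp: insert_letter_def)

lemma writes_insert_word [simp]:
  "writes insert_word = {vSLOT, vNODES, aCHILD, aBASE, aSRC, aLEN, aLAST, vNODE, vPOS}"
  by (auto simp: insert_word_def)

lemma writes_read_atoms [simp]:
  "writes read_atoms = {vPTR, aNODE, aSIGN, aTUPLE, vREL, aRELID, vKEY, aKEYID, aPAIR, vSTMT}"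
  by (auto simp: read_atoms_def)

section \<open>The input format and the construction of the trie\<close>

text \<open>Hides statements and schemas behind numeric sequences, so that the program proof speaks
  of numbers and words only. The 5 in \<open>off_Suc\<close> counts the length cell and the four
  atoms.\<close>

locale ram_input =
  fixes m n d :: nat and inp :: "nat \<Rightarrow> nat" and W :: "nat \<Rightarrow> nat list"
    and sg re ke tu off :: "nat \<Rightarrow> nat"
  assumes inp0 [simp]: "inp 0 = m" and inp1 [simp]: "inp 1 = n" and off0: "off 0 = 2"
    and off_Suc: "j < n \<Longrightarrow> off (Suc j) = off j + length (W j) + 5"
    and inp_len: "j < n \<Longrightarrow> inp (off j) = length (W j)"
    and inp_word: "j < n \<Longrightarrow> q < length (W j) \<Longrightarrow> inp (off j + 1 + q) = W j ! q"
    and inp_sg: "j < n \<Longrightarrow> inp (off j + length (W j) + 1) = sg j"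
    and inp_re: "j < n \<Longrightarrow> inp (off j + length (W j) + 2) = re j"
    and inp_ke: "j < n \<Longrightarrow> inp (off j + length (W j) + 3) = ke j"
    and inp_tu: "j < n \<Longrightarrow> inp (off j + length (W j) + 4) = tu j"
    and W_letters: "j < n \<Longrightarrow> set (W j) \<subseteq> {1..m}"
    and W_length: "j < n \<Longrightarrow> length (W j) \<le> d"
    and n_pos: "0 < n"
begin

lemma inp_Suc_0 [simp]: "inp (Suc 0) = n"
  using inp1 by simp

definition stride :: nat where
  "stride = m + 1"

lemma less_stride [simp]: "i < stride \<longleftrightarrow> i \<le> m"
  by (auto simp: stride_def)

text \<open>Node \<open>ix vs w\<close> of the trie represents the word \<open>w\<close>. Node 0 is a sink: all its
  children are 0, so walks need no test for failure.\<close>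

definition trie :: "memory \<Rightarrow> nat list list \<Rightarrow> bool" where
  "trie \<sigma> vs \<longleftrightarrow> distinct vs \<and> vs \<noteq> [] \<and> vs ! 0 = [] \<and> \<sigma> vNODES 0 = length vs \<and> \<sigma> aIN = inp \<and>
     (\<forall>w i. w @ [i] \<in> set vs \<longrightarrow> w \<in> set vs) \<and>
     (\<forall>w\<in>set vs. set w \<subseteq> {1..m}) \<and>
     (\<forall>k\<le>length vs. \<sigma> aBASE k = k * stride) \<and>
     (\<forall>k<length vs. \<sigma> aLEN (Suc k) = length (vs ! k) \<and>
        \<sigma> aLAST (Suc k) = (if vs ! k = [] then 0 else last (vs ! k)) \<and>
        (\<forall>q<length (vs ! k). inp (\<sigma> aSRC (Suc k) + q) = vs ! k ! q)) \<and>
     (\<forall>w. \<forall>i\<in>{1..m}. \<sigma> aCHILD (ix vs w * stride + i) = ix vs (w @ [i])) \<and>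
     (\<forall>z\<ge>(length vs + 1) * stride. \<sigma> aCHILD z = 0)"

lemma trie_same: "trie \<sigma> vs \<Longrightarrow> (\<And>a. a \<in> {aIN, vNODES, aBASE, aCHILD, aSRC, aLEN, aLAST} \<Longrightarrow> \<sigma>' a = \<sigma> a) \<Longrightarrow> trie \<sigma>' vs"
  by (simp add: trie_def)

text \<open>Only one child cell changes. The row of the new node is still blank, which is right
  because a child of \<open>w @ [i]\<close> among the old words would force \<open>w @ [i]\<close>
  itself to be there.\<close>

lemma trie_snoc:
  assumes t: "trie \<sigma> vs" and w: "w \<in> set vs" and i: "i \<in> {1..m}" and new: "w @ [i] \<notin> set vs"
    and N: "\<sigma>' vNODES 0 = Suc (length vs)" and inp: "\<sigma>' aIN = inp"
    and CH: "\<sigma>' aCHILD = (\<sigma> aCHILD)(ix vs w * stride + i := Suc (length vs))"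
    and NB: "\<sigma>' aBASE = (\<sigma> aBASE)(Suc (length vs) := Suc (length vs) * stride)"
    and LEN: "\<sigma>' aLEN = (\<sigma> aLEN)(Suc (length vs) := Suc (length w))"
    and LAST: "\<sigma>' aLAST = (\<sigma> aLAST)(Suc (length vs) := i)"
    and SRC: "\<sigma>' aSRC = (\<sigma> aSRC)(Suc (length vs) := p)"
    and p: "\<And>q. q < Suc (length w) \<Longrightarrow> inp (p + q) = (w @ [i]) ! q"
  shows "trie \<sigma>' (vs @ [w @ [i]])"
proof -
  let ?u = "w @ [i]" let ?N = "length vs" let ?vs = "vs @ [?u]"
  have pc: "\<And>w i. w @ [i] \<in> set vs \<Longrightarrow> w \<in> set vs" and zero: "\<And>z. z\<ge>(?N + 1) * stride \<Longrightarrow> \<sigma> aCHILD z = 0"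
    and ch: "\<And>w i. i\<in>{1..m} \<Longrightarrow> \<sigma> aCHILD (ix vs w * stride + i) = ix vs (w @ [i])"
    and letters: "\<And>w. w\<in>set vs \<Longrightarrow> set w \<subseteq> {1..m}"
    using t by (auto simp: trie_def)
  have "\<sigma>' aCHILD (ix ?vs w' * stride + i') = ix ?vs (w' @ [i'])" if i': "i' \<in> {1..m}" for w' i'
  proof (cases "w' = ?u")
    case True
    have ne: "ix vs w \<noteq> Suc ?N" using ix_le[of vs w] by simp
    have "?u @ [i'] \<notin> set vs" using new pc by blast
    moreover have "\<sigma> aCHILD (Suc ?N * stride + i') = 0" by (rule zero) (simp add: add.assoc)
    moreover have "Suc ?N * stride + i' \<noteq> ix vs w * stride + i"
      using child_index_inj(1)[of "Suc ?N" stride i' "ix vs w" i] i i' ne by auto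
    ultimately show ?thesis using True new by (simp add: CH ix_snoc del: mult_Suc)
  next
    case False
    then have eq: "ix ?vs w' = ix vs w'" by (simp add: ix_snoc ix_def)
    have "ix vs w' * stride + i' = ix vs w * stride + i \<longleftrightarrow> w' = w \<and> i' = i"
      using child_index_inj[of "ix vs w'" stride i' "ix vs w" i] i i' ix_inj[OF w, of w'] by auto
    then show ?thesis unfolding eq using ch[OF i', of w'] new by (auto simp: CH ix_snoc)
  qed
  moreover have "\<sigma>' aCHILD z = 0" if z: "z \<ge> (length ?vs + 1) * stride" for z
  proof -
    have "ix vs w * stride \<le> ?N * stride" using ix_le[of vs w] by (rule mult_le_mono1)
    then have "z \<noteq> ix vs w * stride + i" using z i by (auto simp: stride_def)
    moreover have "\<sigma> aCHILD z = 0" using z by (intro zero) auto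
    ultimately show ?thesis by (simp add: CH)
  qed
  moreover have "\<forall>k<length ?vs. \<sigma>' aLEN (Suc k) = length (?vs ! k) \<and>
        \<sigma>' aLAST (Suc k) = (if ?vs ! k = [] then 0 else last (?vs ! k)) \<and>
        (\<forall>q<length (?vs ! k). inp (\<sigma>' aSRC (Suc k) + q) = ?vs ! k ! q)"
    using t p by (auto simp: trie_def LEN LAST SRC nth_append less_Suc_eq)
  moreover have "\<forall>k\<le>length ?vs. \<sigma>' aBASE k = k * stride"
    using t by (auto simp: trie_def NB le_Suc_eq)
  moreover have "\<forall>w'\<in>set ?vs. set w' \<subseteq> {1..m}" using letters[OF w] i letters by auto
  moreover have "\<forall>w i. w @ [i] \<in> set ?vs \<longrightarrow> w \<in> set ?vs" using pc w by auto
  moreover have "distinct ?vs" "?vs \<noteq> []" "?vs ! 0 = []"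
    using t new by (auto simp: trie_def nth_append)
  ultimately show ?thesis unfolding trie_def using N inp by simp
qed

lemma wp_insert_word:
  assumes "trie \<sigma> vs" "j < n" "\<sigma> vPTR 0 = off j"
    and post: "\<And>\<sigma>' t' us. same (writes insert_word) \<sigma> \<sigma>' \<Longrightarrow> trie \<sigma>' (vs @ us) \<Longrightarrow>
       set us \<subseteq> {w. prefix w (W j)} \<Longrightarrow> W j \<in> set (vs @ us) \<Longrightarrow> \<sigma>' vNODE 0 = ix (vs @ us) (W j) \<Longrightarrow>
       t' \<le> t + 200 * (d + 1) \<Longrightarrow> Q \<sigma>' t'"
  shows "wp insert_word Q \<sigma> t"
proof -
  note j = inp_len[OF assms(2)] inp_word[OF assms(2)]
  define I where "I k \<sigma>' t' \<longleftrightarrow> \<sigma>' vPOS 0 = k \<and> t' \<le> t + 10 + 100 * k \<and>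
     (\<exists>us. trie \<sigma>' (vs @ us) \<and> set us \<subseteq> {w. prefix w (W j)} \<and> take k (W j) \<in> set (vs @ us) \<and>
        \<sigma>' vNODE 0 = ix (vs @ us) (take k (W j)))" for k \<sigma>' t'
  show ?thesis
    unfolding insert_word_def wp_Seq wp_Store
  proof (rule wp_while[where I = I and n = "length (W j)"], goal_cases)
    case 1
    have v0: "vs \<noteq> []" "vs ! 0 = []" "distinct vs" using assms(1) by (auto simp: trie_def)
    then have "[] \<in> set vs" "ix vs [] = 1" using ix_nth[of vs 0] nth_mem[of 0 vs] by auto
    then show ?case
      unfolding I_def by (auto intro!: exI[of _ "[]"] trie_same[OF assms(1)])
  next
    case (2 k \<sigma>' t')
    then have s: "\<sigma>' vPTR 0 = off j" by (simp add: same_def assms)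
    from 2(3) obtain us where us: "trie \<sigma>' (vs @ us)" "set us \<subseteq> {w. prefix w (W j)}"
      "take k (W j) \<in> set (vs @ us)" "\<sigma>' vNODE 0 = ix (vs @ us) (take k (W j))"
      and q: "\<sigma>' vPOS 0 = k" and t': "t' \<le> t + 10 + 100 * k" by (auto simp: I_def)
    let ?vs = "vs @ us" let ?w = "take k (W j)" let ?i = "W j ! k"
    have inp: "\<sigma>' 0 = inp" "\<sigma>' vNODES 0 = length ?vs" using us(1) by (auto simp: trie_def)
    have i: "?i \<in> {1..m}" using W_letters[OF assms(2)] 2(1) nth_mem by blast
    have letter: "inp (Suc (off j + k)) = ?i" using j(2) 2(1) by simp
    have nb: "\<sigma>' aBASE (ix ?vs ?w) = ix ?vs ?w * stride" "\<sigma>' aBASE (length ?vs) = length ?vs * stride"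
      using us(1) ix_le[of ?vs ?w] by (auto simp: trie_def)
    have ch: "\<sigma>' aCHILD (ix ?vs ?w * stride + ?i) = ix ?vs (?w @ [?i])"
      using us(1) i by (simp add: trie_def)
    have tk: "take (Suc k) (W j) = ?w @ [?i]" using 2(1) by (simp add: take_Suc_conv_app_nth)
    show ?case
    proof (intro conjI)
      show "val (Cell aIN (var vPTR) \<ominus> var vPOS) \<sigma>' \<noteq> 0" using inp s q j(1) 2(1) by simp
      show "wp insert_letter (I (Suc k)) \<sigma>' (t' + Suc (cost (Cell aIN (var vPTR) \<ominus> var vPOS)))"
      proof (cases "?w @ [?i] \<in> set ?vs")
        case True
        then have "ix ?vs (?w @ [?i]) \<noteq> 0" by simp
        note [simp del] = ix_eq_0
        show ?thesis unfolding insert_letter_def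
          using \<open>ix ?vs (?w @ [?i]) \<noteq> 0\<close> t'
          apply (simp add: inp s q us(4) letter nb ch)
          unfolding I_def tk
          using us(2) True by (auto intro!: exI[of _ us] trie_same[OF us(1)] simp del: append_assoc)
      next
        case False
        then have z: "ix ?vs (?w @ [?i]) = 0" by simp
        have pre: "prefix (?w @ [?i]) (W j)" using tk by (metis take_is_prefix)
        have lw: "length ?w = k" using 2(1) by simp
        have new: "ix ?vs (?w @ [?i]) = 0 \<Longrightarrow> ix (vs @ us @ [?w @ [?i]]) (?w @ [?i]) = Suc (length ?vs)"
          using False ix_snoc[of ?vs "?w @ [?i]" "?w @ [?i]"] by simp
        note [simp del] = ix_eq_0
        have p: "inp (Suc (off j + q)) = (?w @ [?i]) ! q" if "q < Suc (length ?w)" for q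
          using that j(2)[of q] 2(1) unfolding lw by (auto simp: nth_append less_Suc_eq)
        show ?thesis unfolding insert_letter_def
          using z t'
          apply (simp add: inp s q us(4) letter nb ch)
          unfolding I_def tk
          apply (intro conjI)
            apply simp
           apply simp
          apply (rule exI[of _ "us @ [?w @ [?i]]"])
          apply (intro conjI)
             apply (simp only: append_assoc[symmetric])
             apply (rule trie_snoc[OF us(1) us(3) i False, where p = "Suc (off j)"])
          using p lw us(2) pre new by (auto simp: stride_def inp nb(2)[unfolded length_append])
      qed
    qed
  next
    case (3 \<sigma>' t')
    then have "\<sigma>' vPTR 0 = off j" by (simp add: same_def assms)
    moreover from 3(2) obtain us where us: "trie \<sigma>' (vs @ us)" "set us \<subseteq> {w. prefix w (W j)}"
      "W j \<in> set (vs @ us)" "\<sigma>' vNODE 0 = ix (vs @ us) (W j)"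
      and q: "\<sigma>' vPOS 0 = length (W j)" and t': "t' \<le> t + 10 + 100 * length (W j)" by (auto simp: I_def)
    moreover have "same (writes insert_word) \<sigma> \<sigma>'" using 3(1) by (auto simp: same_def)
    moreover have "\<sigma>' 0 = inp" using us(1) by (auto simp: trie_def)
    moreover have "t' + 10 \<le> t + 200 * (d + 1)" using t' W_length[OF assms(2)] by simp
    ultimately show ?case using j(1) by (auto intro!: post[of _ us])
  qed
qed

end

text \<open>All these cells are later read only through the pair, tuple or node of some statement,
  so one pass over the statements erases every trace of the previous state that could be
  seen.\<close>

definition reset :: com where
  "reset = vSTMT ::= Num 0 ;; While (eSTMTS \<ominus> var vSTMT)
     (Store aKEYLEV (Cell aPAIR (var vSTMT)) (Num 0) ;; Store aPOSLEV (Cell aTUPLE (var vSTMT)) (Num 0) ;;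
      Store aNEGLEV (Cell aTUPLE (var vSTMT)) (Num 0) ;; Store aLEVEL (Cell aNODE (var vSTMT)) (Num 0) ;; incr vSTMT)"

text \<open>The sum of the two truncated differences is zero exactly for equal numbers.
  \<open>vCLASH\<close> adds up the marks found, so it becomes nonzero at the first clash and stays
  so.\<close>

definition check_step :: com where
  "check_step =
     If ((Cell aNODE (var vSTMT) \<ominus> var vSTATE) \<oplus> (var vSTATE \<ominus> Cell aNODE (var vSTMT))) Skip
       (If (Cell aSIGN (var vSTMT))
          (vCLASH ::= var vCLASH \<oplus> Cell aKEYLEV (Cell aPAIR (var vSTMT)) \<oplus> Cell aNEGLEV (Cell aTUPLE (var vSTMT)) ;;
           Store aKEYLEV (Cell aPAIR (var vSTMT)) (Num 1) ;; Store aPOSLEV (Cell aTUPLE (var vSTMT)) (Num 1))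
          (vCLASH ::= var vCLASH \<oplus> Cell aPOSLEV (Cell aTUPLE (var vSTMT)) ;; Store aNEGLEV (Cell aTUPLE (var vSTMT)) (Num 1))) ;;
     incr vSTMT"

definition check_state :: com where
  "check_state = reset ;; vSTMT ::= Num 0 ;; While (eSTMTS \<ominus> var vSTMT) check_step"

definition check :: com where
  "check = vCLASH ::= Num 0 ;; vSTATE ::= Num 1 ;;
     While (var vNODES \<oplus> Num 1 \<ominus> var vSTATE) (check_state ;; incr vSTATE)"

lemma writes_reset [simp]: "writes reset = {vSTMT, aKEYLEV, aPOSLEV, aNEGLEV, aLEVEL}"
  by (auto simp: reset_def)

lemma writes_check_step [simp]: "writes check_step = {vCLASH, aKEYLEV, aPOSLEV, aNEGLEV, vSTMT}"
  by (auto simp: check_step_def)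

lemma writes_check_state [simp]: "writes check_state = {vCLASH, aKEYLEV, aPOSLEV, aNEGLEV, vSTMT, aLEVEL}"
  by (auto simp: check_state_def)

lemma writes_load [simp]: "writes load = {vSLOT, vNODES, aCHILD, aBASE, aSRC, aLEN, aLAST, vNODE, vPOS,
    vPTR, aNODE, aSIGN, aTUPLE, vREL, aRELID, vKEY, aKEYID, aPAIR, vSTMT}"
  by (auto simp: load_def)

lemma writes_check [simp]: "writes check = {vCLASH, aKEYLEV, aPOSLEV, aNEGLEV, vSTMT, aLEVEL, vSTATE}"
  by (auto simp: check_def)

context ram_input
begin

text \<open>Relations get distinct multiples of \<open>n + 1\<close> and key values distinct numbers up to \<open>n\<close>, so
  that the sum identifies the pair.\<close>

definition distinct_values :: "(nat \<Rightarrow> nat) \<Rightarrow> bool" where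
  "distinct_values f \<longleftrightarrow> inj_on f {x. f x \<noteq> 0}"

lemma distinct_valuesD: "distinct_values f \<Longrightarrow> f x = f y \<Longrightarrow> f x \<noteq> 0 \<Longrightarrow> x = y"
  by (simp add: distinct_values_def inj_on_def)

lemma distinct_values_upd:
  "distinct_values f \<Longrightarrow> (\<And>x. f x \<noteq> c) \<Longrightarrow> distinct_values (f(x := c))"
  by (auto simp: distinct_values_def inj_on_def)

lemma distinct_values_0 [simp]: "distinct_values (\<lambda>_. 0)"
  by (simp add: distinct_values_def)

definition pairs :: "memory \<Rightarrow> nat \<Rightarrow> bool" where
  "pairs \<sigma> k \<longleftrightarrow>
     distinct_values (\<sigma> aRELID) \<and> distinct_values (\<sigma> aKEYID) \<and>
     (\<forall>x. (n + 1) dvd \<sigma> aRELID x \<and> \<sigma> aRELID x \<le> \<sigma> vREL 0) \<and> (n + 1) dvd \<sigma> vREL 0 \<and>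
     (\<forall>x. \<sigma> aKEYID x \<le> \<sigma> vKEY 0) \<and> \<sigma> vKEY 0 \<le> k \<and>
     (\<forall>j<k. \<sigma> aRELID (re j) \<noteq> 0 \<and> \<sigma> aKEYID (ke j) \<noteq> 0 \<and> \<sigma> aPAIR j = \<sigma> aRELID (re j) + \<sigma> aKEYID (ke j))"

lemma pairs_same:
  "pairs \<sigma> k \<Longrightarrow> (\<And>a. a \<in> {vREL, aRELID, vKEY, aKEYID, aPAIR} \<Longrightarrow> \<sigma>' a = \<sigma> a) \<Longrightarrow> pairs \<sigma>' k"
  by (simp add: pairs_def)

text \<open>Each statement introduces at most one new key number, so these stay at most
  \<open>n\<close>, and the sum is a numeral in base \<open>n + 1\<close> with the key number as
  last digit.\<close>

lemma pairs_inj: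
  assumes p: "pairs \<sigma> n" and j: "j < n" "j' < n"
  shows "\<sigma> aPAIR j = \<sigma> aPAIR j' \<longleftrightarrow> re j = re j' \<and> ke j = ke j'"
proof
  assume eq: "\<sigma> aPAIR j = \<sigma> aPAIR j'"
  obtain a b where ab: "\<sigma> aRELID (re j) = (n + 1) * a" "\<sigma> aRELID (re j') = (n + 1) * b"
    using p unfolding pairs_def by (meson dvdE)
  have le: "\<sigma> aKEYID (ke j) \<le> n" "\<sigma> aKEYID (ke j') \<le> n" using p by (auto simp: pairs_def intro: le_trans)
  have "a * (n + 1) + \<sigma> aKEYID (ke j) = b * (n + 1) + \<sigma> aKEYID (ke j')"
    using eq p j ab by (simp add: pairs_def mult.commute)
  then have "\<sigma> aRELID (re j) = \<sigma> aRELID (re j')" "\<sigma> aKEYID (ke j) = \<sigma> aKEYID (ke j')"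
    using child_index_inj[of a "n + 1" "\<sigma> aKEYID (ke j)" b "\<sigma> aKEYID (ke j')"] le ab by auto
  moreover have "\<sigma> aRELID (re j) \<noteq> 0" "\<sigma> aKEYID (ke j) \<noteq> 0" "distinct_values (\<sigma> aRELID)" "distinct_values (\<sigma> aKEYID)"
    using p j by (auto simp: pairs_def)
  ultimately show "re j = re j' \<and> ke j = ke j'" using distinct_valuesD by blast
qed (use p j in \<open>auto simp: pairs_def\<close>)

definition stmts :: "memory \<Rightarrow> nat list list \<Rightarrow> nat \<Rightarrow> bool" where
  "stmts \<sigma> vs k \<longleftrightarrow>
     (\<forall>j<k. W j \<in> set vs \<and> \<sigma> aNODE j = ix vs (W j) \<and> \<sigma> aSIGN j = sg j \<and> \<sigma> aTUPLE j = tu j)"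

section \<open>Loading the statements\<close>

lemma wp_read_atoms:
  assumes j: "j < n" and J: "\<sigma> vSTMT 0 = j" and P: "\<sigma> vPTR 0 = off j" and I: "\<sigma> aIN = inp"
    and X: "\<sigma> vNODE 0 = ix vs (W j)" "W j \<in> set vs" and s: "stmts \<sigma> vs j" and p: "pairs \<sigma> j"
    and post: "\<And>\<sigma>' t'. same (writes read_atoms) \<sigma> \<sigma>' \<Longrightarrow> \<sigma>' vSTMT 0 = Suc j \<Longrightarrow> \<sigma>' vPTR 0 = off (Suc j) \<Longrightarrow>
       stmts \<sigma>' vs (Suc j) \<Longrightarrow> pairs \<sigma>' (Suc j) \<Longrightarrow> t' \<le> t + 150 \<Longrightarrow> Q \<sigma>' t'"
  shows "wp read_atoms Q \<sigma> t"
proof (rule wp_mono)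
  let ?R = "\<lambda>\<sigma>' t'. \<sigma>' vSTMT 0 = Suc j \<and> \<sigma>' vPTR 0 = off (Suc j) \<and> stmts \<sigma>' vs (Suc j) \<and> pairs \<sigma>' (Suc j) \<and> t' \<le> t + 150"
  show "Q \<sigma>' t'" if "same (writes read_atoms) \<sigma> \<sigma>'" "?R \<sigma>' t'" for \<sigma>' t'
    using that post by blast
  let ?o = "Suc (off j + length (W j))"
  have i: "inp (off j) = length (W j)" "inp ?o = sg j" "inp (Suc ?o) = re j" "inp (Suc (Suc ?o)) = ke j"
    "inp (Suc (Suc (Suc ?o))) = tu j" 
    using inp_len[OF j] inp_sg[OF j] inp_re[OF j] inp_ke[OF j] inp_tu[OF j]
    by (simp_all add: numeral_eq_Suc)
  have o: "off (Suc j) = off j + length (W j) + 5" by (rule off_Suc[OF j])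
  have stride: "stmts \<sigma>' vs (Suc j)" if "\<sigma>' aNODE = (\<sigma> aNODE)(j := ix vs (W j))"
    "\<sigma>' aSIGN = (\<sigma> aSIGN)(j := sg j)" "\<sigma>' aTUPLE = (\<sigma> aTUPLE)(j := tu j)" for \<sigma>'
    using s X(2) by (auto simp: stmts_def that less_Suc_eq)
  have pa: "pairs \<sigma>' (Suc j)"
    if RB: "\<sigma> aRELID (re j) \<noteq> 0 \<and> \<sigma>' aRELID = \<sigma> aRELID \<and> \<sigma>' vREL 0 = \<sigma> vREL 0 \<or>
       \<sigma> aRELID (re j) = 0 \<and> \<sigma>' aRELID = (\<sigma> aRELID)(re j := Suc (\<sigma> vREL 0 + n)) \<and> \<sigma>' vREL 0 = Suc (\<sigma> vREL 0 + n)"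
    and KD: "\<sigma> aKEYID (ke j) \<noteq> 0 \<and> \<sigma>' aKEYID = \<sigma> aKEYID \<and> \<sigma>' vKEY 0 = \<sigma> vKEY 0 \<or>
       \<sigma> aKEYID (ke j) = 0 \<and> \<sigma>' aKEYID = (\<sigma> aKEYID)(ke j := Suc (\<sigma> vKEY 0)) \<and> \<sigma>' vKEY 0 = Suc (\<sigma> vKEY 0)"
    and PR: "\<sigma>' aPAIR = (\<sigma> aPAIR)(j := \<sigma>' aRELID (re j) + \<sigma>' aKEYID (ke j))" for \<sigma>'
  proof -
    have "\<sigma> aRELID x \<noteq> Suc (\<sigma> vREL 0 + n)" "\<sigma> aKEYID x \<noteq> Suc (\<sigma> vKEY 0)" for x
      using p unfolding pairs_def by (metis le_add1 not_less_eq_eq, metis Suc_n_not_le_n)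
    note ne = this this[symmetric]
    have le: "\<sigma> aRELID x \<le> \<sigma> vREL 0" "\<sigma> aKEYID x \<le> \<sigma> vKEY 0" "\<sigma> vKEY 0 \<le> j" for x using p by (auto simp: pairs_def)
    have le': "\<sigma> aRELID x \<le> Suc (\<sigma> vREL 0 + n)" "\<sigma> aKEYID x \<le> Suc (\<sigma> vKEY 0)" for x
      using le(1)[of x] le(2)[of x] by linarith+
    have dv: "Suc n dvd \<sigma> aRELID x" "Suc n dvd \<sigma> vREL 0" for x using p by (auto simp: pairs_def)
    have dv': "Suc n dvd Suc (\<sigma> vREL 0 + n)" using dvd_add[OF dv(2) dvd_refl] by simp
    have inj: "distinct_values (\<sigma> aRELID)" "distinct_values (\<sigma> aKEYID)" using p by (auto simp: pairs_def)
    have old: "\<And>i. i < j \<Longrightarrow> \<sigma> aRELID (re i) \<noteq> 0 \<and> \<sigma> aKEYID (ke i) \<noteq> 0 \<and> \<sigma> aPAIR i = \<sigma> aRELID (re i) + \<sigma> aKEYID (ke i)"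
      using p by (auto simp: pairs_def)
    have "distinct_values (\<sigma>' aRELID)" "distinct_values (\<sigma>' aKEYID)"
      using RB KD inj distinct_values_upd[OF inj(1) ne(1)] distinct_values_upd[OF inj(2) ne(2)] by auto
    moreover have "\<forall>x. (n + 1) dvd \<sigma>' aRELID x \<and> \<sigma>' aRELID x \<le> \<sigma>' vREL 0" "(n + 1) dvd \<sigma>' vREL 0"
      using RB le(1) le' dv dv' by auto
    moreover have "\<forall>x. \<sigma>' aKEYID x \<le> \<sigma>' vKEY 0" "\<sigma>' vKEY 0 \<le> Suc j"
      using KD le(2,3) le' by auto
    moreover have "\<forall>i<Suc j. \<sigma>' aRELID (re i) \<noteq> 0 \<and> \<sigma>' aKEYID (ke i) \<noteq> 0 \<and> \<sigma>' aPAIR i = \<sigma>' aRELID (re i) + \<sigma>' aKEYID (ke i)"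
    proof (intro allI impI)
      fix i assume "i < Suc j"
      then show "\<sigma>' aRELID (re i) \<noteq> 0 \<and> \<sigma>' aKEYID (ke i) \<noteq> 0 \<and> \<sigma>' aPAIR i = \<sigma>' aRELID (re i) + \<sigma>' aKEYID (ke i)"
        using old[of i] RB KD PR by (cases "i = j") auto
    qed
    ultimately show ?thesis unfolding pairs_def by blast
  qed
  have n3: "a + 3 = Suc (Suc (Suc a))" "a + 2 = Suc (Suc a)" for a :: nat by simp_all
  show "wp read_atoms ?R \<sigma> t"
    unfolding read_atoms_def
    by (cases "\<sigma> aRELID (re j) = 0"; cases "\<sigma> aKEYID (ke j) = 0")
       (simp_all add: J P I i n3 X o; intro conjI stride pa; simp add: J P I i n3 X)+
qed

lemma wp_load:
  assumes I: "\<sigma> = (\<lambda>a. if a = 0 then inp else (\<lambda>_. 0))"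
    and post: "\<And>\<sigma>' t' vs. same (writes load) \<sigma> \<sigma>' \<Longrightarrow> trie \<sigma>' vs \<Longrightarrow> stmts \<sigma>' vs n \<Longrightarrow> pairs \<sigma>' n \<Longrightarrow>
       (\<forall>w\<in>set vs. \<exists>j<n. prefix w (W j)) \<Longrightarrow> t' \<le> t + 100 + n * (400 * (d + 1)) \<Longrightarrow> Q \<sigma>' t'"
  shows "wp load Q \<sigma> t"
proof -
  define I where "I k \<sigma>' t' \<longleftrightarrow> \<sigma>' vSTMT 0 = k \<and> \<sigma>' vPTR 0 = off k \<and> t' \<le> t + 60 + k * (400 * (d + 1)) \<and>
     (\<exists>vs. trie \<sigma>' vs \<and> stmts \<sigma>' vs k \<and> pairs \<sigma>' k \<and> (\<forall>w\<in>set vs. \<exists>j<n. prefix w (W j)))" for k \<sigma>' t'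
  show ?thesis
    unfolding load_def wp_Seq wp_Store
  proof (rule wp_while[where I = I and n = n], goal_cases)
    case 1
    have "trie (\<sigma>(vNODES := (\<sigma> vNODES)(0 := 1), aBASE := (\<sigma> aBASE)(1 := m + 1), vPTR := x, vSTMT := y)) [[]]" for x y
      unfolding trie_def using ix_le[of "[[]]" "_ :: nat list"] 
      by (auto simp: assms(1) stride_def ix_def le_Suc_eq)
    then show ?case
      unfolding I_def using n_pos
      by (auto intro!: exI[of _ "[[]]"] simp: assms(1) off0 stmts_def pairs_def)
  next
    case (2 k \<sigma>' t')
    then obtain vs where vs: "trie \<sigma>' vs" "stmts \<sigma>' vs k" "pairs \<sigma>' k" "\<forall>w\<in>set vs. \<exists>j<n. prefix w (W j)"
      and J: "\<sigma>' vSTMT 0 = k" and P: "\<sigma>' vPTR 0 = off k" and t': "t' \<le> t + 60 + k * (400 * (d + 1))"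
      by (auto simp: I_def)
    have inp: "\<sigma>' 0 = inp" using vs(1) by (simp add: trie_def)
    show ?case
    proof (intro conjI)
      show "val (eSTMTS \<ominus> var vSTMT) \<sigma>' \<noteq> 0" using 2(1) by (simp add: inp J)
      show "wp (insert_word ;; read_atoms) (I (Suc k)) \<sigma>' (t' + Suc (cost (eSTMTS \<ominus> var vSTMT)))"
        unfolding wp_Seq
      proof (rule wp_insert_word[OF vs(1) 2(1) P], goal_cases)
        case a: (1 \<sigma>2 t2 us)
        have eq: "\<sigma>2 x = \<sigma>' x" if "x \<in> {vSTMT, vPTR, aNODE, aSIGN, aTUPLE, vREL, aRELID, vKEY, aKEYID, aPAIR}" for x
          using a(1) that by (auto simp: same_def)
        have "stmts \<sigma>2 (vs @ us) k" using vs(2) by (auto simp: stmts_def eq)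
        moreover have "pairs \<sigma>2 k" using vs(3) by (rule pairs_same) (auto simp: eq)
        moreover have "\<sigma>2 aIN = inp" using a(2) by (simp add: trie_def)
        moreover have "I (Suc k) \<sigma>3 (t3 + 1)"
          if "same (writes read_atoms) \<sigma>2 \<sigma>3" "\<sigma>3 vSTMT 0 = Suc k" "\<sigma>3 vPTR 0 = off (Suc k)"
            "stmts \<sigma>3 (vs @ us) (Suc k)" "pairs \<sigma>3 (Suc k)" "t3 \<le> t2 + 150" for \<sigma>3 t3
        proof -
          have "trie \<sigma>3 (vs @ us)" using a(2) by (rule trie_same) (use that(1) in \<open>auto simp: same_def\<close>)
          moreover have "\<forall>w\<in>set (vs @ us). \<exists>j<n. prefix w (W j)"
            using vs(4) a(3) 2(1) by auto
          moreover have "t3 + 1 \<le> t + 60 + Suc k * (400 * (d + 1))"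
            using that(6) a(6) t' by (simp add: algebra_simps)
          ultimately show ?thesis using that(2-5) unfolding I_def by blast
        qed
        ultimately show ?case using 2(1) a(4,5) J P eq
          by (intro wp_read_atoms[of k]) auto
      qed
    qed
  next
    case (3 \<sigma>' t')
    then obtain vs where vs: "trie \<sigma>' vs" "stmts \<sigma>' vs n" "pairs \<sigma>' n" "\<forall>w\<in>set vs. \<exists>j<n. prefix w (W j)"
      and J: "\<sigma>' vSTMT 0 = n" and t': "t' \<le> t + 60 + n * (400 * (d + 1))"
      by (auto simp: I_def)
    have inp: "\<sigma>' 0 = inp" using vs(1) by (simp add: trie_def)
    have "same (writes load) \<sigma> \<sigma>'" using 3(1) by (auto simp: same_def)
    then show ?case using vs t' by (auto simp: inp J intro!: post)
  qed
qed

definition loaded :: "memory \<Rightarrow> nat list list \<Rightarrow> bool" where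
  "loaded \<sigma> vs \<longleftrightarrow> trie \<sigma> vs \<and> stmts \<sigma> vs n \<and> pairs \<sigma> n \<and> (\<forall>w\<in>set vs. \<exists>j<n. prefix w (W j))"

lemma loaded_same:
  assumes "loaded \<sigma> vs" "same A \<sigma> \<sigma>'"
    "A \<inter> {aIN, vNODES, aBASE, aCHILD, aSRC, aLEN, aLAST, vREL, vKEY, aRELID, aKEYID, aNODE, aSIGN, aPAIR, aTUPLE} = {}"
  shows "loaded \<sigma>' vs"
proof -
  have eq: "\<sigma>' x = \<sigma> x" if "x \<in> {aIN, vNODES, aBASE, aCHILD, aSRC, aLEN, aLAST, vREL, vKEY, aRELID, aKEYID, aNODE, aSIGN, aPAIR, aTUPLE}" for x
    using assms(2,3) that unfolding same_def by blast
  show ?thesis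
    using assms(1) unfolding loaded_def
    by (auto intro!: trie_same[of \<sigma> vs \<sigma>'] pairs_same[of \<sigma> n \<sigma>'] simp: eq stmts_def)
qed

lemma loadedD:
  assumes "loaded \<sigma> vs"
  shows "\<sigma> aIN = inp" "\<sigma> vNODES 0 = length vs" "j < n \<Longrightarrow> \<sigma> aNODE j = ix vs (W j)" "j < n \<Longrightarrow> W j \<in> set vs"
    "j < n \<Longrightarrow> \<sigma> aSIGN j = sg j" "j < n \<Longrightarrow> \<sigma> aTUPLE j = tu j" "distinct vs"
    "j < n \<Longrightarrow> j' < n \<Longrightarrow> \<sigma> aPAIR j = \<sigma> aPAIR j' \<longleftrightarrow> re j = re j' \<and> ke j = ke j'"
  using assms pairs_inj by (auto simp: loaded_def trie_def stmts_def)

section \<open>Clearing the marks and detecting inconsistency\<close>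

lemma wp_reset:
  assumes l: "loaded \<sigma> vs"
    and post: "\<And>\<sigma>' t'. same (writes reset) \<sigma> \<sigma>' \<Longrightarrow>
       \<forall>j<n. \<sigma>' aKEYLEV (\<sigma> aPAIR j) = 0 \<and> \<sigma>' aPOSLEV (tu j) = 0 \<and> \<sigma>' aNEGLEV (tu j) = 0 \<and> \<sigma>' aLEVEL (ix vs (W j)) = 0 \<Longrightarrow>
       t' \<le> t + 50 * (n + 1) \<Longrightarrow> Q \<sigma>' t'"
  shows "wp reset Q \<sigma> t"
proof -
  define I where "I k \<sigma>' t' \<longleftrightarrow> \<sigma>' vSTMT 0 = k \<and> t' \<le> t + 10 + 50 * k \<and>
     (\<forall>j<k. \<sigma>' aKEYLEV (\<sigma> aPAIR j) = 0 \<and> \<sigma>' aPOSLEV (tu j) = 0 \<and> \<sigma>' aNEGLEV (tu j) = 0 \<and> \<sigma>' aLEVEL (ix vs (W j)) = 0)" for k \<sigma>' t'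
  note ld = loadedD[OF l]
  show ?thesis
    unfolding reset_def wp_Seq wp_Store
  proof (rule wp_while[where I = I and n = n], goal_cases)
    case 1
    then show ?case by (simp add: I_def)
  next
    case (2 k \<sigma>' t')
    then have s: "\<sigma>' aPAIR = \<sigma> aPAIR" "\<sigma>' aTUPLE k = tu k" "\<sigma>' aNODE k = ix vs (W k)" "\<sigma>' aIN = inp"
      using ld by (auto simp: same_def)
    show ?case using 2(1,3) by (auto simp: s I_def less_Suc_eq)
  next
    case (3 \<sigma>' t')
    then have s: "\<sigma>' aIN = inp" using ld by (simp add: same_def)
    have "same (writes reset) \<sigma> \<sigma>'" using 3(1) by (auto simp: same_def)
    then show ?case using 3(2) by (auto simp: s I_def intro!: post)
  qed
qed

text \<open>Differs from \<open>conflict\<close> in that positive statements with equal keys clash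
  even if their tuples agree. For different entries of a repetition-free list at one path this
  cannot occur.\<close>

definition clash :: "nat \<Rightarrow> nat \<Rightarrow> bool" where
  "clash j' j \<longleftrightarrow> W j' = W j \<and>
     (if sg j = 0 then sg j' \<noteq> 0 \<and> tu j' = tu j
      else if sg j' = 0 then tu j' = tu j
      else re j' = re j \<and> ke j' = ke j)"

text \<open>The marks record which positive pairs and which signed tuples occurred at
  \<open>u\<close> so far; each pair of statements is thus examined when its later member is
  reached.\<close>

lemma wp_check_state:
  assumes l: "loaded \<sigma> vs" and V: "\<sigma> vSTATE 0 = ix vs u" and u: "u \<in> set vs"
    and post: "\<And>\<sigma>' t'. same (writes check_state) \<sigma> \<sigma>' \<Longrightarrow>
       \<sigma>' vCLASH 0 \<noteq> 0 \<longleftrightarrow> \<sigma> vCLASH 0 \<noteq> 0 \<or> (\<exists>j<n. \<exists>j'<j. W j = u \<and> clash j' j) \<Longrightarrow>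
       t' \<le> t + 200 * (n + 1) \<Longrightarrow> Q \<sigma>' t'"
  shows "wp check_state Q \<sigma> t"
proof -
  define I where "I k \<sigma>' t' \<longleftrightarrow> \<sigma>' vSTMT 0 = k \<and> t' \<le> t + 50 * (n + 1) + 20 + 100 * k \<and>
     (\<sigma>' vCLASH 0 \<noteq> 0 \<longleftrightarrow> \<sigma> vCLASH 0 \<noteq> 0 \<or> (\<exists>j<k. \<exists>j'<j. W j = u \<and> clash j' j)) \<and>
     (\<forall>j<n. (\<sigma>' aKEYLEV (\<sigma> aPAIR j) \<noteq> 0 \<longleftrightarrow> (\<exists>j'<k. W j' = u \<and> sg j' \<noteq> 0 \<and> re j' = re j \<and> ke j' = ke j)) \<and>
        (\<sigma>' aPOSLEV (tu j) \<noteq> 0 \<longleftrightarrow> (\<exists>j'<k. W j' = u \<and> sg j' \<noteq> 0 \<and> tu j' = tu j)) \<and>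
        (\<sigma>' aNEGLEV (tu j) \<noteq> 0 \<longleftrightarrow> (\<exists>j'<k. W j' = u \<and> sg j' = 0 \<and> tu j' = tu j)))" for k \<sigma>' t'
  note ld = loadedD[OF l]
  show ?thesis
    unfolding check_state_def wp_Seq
  proof (rule wp_reset[OF l], unfold wp_Store, rule wp_while[where I = I and n = n], goal_cases)
    case (1 \<sigma>1 t1)
    then show ?case by (auto simp: I_def same_def)
  next
    case (2 \<sigma>1 t1 k \<sigma>' t')
    then have s: "\<sigma>' aPAIR = \<sigma> aPAIR" "\<sigma>' aTUPLE k = tu k" "\<sigma>' aNODE k = ix vs (W k)" "\<sigma>' aIN = inp"
        "\<sigma>' aSIGN k = sg k" "\<sigma>' vSTATE 0 = ix vs u"
      using ld V by (auto simp: same_def)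
    have J: "\<sigma>' vSTMT 0 = k" using 2(6) by (simp add: I_def)
    have eq: "ix vs (W k) - ix vs u + (ix vs u - ix vs (W k)) = 0 \<longleftrightarrow> W k = u"
      using ix_inj[OF u, of "W k"] by auto
    show ?case
    proof (intro conjI)
      show "val (eSTMTS \<ominus> var vSTMT) \<sigma>' \<noteq> 0" using 2(4) by (simp add: s J)
      show "wp check_step (I (Suc k)) \<sigma>' (t' + Suc (cost (eSTMTS \<ominus> var vSTMT)))"
      proof (cases "W k = u")
        case False
        with 2(6) show ?thesis
          using eq by (simp add: check_step_def s J) (auto simp: I_def less_Suc_eq)
      next
        case True
        have inv: "\<sigma>' vCLASH 0 \<noteq> 0 \<longleftrightarrow> \<sigma> vCLASH 0 \<noteq> 0 \<or> (\<exists>j<k. \<exists>j'<j. W j = u \<and> clash j' j)"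
          "\<And>j. j < n \<Longrightarrow> \<sigma>' aKEYLEV (\<sigma> aPAIR j) \<noteq> 0 \<longleftrightarrow> (\<exists>j'<k. W j' = u \<and> sg j' \<noteq> 0 \<and> re j' = re j \<and> ke j' = ke j)"
          "\<And>j. j < n \<Longrightarrow> \<sigma>' aPOSLEV (tu j) \<noteq> 0 \<longleftrightarrow> (\<exists>j'<k. W j' = u \<and> sg j' \<noteq> 0 \<and> tu j' = tu j)"
          "\<And>j. j < n \<Longrightarrow> \<sigma>' aNEGLEV (tu j) \<noteq> 0 \<longleftrightarrow> (\<exists>j'<k. W j' = u \<and> sg j' = 0 \<and> tu j' = tu j)"
          and t': "t' \<le> t + 50 * (n + 1) + 20 + 100 * k"
          using 2(6) by (simp_all add: I_def)
        have "(\<exists>j<Suc k. \<exists>j'<j. W j = u \<and> clash j' j) \<longleftrightarrow>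
            (\<exists>j<k. \<exists>j'<j. W j = u \<and> clash j' j) \<or> (\<exists>j'<k. clash j' k)"
          using True by (auto simp: less_Suc_eq)
        moreover have "(\<exists>j'<k. clash j' k) \<longleftrightarrow>
            (if sg k = 0 then \<sigma>' aPOSLEV (tu k) \<noteq> 0 else \<sigma>' aKEYLEV (\<sigma> aPAIR k) \<noteq> 0 \<or> \<sigma>' aNEGLEV (tu k) \<noteq> 0)"
          unfolding inv(2-4)[OF 2(4)] using True by (auto simp: clash_def)
        ultimately have cl: "(\<exists>j<Suc k. \<exists>j'<j. W j = u \<and> clash j' j) \<longleftrightarrow>
            (\<exists>j<k. \<exists>j'<j. W j = u \<and> clash j' j) \<or>
            (if sg k = 0 then \<sigma>' aPOSLEV (tu k) \<noteq> 0 else \<sigma>' aKEYLEV (\<sigma> aPAIR k) \<noteq> 0 \<or> \<sigma>' aNEGLEV (tu k) \<noteq> 0)"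
          by argo
        have Suc_ex: "(\<exists>j'<Suc k. W j' = u \<and> P j') \<longleftrightarrow> (\<exists>j'<k. W j' = u \<and> P j') \<or> P k" for P
          using True by (auto simp: less_Suc_eq)
        have pr: "\<sigma> aPAIR j = \<sigma> aPAIR k \<longleftrightarrow> re k = re j \<and> ke k = ke j" if "j < n" for j
          using ld(8)[OF that 2(4)] by auto
        show ?thesis
        proof (cases "sg k = 0")
          case s0: True
          show ?thesis unfolding check_step_def using t' True s0
            apply (simp add: s J)
            unfolding I_def cl Suc_ex
            using inv s0 by (auto simp: pr)
        next
          case s0: False
          show ?thesis unfolding check_step_def using t' True s0
            apply (simp add: s J)
            unfolding I_def cl Suc_ex
            using inv s0 by (auto simp: pr)
        qed
      qed
    qed
  next
    case (3 \<sigma>1 t1 \<sigma>' t')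
    then have s: "\<sigma>' aIN = inp" using ld by (simp add: same_def)
    have "same (writes check_state) \<sigma> \<sigma>'" using 3(1,4) by (auto simp: same_def)
    then show ?case using 3(5) by (auto simp: s I_def intro!: post)
  qed
qed

text \<open>Clashing statements share their path, and this path is a state, so examining the states
  one by one misses nothing.\<close>

lemma wp_check:
  assumes l: "loaded \<sigma> vs"
    and post: "\<And>\<sigma>' t'. same (writes check) \<sigma> \<sigma>' \<Longrightarrow>
       \<sigma>' vCLASH 0 \<noteq> 0 \<longleftrightarrow> (\<exists>j<n. \<exists>j'<j. clash j' j) \<Longrightarrow>
       t' \<le> t + 50 + length vs * (300 * (n + 1)) \<Longrightarrow> Q \<sigma>' t'"
  shows "wp check Q \<sigma> t"
proof -
  define I where "I k (\<sigma>' :: memory) t' \<longleftrightarrow> \<sigma>' vSTATE 0 = Suc k \<and> t' \<le> t + 20 + k * (300 * (n + 1)) \<and>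
     (\<sigma>' vCLASH 0 \<noteq> 0 \<longleftrightarrow> (\<exists>j<n. \<exists>j'<j. W j \<in> set (take k vs) \<and> clash j' j))" for k \<sigma>' t'
  note ld = loadedD[OF l]
  show ?thesis
    unfolding check_def wp_Seq wp_Store
  proof (rule wp_while[where I = I and n = "length vs"], goal_cases)
    case 1
    then show ?case by (auto simp: I_def)
  next
    case (2 k \<sigma>' t')
    have l': "loaded \<sigma>' vs" using 2(2) by (intro loaded_same[OF l, where A = "writes check"]) (auto simp: same_def)
    have V: "\<sigma>' vSTATE 0 = ix vs (vs ! k)" using 2 ld(7) by (simp add: I_def ix_nth)
    show ?case
    proof (intro conjI)
      show "val (var vNODES \<oplus> Num 1 \<ominus> var vSTATE) \<sigma>' \<noteq> 0" using 2(1,3) loadedD(2)[OF l'] by (simp add: I_def)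
      show "wp (check_state ;; incr vSTATE) (I (Suc k)) \<sigma>' (t' + Suc (cost (var vNODES \<oplus> Num 1 \<ominus> var vSTATE)))"
        unfolding wp_Seq
      proof (rule wp_check_state[OF l' V], goal_cases)
        case 1
        then show ?case using 2 by simp
      next
        case b: (2 \<sigma>2 t2)
        have "\<sigma>2 vSTATE = \<sigma>' vSTATE" using b(1) by (simp add: same_def)
        moreover have "W j \<in> set (take (Suc k) vs) \<longleftrightarrow> W j \<in> set (take k vs) \<or> W j = vs ! k" for j
          using 2(1) by (auto simp: take_Suc_conv_app_nth)
        ultimately show ?case using b(2,3) 2(3)
          unfolding wp_Store I_def by (auto simp: algebra_simps)
      qed
    qed
  next
    case (3 \<sigma>' t')
    have l': "loaded \<sigma>' vs" using 3(1) by (intro loaded_same[OF l, where A = "writes check"]) (auto simp: same_def)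
    have "same (writes check) \<sigma> \<sigma>'" using 3(1) by (auto simp: same_def)
    moreover have "\<sigma>' vCLASH 0 \<noteq> 0 \<longleftrightarrow> (\<exists>j<n. \<exists>j'<j. clash j' j)"
      using 3(2) ld(4) by (auto simp: I_def)
    ultimately show ?case using 3(2) loadedD(2)[OF l'] by (auto simp: I_def intro!: post)
  qed
qed

end

section \<open>The world and the edges of a state\<close>

text \<open>Walks from the root along the last \<open>vLEN\<close> letters of the state; if this
  suffix is not a state, the walk ends in the sink. Repeating the walk for each length costs
  \<open>O((d + 1)\<^sup>2)\<close>.\<close>

definition suffixes_step :: com where
  "suffixes_step =
     vNODE ::= Num 1 ;; vPOS ::= Cell aLEN (var vSTATE) \<ominus> var vLEN ;;
     While (Cell aLEN (var vSTATE) \<ominus> var vPOS)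
       (vNODE ::= Cell aCHILD (Cell aBASE (var vNODE) \<oplus> Cell aIN (Cell aSRC (var vSTATE) \<oplus> var vPOS)) ;; incr vPOS) ;;
     Store aSUFFIX (var vLEN) (var vNODE) ;;
     incr vLEN"

definition suffixes_com :: com where
  "suffixes_com = vLEN ::= Num 0 ;; While (Cell aLEN (var vSTATE) \<oplus> Num 1 \<ominus> var vLEN) suffixes_step"

text \<open>Levels are lengths plus one, leaving 0 for nodes that are no suffix. With the
  inconsistency flag set, the loop starts at full length, so that only the state's own statements
  receive a level.\<close>

definition levels :: com where
  "levels = If (var vCLASH) (vLEN ::= Cell aLEN (var vSTATE)) (vLEN ::= Num 0) ;;
     While (Cell aLEN (var vSTATE) \<oplus> Num 1 \<ominus> var vLEN)
       (Store aLEVEL (Cell aSUFFIX (var vLEN)) (var vLEN \<oplus> Num 1) ;; incr vLEN)"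

text \<open>With truncated subtraction, \<open>a + (b - a)\<close> is the maximum of \<open>a\<close> and \<open>b\<close>.\<close>

abbreviation raise :: "nat \<Rightarrow> exp \<Rightarrow> com" where
  "raise a e \<equiv> Store a e (Cell a e \<oplus> (Cell aLEVEL (Cell aNODE (var vSTMT)) \<ominus> Cell a e))"

definition mark :: com where
  "mark = vSTMT ::= Num 0 ;; While (eSTMTS \<ominus> var vSTMT)
     (If (Cell aSIGN (var vSTMT))
        (raise aKEYLEV (Cell aPAIR (var vSTMT)) ;; raise aPOSLEV (Cell aTUPLE (var vSTMT)))
        (raise aNEGLEV (Cell aTUPLE (var vSTMT))) ;;
      incr vSTMT)"

text \<open>The marks are maxima that include the statement itself, so survival means that none
  exceeds its own level; truncated subtraction tests just that. For a positive statement the key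
  mark also covers repetitions of its tuple.\<close>

definition scan_step :: com where
  "scan_step =
     vLEN ::= Cell aLEVEL (Cell aNODE (var vSTMT)) ;;
     If (var vLEN)
       (If (Cell aSIGN (var vSTMT))
          (If ((Cell aKEYLEV (Cell aPAIR (var vSTMT)) \<ominus> var vLEN) \<oplus> (Cell aNEGLEV (Cell aTUPLE (var vSTMT)) \<ominus> var vLEN)) Skip
             (Store aPOS (var vNPOS) (Cell aTUPLE (var vSTMT)) ;; incr vNPOS))
          (If ((Cell aPOSLEV (Cell aTUPLE (var vSTMT)) \<ominus> var vLEN) \<oplus> (Cell aNEGLEV (Cell aTUPLE (var vSTMT)) \<ominus> var vLEN)) Skip
             (Store aNEG (var vNNEG) (Cell aTUPLE (var vSTMT)) ;; incr vNNEG)))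
       Skip ;;
     incr vSTMT"

definition scan :: com where
  "scan = vNPOS ::= Num 0 ;; vNNEG ::= Num 0 ;; vSTMT ::= Num 0 ;; While (eSTMTS \<ominus> var vSTMT) scan_step"

text \<open>Every nonempty suffix of \<open>u @ [i]\<close> is a suffix of \<open>u\<close> followed
  by \<open>i\<close>, hence a child of a stored suffix node. Candidates come by increasing length
  and overwrite each other, so the longest remains; node 1 is the empty suffix.\<close>

definition target :: com where
  "target = vTARGET ::= Num 1 ;; vLEN ::= Num 0 ;;
     While (Cell aLEN (var vSTATE) \<oplus> Num 1 \<ominus> var vLEN)
       (vSLOT ::= Cell aCHILD (Cell aBASE (Cell aSUFFIX (var vLEN)) \<oplus> var vUSER) ;;
        If (var vSLOT) (vTARGET ::= var vSLOT) Skip ;;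
        incr vLEN)"

text \<open>The root has last letter 0, which is not a user, so it passes the test for all users.
  Targets are decreased by one because output positions start at 0.\<close>

definition edges_com :: com where
  "edges_com = vNEDGE ::= Num 0 ;; vUSER ::= Num 1 ;;
     While (eUSERS \<oplus> Num 1 \<ominus> var vUSER)
       (If ((Cell aLAST (var vSTATE) \<ominus> var vUSER) \<oplus> (var vUSER \<ominus> Cell aLAST (var vSTATE)))
          (target ;;
           Store aEDGE (var vNEDGE \<oplus> var vNEDGE) (var vUSER) ;;
           Store aEDGE (var vNEDGE \<oplus> var vNEDGE \<oplus> Num 1) (var vTARGET \<ominus> Num 1) ;;
           incr vNEDGE)
          Skip ;;
        incr vUSER)"

lemma writes_suffixes_step [simp]: "writes suffixes_step = {vNODE, vPOS, aSUFFIX, vLEN}"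
  by (auto simp: suffixes_step_def)

lemma writes_suffixes_com [simp]: "writes suffixes_com = {vNODE, vPOS, aSUFFIX, vLEN}"
  by (auto simp: suffixes_com_def)

lemma writes_levels [simp]: "writes levels = {vLEN, aLEVEL}"
  by (auto simp: levels_def)

lemma writes_mark [simp]: "writes mark = {vSTMT, aKEYLEV, aPOSLEV, aNEGLEV}"
  by (auto simp: mark_def)

lemma writes_scan_step [simp]: "writes scan_step = {vLEN, aPOS, vNPOS, aNEG, vNNEG, vSTMT}"
  by (auto simp: scan_step_def)

lemma writes_scan [simp]: "writes scan = {vLEN, aPOS, vNPOS, aNEG, vNNEG, vSTMT}"
  by (auto simp: scan_def)

lemma writes_target [simp]: "writes target = {vTARGET, vLEN, vSLOT}"
  by (auto simp: target_def)

lemma writes_edges_com [simp]: "writes edges_com = {vTARGET, vLEN, vSLOT, vNEDGE, vUSER, aEDGE}"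
  by (auto simp: edges_com_def)

text \<open>A recursive form of \<open>dss\<close>; the default value is legitimate as long as the
  empty word belongs to the set.\<close>

fun longest_suffix :: "'a list set \<Rightarrow> 'a list \<Rightarrow> 'a list" where
  "longest_suffix A [] = []"
| "longest_suffix A (i # w) = (if i # w \<in> A then i # w else longest_suffix A w)"

context ram_input
begin

lemma trieD:
  assumes "trie \<sigma> vs"
  shows "w \<in> set vs \<Longrightarrow> \<sigma> aLEN (ix vs w) = length w"
    "w \<in> set vs \<Longrightarrow> \<sigma> aLAST (ix vs w) = (if w = [] then 0 else last w)"
    "w \<in> set vs \<Longrightarrow> q < length w \<Longrightarrow> inp (\<sigma> aSRC (ix vs w) + q) = w ! q"
    "\<sigma> aBASE (ix vs w) = ix vs w * stride"
    "i \<in> {1..m} \<Longrightarrow> \<sigma> aCHILD (ix vs w * stride + i) = ix vs (w @ [i])"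
    "[] \<in> set vs" "ix vs [] = 1" "w \<in> set vs \<Longrightarrow> set w \<subseteq> {1..m}"
proof -
  have k: "\<exists>k<length vs. ix vs w = Suc k \<and> vs ! k = w" if "w \<in> set vs"
    using that ix_nth assms by (auto simp: trie_def in_set_conv_nth)
  show "w \<in> set vs \<Longrightarrow> \<sigma> aLEN (ix vs w) = length w"
    "w \<in> set vs \<Longrightarrow> \<sigma> aLAST (ix vs w) = (if w = [] then 0 else last w)"
    "w \<in> set vs \<Longrightarrow> q < length w \<Longrightarrow> inp (\<sigma> aSRC (ix vs w) + q) = w ! q"
    using k assms by (auto simp: trie_def)
  show "\<sigma> aBASE (ix vs w) = ix vs w * stride" "i \<in> {1..m} \<Longrightarrow> \<sigma> aCHILD (ix vs w * stride + i) = ix vs (w @ [i])"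
    "w \<in> set vs \<Longrightarrow> set w \<subseteq> {1..m}"
    using assms ix_le[of vs w] by (auto simp: trie_def)
  have "vs \<noteq> []" "vs ! 0 = []" "distinct vs" using assms by (auto simp: trie_def)
  then show "[] \<in> set vs" "ix vs [] = 1" using ix_nth[of vs 0] nth_mem[of 0 vs] by auto
qed

lemma loaded_trie: "loaded \<sigma> vs \<Longrightarrow> trie \<sigma> vs"
  by (simp add: loaded_def)

lemma loaded_length: "loaded \<sigma> vs \<Longrightarrow> w \<in> set vs \<Longrightarrow> length w \<le> d"
  by (meson W_length le_trans loaded_def prefix_length_le)

section \<open>Suffix nodes and levels\<close>

lemma wp_suffixes_step:
  assumes l: "loaded \<sigma> vs" and V: "\<sigma> vSTATE 0 = ix vs u" and u: "u \<in> set vs"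
    and L: "\<sigma> vLEN 0 = k" "k \<le> length u"
    and post: "\<And>\<sigma>' t'. same (writes suffixes_step) \<sigma> \<sigma>' \<Longrightarrow> \<sigma>' vLEN 0 = Suc k \<Longrightarrow>
       \<sigma>' aSUFFIX = (\<sigma> aSUFFIX)(k := ix vs (drop (length u - k) u)) \<Longrightarrow>
       t' \<le> t + 100 * (d + 1) \<Longrightarrow> Q \<sigma>' t'"
  shows "wp suffixes_step Q \<sigma> t"
proof -
  let ?w = "drop (length u - k) u"
  define I where "I q \<sigma>' t' \<longleftrightarrow> \<sigma>' vPOS 0 = length u - k + q \<and> t' \<le> t + 20 + 50 * q \<and>
     \<sigma>' vNODE 0 = ix vs (take q ?w)" for q and \<sigma>' :: memory and t'
  note tr = trieD[OF loaded_trie[OF l]] loadedD[OF l]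
  show ?thesis
    unfolding suffixes_step_def wp_Seq wp_Store
  proof (rule wp_while[where I = I and n = k], goal_cases)
    case 1
    show ?case using tr u by (simp add: I_def V L)
  next
    case (2 q \<sigma>' t')
    then have s: "\<sigma>' aLEN = \<sigma> aLEN" "\<sigma>' vSTATE = \<sigma> vSTATE" "\<sigma>' aCHILD = \<sigma> aCHILD" "\<sigma>' aBASE = \<sigma> aBASE" "\<sigma>' aSRC = \<sigma> aSRC"
      "\<sigma>' aIN = inp" using tr(9) by (auto simp: same_def)
    let ?i = "u ! (length u - k + q)"
    have q: "length u - k + q < length u" using 2(1) L(2) by simp
    then have i: "?i \<in> {1..m}" using tr(8)[OF u] nth_mem by blast
    have tk: "take (Suc q) ?w = take q ?w @ [?i]" using 2(1) L(2) by (simp add: take_Suc_conv_app_nth)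
    show ?case using 2(3) q tr(5)[OF i, of "take q ?w"]
      by (simp add: I_def s V tr(1)[OF u] tr(3)[OF u q] tr(4) tk del: take_Suc)
  next
    case (3 \<sigma>' t')
    then have s: "\<sigma>' aLEN = \<sigma> aLEN" "\<sigma>' vSTATE = \<sigma> vSTATE" "\<sigma>' aSUFFIX = \<sigma> aSUFFIX" "\<sigma>' vLEN = \<sigma> vLEN" by (auto simp: same_def)
    have len: "take k ?w = ?w" using L(2) by simp
    have ud: "length u \<le> d" using l u by (rule loaded_length)
    have "same (writes suffixes_step) \<sigma> (\<sigma>'(aSUFFIX := x, vLEN := y))" for x y
      using 3(1) by (auto simp: same_def)
    then show ?case using 3(2) L ud
      by (simp add: s I_def V tr(1)[OF u] del: fun_upd_apply writes_suffixes_step)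
        (intro conjI post; auto simp: len s)
  qed
qed

lemma wp_suffixes:
  assumes l: "loaded \<sigma> vs" and V: "\<sigma> vSTATE 0 = ix vs u" and u: "u \<in> set vs"
    and post: "\<And>\<sigma>' t'. same (writes suffixes_com) \<sigma> \<sigma>' \<Longrightarrow>
       \<forall>k\<le>length u. \<sigma>' aSUFFIX k = ix vs (drop (length u - k) u) \<Longrightarrow>
       t' \<le> t + 200 * (d + 1) * (d + 1) \<Longrightarrow> Q \<sigma>' t'"
  shows "wp suffixes_com Q \<sigma> t"
proof -
  define I where "I k \<sigma>' t' \<longleftrightarrow> \<sigma>' vLEN 0 = k \<and> t' \<le> t + 20 + k * (150 * (d + 1)) \<and>
     (\<forall>k'<k. \<sigma>' aSUFFIX k' = ix vs (drop (length u - k') u))" for k and \<sigma>' :: memory and t'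
  have ud: "length u \<le> d" using l u by (rule loaded_length)
  show ?thesis
    unfolding suffixes_com_def wp_Seq wp_Store
  proof (rule wp_while[where I = I and n = "Suc (length u)"], goal_cases)
    case 1
    show ?case by (simp add: I_def)
  next
    case (2 k \<sigma>' t')
    have l': "loaded \<sigma>' vs" using 2(2) by (intro loaded_same[OF l, where A = "writes suffixes_com"]) (auto simp: same_def)
    have V': "\<sigma>' vSTATE 0 = ix vs u" using 2(2) V by (simp add: same_def)
    note len = trieD(1)[OF loaded_trie[OF l'] u]
    show ?case
    proof (intro conjI)
      show "val (Cell aLEN (var vSTATE) \<oplus> Num 1 \<ominus> var vLEN) \<sigma>' \<noteq> 0" using 2(1,3) by (simp add: V' len I_def)
      show "wp suffixes_step (I (Suc k)) \<sigma>' (t' + Suc (cost (Cell aLEN (var vSTATE) \<oplus> Num 1 \<ominus> var vLEN)))"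
        using 2(1,3) by (intro wp_suffixes_step[OF l' V' u, of k]) (auto simp: I_def less_Suc_eq)
    qed
  next
    case (3 \<sigma>' t')
    have l': "loaded \<sigma>' vs" using 3(1) by (intro loaded_same[OF l, where A = "writes suffixes_com"]) (auto simp: same_def)
    have V': "\<sigma>' vSTATE 0 = ix vs u" using 3(1) V by (simp add: same_def)
    note len = trieD(1)[OF loaded_trie[OF l'] u]
    have "Suc (length u) * (150 * (d + 1)) \<le> (d + 1) * (150 * (d + 1))" using ud by (intro mult_le_mono1) simp
    then have "t' + 20 \<le> t + 200 * (d + 1) * (d + 1)" using 3(2) by (simp add: I_def algebra_simps)
    moreover have "same (writes suffixes_com) \<sigma> \<sigma>'" using 3(1) by (auto simp: same_def)
    ultimately show ?case using 3(2) by (auto simp: I_def V' len intro!: post)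
  qed
qed

text \<open>\<open>lev b u j\<close> is 0 unless statement \<open>j\<close> is relevant to the world at \<open>u\<close>; the flag \<open>b\<close> tells
  that the database is inconsistent, in which case nothing is inherited.\<close>

definition lev :: "bool \<Rightarrow> nat list \<Rightarrow> nat \<Rightarrow> nat" where
  "lev b u j = (if (if b then W j = u else suffix (W j) u) then Suc (length (W j)) else 0)"

lemma wp_levels:
  assumes l: "loaded \<sigma> vs" and V: "\<sigma> vSTATE 0 = ix vs u" and u: "u \<in> set vs"
    and SN: "\<forall>k\<le>length u. \<sigma> aSUFFIX k = ix vs (drop (length u - k) u)"
    and LV: "\<forall>j<n. \<sigma> aLEVEL (ix vs (W j)) = 0"
    and post: "\<And>\<sigma>' t'. same (writes levels) \<sigma> \<sigma>' \<Longrightarrow>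
       \<forall>j<n. \<sigma>' aLEVEL (ix vs (W j)) = lev (\<sigma> vCLASH 0 \<noteq> 0) u j \<Longrightarrow>
       t' \<le> t + 100 * (d + 1) \<Longrightarrow> Q \<sigma>' t'"
  shows "wp levels Q \<sigma> t"
proof -
  let ?b = "\<sigma> vCLASH 0 \<noteq> 0"
  define a where "a = (if ?b then length u else 0)"
  define I where "I k \<sigma>' t' \<longleftrightarrow> \<sigma>' vLEN 0 = a + k \<and> t' \<le> t + 20 + 50 * k \<and>
     (\<forall>j<n. \<sigma>' aLEVEL (ix vs (W j)) =
        (if suffix (W j) u \<and> a \<le> length (W j) \<and> length (W j) < a + k then Suc (length (W j)) else 0))"
    for k and \<sigma>' :: memory and t'
  have ud: "length u \<le> d" using l u by (rule loaded_length)
  have au: "a \<le> length u" by (simp add: a_def)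
  note tr = trieD[OF loaded_trie[OF l]] loadedD[OF l]
  have loop: "wp (While (Cell aLEN (var vSTATE) \<oplus> Num 1 \<ominus> var vLEN)
       (Store aLEVEL (Cell aSUFFIX (var vLEN)) (var vLEN \<oplus> Num 1) ;; incr vLEN)) (\<lambda>\<sigma>' t'. Q \<sigma>' (t' + 1)) \<sigma>0 t0"
    if \<sigma>0: "\<sigma>0 = \<sigma>(vLEN := (\<sigma> vLEN)(0 := a))" and t0: "t0 \<le> t + 20" for \<sigma>0 t0
  proof (rule wp_while[where I = I and n = "Suc (length u - a)"], goal_cases)
    case 1
    show ?case using LV t0 by (simp add: I_def \<sigma>0)
  next
    case (2 k \<sigma>' t')
    have s: "\<sigma>' aLEN = \<sigma> aLEN" "\<sigma>' vSTATE = \<sigma> vSTATE" "\<sigma>' aSUFFIX = \<sigma> aSUFFIX" using 2(2) by (auto simp: same_def \<sigma>0)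
    have ak: "a + k \<le> length u" using 2(1) au by linarith
    \<comment> \<open>The stored node may be the sink. Writing a level there is harmless, since
      \<open>W j\<close> is a state and its node differs from 0; \<open>ix_inj\<close> needs
      membership of one side only.\<close>
    have "ix vs (W j) = ix vs (drop (length u - (a + k)) u) \<longleftrightarrow> suffix (W j) u \<and> length (W j) = a + k"
      if "j < n" for j
    proof -
      have "ix vs (W j) = ix vs (drop (length u - (a + k)) u) \<longleftrightarrow> W j = drop (length u - (a + k)) u"
        using tr(12)[OF that] by (rule ix_inj)
      also have "\<dots> \<longleftrightarrow> suffix (W j) u \<and> length (W j) = a + k"
      proof
        assume "W j = drop (length u - (a + k)) u"
        with ak show "suffix (W j) u \<and> length (W j) = a + k" by (simp add: suffix_drop)
      next
        assume "suffix (W j) u \<and> length (W j) = a + k"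
        then show "W j = drop (length u - (a + k)) u" by (auto simp: suffix_def)
      qed
      finally show ?thesis .
    qed
    moreover have "\<sigma> aSUFFIX (a + k) = ix vs (drop (length u - (a + k)) u)" using SN ak by blast
    ultimately show ?case using 2(1,3) tr(1)[OF u] V ak
      by (auto simp: I_def s)
  next
    case (3 \<sigma>' t')
    have s: "\<sigma>' aLEN = \<sigma> aLEN" "\<sigma>' vSTATE = \<sigma> vSTATE" using 3(1) by (auto simp: same_def \<sigma>0)
    have "(suffix (W j) u \<and> a \<le> length (W j) \<and> length (W j) < a + Suc (length u - a)) \<longleftrightarrow>
        (if ?b then W j = u else suffix (W j) u)" for j
      using suffix_length_le[of "W j" u] suffix_length_suffix[of u u "W j"] 
      by (auto simp: a_def dest: suffix_order.antisym)
    then have "\<forall>j<n. \<sigma>' aLEVEL (ix vs (W j)) = lev ?b u j" using 3(2) by (simp add: I_def lev_def)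
    moreover have "same (writes levels) \<sigma> \<sigma>'" using 3(1) by (auto simp: same_def \<sigma>0)
    ultimately show ?case using 3(2) au ud V tr(1)[OF u]
      by (auto simp: I_def s intro!: post)
  qed
  show ?thesis unfolding levels_def wp_Seq wp_If wp_Store
    by (split if_split, intro conjI impI; rule loop; simp add: a_def V tr(1)[OF u])
qed

section \<open>Marking and scanning the statements\<close>

definition levels_at :: "memory \<Rightarrow> nat list list \<Rightarrow> bool \<Rightarrow> nat list \<Rightarrow> bool" where
  "levels_at \<sigma> vs b u \<longleftrightarrow> (\<forall>j<n. \<sigma> aLEVEL (ix vs (W j)) = lev b u j)"

text \<open>Each cell is the maximum of the relevant levels, or 0 if there are none. Expressed by
  thresholds \<open>x\<close>, taking a maximum becomes a disjunction and no case of an empty set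
  arises.\<close>

definition marked :: "memory \<Rightarrow> (nat \<Rightarrow> nat) \<Rightarrow> bool \<Rightarrow> nat list \<Rightarrow> nat \<Rightarrow> bool" where
  "marked \<sigma> PR b u k \<longleftrightarrow>
     (\<forall>j<n. \<forall>x. (x < \<sigma> aKEYLEV (PR j) \<longleftrightarrow> (\<exists>j'<k. sg j' \<noteq> 0 \<and> re j' = re j \<and> ke j' = ke j \<and> x < lev b u j')) \<and>
       (x < \<sigma> aPOSLEV (tu j) \<longleftrightarrow> (\<exists>j'<k. sg j' \<noteq> 0 \<and> tu j' = tu j \<and> x < lev b u j')) \<and>
       (x < \<sigma> aNEGLEV (tu j) \<longleftrightarrow> (\<exists>j'<k. sg j' = 0 \<and> tu j' = tu j \<and> x < lev b u j')))"

lemma wp_mark: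
  assumes l: "loaded \<sigma> vs" and LV: "levels_at \<sigma> vs b u"
    and z: "\<forall>j<n. \<sigma> aKEYLEV (\<sigma> aPAIR j) = 0 \<and> \<sigma> aPOSLEV (tu j) = 0 \<and> \<sigma> aNEGLEV (tu j) = 0"
    and post: "\<And>\<sigma>' t'. same (writes mark) \<sigma> \<sigma>' \<Longrightarrow> marked \<sigma>' (\<sigma> aPAIR) b u n \<Longrightarrow>
       t' \<le> t + 100 * (n + 1) \<Longrightarrow> Q \<sigma>' t'"
  shows "wp mark Q \<sigma> t"
proof -
  define I where "I k \<sigma>' t' \<longleftrightarrow> \<sigma>' vSTMT 0 = k \<and> t' \<le> t + 20 + 80 * k \<and> marked \<sigma>' (\<sigma> aPAIR) b u k" for k \<sigma>' t'
  note ld = loadedD[OF l]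
  show ?thesis
    unfolding mark_def wp_Seq wp_Store
  proof (rule wp_while[where I = I and n = n], goal_cases)
    case 1
    show ?case using z by (simp add: I_def marked_def)
  next
    case (2 k \<sigma>' t')
    then have s: "\<sigma>' aPAIR = \<sigma> aPAIR" "\<sigma>' aTUPLE k = tu k" "\<sigma>' aNODE k = ix vs (W k)" "\<sigma>' aIN = inp" "\<sigma>' aSIGN k = sg k"
      "\<sigma>' aLEVEL = \<sigma> aLEVEL"
      using ld by (auto simp: same_def)
    have lv: "\<sigma> aLEVEL (ix vs (W k)) = lev b u k" using LV 2(1) by (simp add: levels_at_def)
    have J: "\<sigma>' vSTMT 0 = k" and t': "t' \<le> t + 20 + 80 * k" and mk: "marked \<sigma>' (\<sigma> aPAIR) b u k"
      using 2(3) by (auto simp: I_def)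
    have max: "x < a + (c - a) \<longleftrightarrow> x < a \<or> x < c" for x a c :: nat by auto
    have Suc_ex: "(\<exists>j'<Suc k. P j') \<longleftrightarrow> (\<exists>j'<k. P j') \<or> P k" for P by (auto simp: less_Suc_eq)
    have pr: "\<sigma> aPAIR j = \<sigma> aPAIR k \<longleftrightarrow> re k = re j \<and> ke k = ke j" if "j < n" for j
      using ld(8)[OF that 2(1)] by auto
    show ?case
      using 2(1) t' mk
      by (simp add: s J lv) (auto simp: I_def marked_def Suc_ex pr max eq_commute[of "tu k"])
  next
    case (3 \<sigma>' t')
    then have s: "\<sigma>' aIN = inp" using ld by (simp add: same_def)
    have "same (writes mark) \<sigma> \<sigma>'" using 3(1) by (auto simp: same_def)
    then show ?case using 3(2) by (auto simp: s I_def intro!: post)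
  qed
qed

text \<open>The counterpart of \<open>survives\<close> on machine data, with levels in place of path
  lengths and suffix tests.\<close>

definition live :: "bool \<Rightarrow> nat list \<Rightarrow> nat \<Rightarrow> bool" where
  "live b u j \<longleftrightarrow> lev b u j \<noteq> 0 \<and> (\<forall>j'<n. lev b u j < lev b u j' \<longrightarrow>
     \<not> (if sg j = 0 then tu j' = tu j
        else if sg j' = 0 then tu j' = tu j else re j' = re j \<and> ke j' = ke j))"

lemma wp_scan:
  assumes l: "loaded \<sigma> vs" and LV: "levels_at \<sigma> vs b u" and mk: "marked \<sigma> (\<sigma> aPAIR) b u n"
    and post: "\<And>\<sigma>' t'. same (writes scan) \<sigma> \<sigma>' \<Longrightarrow>
       map (\<sigma>' aPOS) [0..<\<sigma>' vNPOS 0] = map tu (filter (\<lambda>j. sg j \<noteq> 0 \<and> live b u j) [0..<n]) \<Longrightarrow>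
       map (\<sigma>' aNEG) [0..<\<sigma>' vNNEG 0] = map tu (filter (\<lambda>j. sg j = 0 \<and> live b u j) [0..<n]) \<Longrightarrow>
       t' \<le> t + 100 * (n + 1) \<Longrightarrow> Q \<sigma>' t'"
  shows "wp scan Q \<sigma> t"
proof -
  define I where "I k \<sigma>' t' \<longleftrightarrow> \<sigma>' vSTMT 0 = k \<and> t' \<le> t + 30 + 80 * k \<and>
       map (\<sigma>' aPOS) [0..<\<sigma>' vNPOS 0] = map tu (filter (\<lambda>j. sg j \<noteq> 0 \<and> live b u j) [0..<k]) \<and>
       map (\<sigma>' aNEG) [0..<\<sigma>' vNNEG 0] = map tu (filter (\<lambda>j. sg j = 0 \<and> live b u j) [0..<k])"
    for k and \<sigma>' :: memory and t'
  note ld = loadedD[OF l]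
  show ?thesis
    unfolding scan_def wp_Seq wp_Store
  proof (rule wp_while[where I = I and n = n], goal_cases)
    case 1
    show ?case by (simp add: I_def)
  next
    case (2 k \<sigma>' t')
    then have s: "\<sigma>' aPAIR = \<sigma> aPAIR" "\<sigma>' aTUPLE k = tu k" "\<sigma>' aNODE k = ix vs (W k)" "\<sigma>' aIN = inp" "\<sigma>' aSIGN k = sg k"
      "\<sigma>' aLEVEL = \<sigma> aLEVEL" "\<sigma>' aKEYLEV = \<sigma> aKEYLEV" "\<sigma>' aPOSLEV = \<sigma> aPOSLEV" "\<sigma>' aNEGLEV = \<sigma> aNEGLEV"
      using ld by (auto simp: same_def)
    have lv: "\<sigma> aLEVEL (ix vs (W k)) = lev b u k" using LV 2(1) by (simp add: levels_at_def)
    have J: "\<sigma>' vSTMT 0 = k" and t': "t' \<le> t + 30 + 80 * k"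
      and ps: "map (\<sigma>' aPOS) [0..<\<sigma>' vNPOS 0] = map tu (filter (\<lambda>j. sg j \<noteq> 0 \<and> live b u j) [0..<k])"
      and ns: "map (\<sigma>' aNEG) [0..<\<sigma>' vNNEG 0] = map tu (filter (\<lambda>j. sg j = 0 \<and> live b u j) [0..<k])"
      using 2(3) by (auto simp: I_def)
    have m: "lev b u k < \<sigma> aKEYLEV (\<sigma> aPAIR k) \<longleftrightarrow> (\<exists>j'<n. sg j' \<noteq> 0 \<and> re j' = re k \<and> ke j' = ke k \<and> lev b u k < lev b u j')"
      "lev b u k < \<sigma> aPOSLEV (tu k) \<longleftrightarrow> (\<exists>j'<n. sg j' \<noteq> 0 \<and> tu j' = tu k \<and> lev b u k < lev b u j')"
      "lev b u k < \<sigma> aNEGLEV (tu k) \<longleftrightarrow> (\<exists>j'<n. sg j' = 0 \<and> tu j' = tu k \<and> lev b u k < lev b u j')"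
      using mk 2(1) by (auto simp: marked_def)
    have live: "live b u k \<longleftrightarrow> lev b u k \<noteq> 0 \<and>
        (if sg k = 0 then \<sigma> aPOSLEV (tu k) \<le> lev b u k \<and> \<sigma> aNEGLEV (tu k) \<le> lev b u k
         else \<sigma> aKEYLEV (\<sigma> aPAIR k) \<le> lev b u k \<and> \<sigma> aNEGLEV (tu k) \<le> lev b u k)"
      unfolding live_def not_less[symmetric] m by auto (metis neq0_conv)
    show ?case
    proof (intro conjI)
      show "val (eSTMTS \<ominus> var vSTMT) \<sigma>' \<noteq> 0" using 2(1) by (simp add: s J)
      show "wp scan_step (I (Suc k)) \<sigma>' (t' + Suc (cost (eSTMTS \<ominus> var vSTMT)))"
        unfolding scan_step_def using t' ps ns
        by (simp add: s J lv) (auto simp: I_def live not_le)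
    qed
  next
    case (3 \<sigma>' t')
    then have s: "\<sigma>' aIN = inp" using ld by (simp add: same_def)
    have "same (writes scan) \<sigma> \<sigma>'" using 3(1) by (auto simp: same_def)
    then show ?case using 3(2) by (auto simp: s I_def intro!: post)
  qed
qed

section \<open>Edges\<close>

lemma wp_target:
  assumes l: "loaded \<sigma> vs" and V: "\<sigma> vSTATE 0 = ix vs u" and u: "u \<in> set vs"
    and SN: "\<forall>k\<le>length u. \<sigma> aSUFFIX k = ix vs (drop (length u - k) u)"
    and i: "\<sigma> vUSER 0 = i" "i \<in> {1..m}"
    and post: "\<And>\<sigma>' t'. same (writes target) \<sigma> \<sigma>' \<Longrightarrow>
       \<sigma>' vTARGET 0 = ix vs (longest_suffix (set vs) (u @ [i])) \<Longrightarrow>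
       t' \<le> t + 100 * (d + 1) \<Longrightarrow> Q \<sigma>' t'"
  shows "wp target Q \<sigma> t"
proof -
  let ?s = "\<lambda>k. drop (Suc (length u) - k) (u @ [i])"
  define I where "I k \<sigma>' t' \<longleftrightarrow> \<sigma>' vLEN 0 = k \<and> t' \<le> t + 20 + 60 * k \<and>
     \<sigma>' vTARGET 0 = ix vs (longest_suffix (set vs) (?s k))" for k and \<sigma>' :: memory and t'
  have ud: "length u \<le> d" using l u by (rule loaded_length)
  note tr = trieD[OF loaded_trie[OF l]]
  show ?thesis
    unfolding target_def wp_Seq wp_Store
  proof (rule wp_while[where I = I and n = "Suc (length u)"], goal_cases)
    case 1
    show ?case by (simp add: I_def tr)
  next
    case (2 k \<sigma>' t')
    have s: "\<sigma>' aLEN = \<sigma> aLEN" "\<sigma>' vSTATE = \<sigma> vSTATE" "\<sigma>' aSUFFIX = \<sigma> aSUFFIX" "\<sigma>' aCHILD = \<sigma> aCHILD" "\<sigma>' aBASE = \<sigma> aBASE"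
      "\<sigma>' vUSER = \<sigma> vUSER" using 2(2) by (auto simp: same_def)
    let ?w = "drop (length u - k) u"
    have k: "k \<le> length u" using 2(1) by simp
    have sn: "\<sigma> aSUFFIX k = ix vs ?w" using SN 2(1) by auto
    have sk: "?s (Suc k) = ?w @ [i]" by simp
    \<comment> \<open>The loop lengthens the suffix while \<open>longest_suffix\<close> recurses by
      shortening it, so one iteration undoes one recursive call.\<close>
    have "?s k = tl (?s (Suc k))" using k
      by (simp add: tl_drop drop_Suc Suc_diff_le del: drop_append)
    then have ls: "longest_suffix (set vs) (?s (Suc k)) =
        (if ?w @ [i] \<in> set vs then ?w @ [i] else longest_suffix (set vs) (?s k))"
      unfolding sk by (cases "?w @ [i]") auto
    show ?case
      using 2(1,3) V tr(1)[OF u] i(1) tr(4)[of ?w] tr(5)[OF i(2), of ?w] ls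
      by (auto simp: I_def s sn simp del: drop_append)
  next
    case (3 \<sigma>' t')
    have s: "\<sigma>' aLEN = \<sigma> aLEN" "\<sigma>' vSTATE = \<sigma> vSTATE" using 3(1) by (auto simp: same_def)
    have "same (writes target) \<sigma> \<sigma>'" using 3(1) by (auto simp: same_def)
    then show ?case using 3(2) ud V tr(1)[OF u] by (auto simp: I_def s intro!: post)
  qed
qed

definition out_edges :: "nat list list \<Rightarrow> nat list \<Rightarrow> nat \<Rightarrow> (nat \<times> nat) list" where
  "out_edges vs u k = map (\<lambda>i. (i, ix vs (longest_suffix (set vs) (u @ [i])) - 1))
     (filter (\<lambda>i. u = [] \<or> last u \<noteq> i) [1..<Suc k])"

lemma wp_edges:
  assumes l: "loaded \<sigma> vs" and V: "\<sigma> vSTATE 0 = ix vs u" and u: "u \<in> set vs"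
    and SN: "\<forall>k\<le>length u. \<sigma> aSUFFIX k = ix vs (drop (length u - k) u)"
    and post: "\<And>\<sigma>' t'. same (writes edges_com) \<sigma> \<sigma>' \<Longrightarrow>
       \<sigma>' vNEDGE 0 = length (out_edges vs u m) \<Longrightarrow>
       map (\<sigma>' aEDGE) [0..<\<sigma>' vNEDGE 0 + \<sigma>' vNEDGE 0] = concat (map (\<lambda>(i, j). [i, j]) (out_edges vs u m)) \<Longrightarrow>
       t' \<le> t + 50 + m * (200 * (d + 1)) \<Longrightarrow> Q \<sigma>' t'"
  shows "wp edges_com Q \<sigma> t"
proof -
  define I where "I k \<sigma>' t' \<longleftrightarrow> \<sigma>' vUSER 0 = Suc k \<and> t' \<le> t + 20 + k * (200 * (d + 1)) \<and>
     \<sigma>' vNEDGE 0 = length (out_edges vs u k) \<and>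
     map (\<sigma>' aEDGE) [0..<\<sigma>' vNEDGE 0 + \<sigma>' vNEDGE 0] = concat (map (\<lambda>(i, j). [i, j]) (out_edges vs u k))"
     for k and \<sigma>' :: memory and t'
  show ?thesis
    unfolding edges_com_def wp_Seq wp_Store
  proof (rule wp_while[where I = I and n = m], goal_cases)
    case 1
    show ?case by (simp add: I_def out_edges_def)
  next
    case (2 k \<sigma>' t')
    have l': "loaded \<sigma>' vs" using 2(2) by (intro loaded_same[OF l, where A = "writes edges_com"]) (auto simp: same_def)
    have V': "\<sigma>' vSTATE 0 = ix vs u" using 2(2) V by (simp add: same_def)
    have SN': "\<forall>k\<le>length u. \<sigma>' aSUFFIX k = ix vs (drop (length u - k) u)" using 2(2) SN by (simp add: same_def)
    have iv: "\<sigma>' vUSER 0 = Suc k" "t' \<le> t + 20 + k * (200 * (d + 1))"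
      "\<sigma>' vNEDGE 0 = length (out_edges vs u k)"
      "map (\<sigma>' aEDGE) [0..<\<sigma>' vNEDGE 0 + \<sigma>' vNEDGE 0] = concat (map (\<lambda>(i, j). [i, j]) (out_edges vs u k))"
      using 2(3) by (auto simp: I_def)
    have inp: "\<sigma>' aIN = inp" using loadedD(1)[OF l'] .
    have k: "Suc k \<in> {1..m}" using 2(1) by simp
    have last: "\<sigma>' aLAST (ix vs u) = (if u = [] then 0 else last u)"
      using trieD(2)[OF loaded_trie[OF l'] u] .
    have eq: "a - Suc k + (Suc k - a) = 0 \<longleftrightarrow> a = Suc k" for a by auto
    have oe: "out_edges vs u (Suc k) = out_edges vs u k @
      (if u = [] \<or> last u \<noteq> Suc k then [(Suc k, ix vs (longest_suffix (set vs) (u @ [Suc k])) - 1)] else [])"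
      by (simp add: out_edges_def)
    show ?case
    proof (cases "u = [] \<or> last u \<noteq> Suc k")
      case False
      then show ?thesis using iv 2(1) oe by (simp add: inp V' last I_def)
    next
      case True
      then have ne: "(if u = [] then 0 else last u) - Suc k + (Suc k - (if u = [] then 0 else last u)) \<noteq> 0" 
        by (auto simp: eq)
      show ?thesis using 2(1) ne
        apply (simp add: inp V' last iv(1) del: add_is_0)
        apply (rule wp_target[OF l' V' u SN' iv(1) k])
        subgoal premises p for \<sigma>2 t2
        proof -
          have s: "\<sigma>2 vNEDGE = \<sigma>' vNEDGE" "\<sigma>2 aEDGE = \<sigma>' aEDGE" "\<sigma>2 vUSER = \<sigma>' vUSER" using p(3) by (auto simp: same_def)
          then show ?thesis using p(4,5) iv(1-3) True
            by (auto simp: I_def s oe algebra_simps iv(4)[unfolded iv(3), symmetric])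
        qed
        done
    qed
  next
    case (3 \<sigma>' t')
    have inp: "\<sigma>' aIN = inp" using 3(1) loadedD(1)[OF l] by (simp add: same_def)
    have "same (writes edges_com) \<sigma> \<sigma>'" using 3(1) by (auto simp: same_def)
    then show ?case using 3(2) by (auto simp: I_def inp intro!: post)
  qed
qed

end

section \<open>The whole program\<close>

abbreviation put :: "exp \<Rightarrow> com" where
  "put e \<equiv> Store aOUT (var vOUT) e ;; incr vOUT"

definition copy :: "nat \<Rightarrow> exp \<Rightarrow> exp \<Rightarrow> com" where
  "copy a s l = vPOS ::= Num 0 ;; While (l \<ominus> var vPOS) (put (Cell a (s \<oplus> var vPOS)) ;; incr vPOS)"

definition emit :: com where
  "emit =
     put (Cell aLEN (var vSTATE)) ;; copy aIN (Cell aSRC (var vSTATE)) (Cell aLEN (var vSTATE)) ;;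
     put (var vNPOS) ;; copy aPOS (Num 0) (var vNPOS) ;;
     put (var vNNEG) ;; copy aNEG (Num 0) (var vNNEG) ;;
     put (var vNEDGE) ;; copy aEDGE (Num 0) (var vNEDGE \<oplus> var vNEDGE)"

definition state_com :: com where
  "state_com = suffixes_com ;; reset ;; levels ;; mark ;; scan ;; edges_com ;; emit"

definition program :: com where
  "program = load ;; check ;; put (var vNODES) ;; put (Num 0) ;; vSTATE ::= Num 1 ;;
     While (var vNODES \<oplus> Num 1 \<ominus> var vSTATE) (state_com ;; incr vSTATE)"

lemma writes_copy [simp]: "writes (copy a s l) = {vPOS, aOUT, vOUT}"
  by (auto simp: copy_def)

lemma writes_emit [simp]: "writes emit = {vPOS, aOUT, vOUT}"
  by (auto simp: emit_def)

lemma writes_state_com [simp]: "writes state_com = {vNODE, vPOS, aSUFFIX, vLEN, vSTMT, aKEYLEV, aPOSLEV, aNEGLEV, aLEVEL,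
    aPOS, vNPOS, aNEG, vNNEG, vTARGET, vSLOT, vNEDGE, vUSER, aEDGE, aOUT, vOUT}"
  by (auto simp: state_com_def)

definition out :: "memory \<Rightarrow> nat list" where
  "out \<sigma> = map (\<sigma> aOUT) [0..<\<sigma> vOUT 0]"

lemma out_put: "\<sigma>' aOUT = (\<sigma> aOUT)(\<sigma> vOUT 0 := x) \<Longrightarrow> \<sigma>' vOUT 0 = Suc (\<sigma> vOUT 0) \<Longrightarrow> out \<sigma>' = out \<sigma> @ [x]"
  by (simp add: out_def)

lemma out_same: "\<sigma>' aOUT = \<sigma> aOUT \<Longrightarrow> \<sigma>' vOUT = \<sigma> vOUT \<Longrightarrow> out \<sigma>' = out \<sigma>"
  by (simp add: out_def)

text \<open>Source and length are re-evaluated in every iteration, hence their values must be stable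
  under writing output; the cost limit makes the time per entry a fixed constant.\<close>

lemma wp_copy:
  assumes a: "a \<notin> {vPOS, aOUT, vOUT}"
    and s: "\<And>\<sigma>'. same {vPOS, aOUT, vOUT} \<sigma> \<sigma>' \<Longrightarrow> val s \<sigma>' = val s \<sigma> \<and> val l \<sigma>' = val l \<sigma>"
    and c: "cost s + cost l \<le> 10"
    and post: "\<And>\<sigma>' t'. same {vPOS, aOUT, vOUT} \<sigma> \<sigma>' \<Longrightarrow>
      out \<sigma>' = out \<sigma> @ map (\<lambda>k. \<sigma> a (val s \<sigma> + k)) [0..<val l \<sigma>] \<Longrightarrow>
      t' \<le> t + 30 + 50 * val l \<sigma> \<Longrightarrow> Q \<sigma>' t'"
  shows "wp (copy a s l) Q \<sigma> t"
proof -
  define I where "I k \<sigma>' t' \<longleftrightarrow> \<sigma>' vPOS 0 = k \<and> t' \<le> t + 10 + 50 * k \<and>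
     out \<sigma>' = out \<sigma> @ map (\<lambda>k. \<sigma> a (val s \<sigma> + k)) [0..<k]" for k and \<sigma>' :: memory and t'
  show ?thesis
    unfolding copy_def wp_Seq wp_Store
  proof (rule wp_while[where I = I and n = "val l \<sigma>"], goal_cases)
    case 1
    show ?case by (simp add: I_def out_def)
  next
    case (2 k \<sigma>' t')
    have sm: "same {vPOS, aOUT, vOUT} \<sigma> \<sigma>'" using 2(2) by (auto simp: same_def)
    then have a': "\<sigma>' a = \<sigma> a" using a unfolding same_def by blast
    have q: "\<sigma>' vPOS 0 = k" and t': "t' \<le> t + 10 + 50 * k"
      and o: "out \<sigma>' = out \<sigma> @ map (\<lambda>k. \<sigma> a (val s \<sigma> + k)) [0..<k]" using 2(3) by (auto simp: I_def)
    have "out (\<sigma>'(aOUT := (\<sigma>' aOUT)(\<sigma>' vOUT 0 := \<sigma> a (val s \<sigma> + k)), vOUT := (\<sigma>' vOUT)(0 := Suc (\<sigma>' vOUT 0)),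
        vPOS := (\<sigma>' vPOS)(0 := Suc k))) = out \<sigma>' @ [\<sigma> a (val s \<sigma> + k)]"
      by (rule out_put) simp_all
    then show ?case using 2(1) s[OF sm] t' c o by (simp add: q a' I_def)
  next
    case (3 \<sigma>' t')
    have sm: "same {vPOS, aOUT, vOUT} \<sigma> \<sigma>'" using 3(1) by (auto simp: same_def)
    show ?case using s[OF sm] 3(2) sm c by (auto simp: I_def intro!: post)
  qed
qed

context ram_input
begin

definition pos_list :: "bool \<Rightarrow> nat list \<Rightarrow> nat list" where
  "pos_list b u = map tu (filter (\<lambda>j. sg j \<noteq> 0 \<and> live b u j) [0..<n])"

definition neg_list :: "bool \<Rightarrow> nat list \<Rightarrow> nat list" where
  "neg_list b u = map tu (filter (\<lambda>j. sg j = 0 \<and> live b u j) [0..<n])"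

definition state_words :: "bool \<Rightarrow> nat list list \<Rightarrow> nat list \<Rightarrow> nat list" where
  "state_words b vs u = length u # u @ length (pos_list b u) # pos_list b u @
     length (neg_list b u) # neg_list b u @
     length (out_edges vs u m) # concat (map (\<lambda>(i, j). [i, j]) (out_edges vs u m))"

lemma wp_emit:
  assumes l: "loaded \<sigma> vs" and V: "\<sigma> vSTATE 0 = ix vs u" and u: "u \<in> set vs"
    and ps: "map (\<sigma> aPOS) [0..<\<sigma> vNPOS 0] = pos_list b u"
    and ns: "map (\<sigma> aNEG) [0..<\<sigma> vNNEG 0] = neg_list b u"
    and e: "\<sigma> vNEDGE 0 = length (out_edges vs u m)"
      "map (\<sigma> aEDGE) [0..<\<sigma> vNEDGE 0 + \<sigma> vNEDGE 0] = concat (map (\<lambda>(i, j). [i, j]) (out_edges vs u m))"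
    and post: "\<And>\<sigma>' t'. same (writes emit) \<sigma> \<sigma>' \<Longrightarrow> out \<sigma>' = out \<sigma> @ state_words b vs u \<Longrightarrow>
       t' \<le> t + 300 * (n + (d + 1) * (d + 1) + m * (d + 1)) \<Longrightarrow> Q \<sigma>' t'"
  shows "wp emit Q \<sigma> t"
proof -
  note tr = trieD[OF loaded_trie[OF l]] loadedD[OF l]
  have lens: "\<sigma> vNPOS 0 = length (pos_list b u)" "\<sigma> vNNEG 0 = length (neg_list b u)"
    using arg_cong[OF ps, of length] arg_cong[OF ns, of length] by simp_all
  have "length (pos_list b u) \<le> n" "length (neg_list b u) \<le> n" "length (out_edges vs u m) \<le> m"
    using length_filter_le[of _ "[0..<n]"] length_filter_le[of _ "[1..<Suc m]"]
    by (simp_all add: pos_list_def neg_list_def out_edges_def del: upt_Suc filter.simps)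
  note le = this loaded_length[OF l u]
  have ins: "map (\<lambda>k. \<sigma> aIN (\<sigma> aSRC (ix vs u) + k)) [0..<length u] = u"
    using tr(3)[OF u] by (intro nth_equalityI) (auto simp: tr(9))
  have put: "out (\<sigma>'(Suc 0 := (\<sigma>' (Suc 0))(\<sigma>' vOUT 0 := x), vOUT := (\<sigma>' vOUT)(0 := Suc (\<sigma>' vOUT 0)))) = out \<sigma>' @ [x]"
    for \<sigma>' x by (rule out_put) simp_all
  have dd: "d + 1 \<le> (d + 1) * (d + 1)" "m \<le> m * (d + 1)" by simp_all
  have bound: "t' \<le> t + 300 * (n + (d + 1) * (d + 1) + m * (d + 1))"
    if "t' \<le> t + 300 + 50 * (d + n + n + m + m)" for t'
  proof -
    \<comment> \<open>Variables replace the two products, which turns the estimate into linear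
      arithmetic.\<close>
    have "t' \<le> t + 300 * (n + x + y)" if "d + 1 \<le> x" "m \<le> y" for x y
      using that \<open>t' \<le> t + 300 + 50 * (d + n + n + m + m)\<close> n_pos by simp
    then show ?thesis using dd by blast
  qed
  show ?thesis
    unfolding emit_def wp_Seq wp_Store
    apply (rule wp_copy)
       apply simp
      apply (simp add: same_def)
     apply simp
    unfolding wp_Seq wp_Store
    apply (rule wp_copy)
       apply simp
      apply (simp add: same_def)
     apply simp
    unfolding wp_Seq wp_Store
    apply (rule wp_copy)
       apply simp
      apply (simp add: same_def)
     apply simp
    unfolding wp_Seq wp_Store
    apply (rule wp_copy)
       apply simp
      apply (simp add: same_def)
     apply simp
    subgoal premises p for \<sigma>1 t1 \<sigma>2 t2 \<sigma>3 t3 \<sigma>4 t4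
    proof -
      have sm: "same (writes emit) \<sigma> \<sigma>4"
        using p(1,4,7,10) by (auto simp: same_def)
      have s: "\<sigma>1 a = \<sigma> a" "\<sigma>2 a = \<sigma> a" "\<sigma>3 a = \<sigma> a" if "a \<in> {vSTATE, vNPOS, vNNEG, vNEDGE, aPOS, aNEG, aEDGE}" for a
        using p(1,4,7) that by (auto simp: same_def)
      have lenu: "\<sigma> aLEN (\<sigma> vSTATE 0) = length u" using tr(1)[OF u] V by simp
      have o1: "out \<sigma>1 = out \<sigma> @ length u # u"
        using p(2) by (simp add: put lenu ins[folded V])
      have o2: "out \<sigma>2 = out \<sigma>1 @ length (pos_list b u) # pos_list b u"
        using p(5) by (simp add: put s lens(1) ps[unfolded lens])
      have o3: "out \<sigma>3 = out \<sigma>2 @ length (neg_list b u) # neg_list b u"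
        using p(8) by (simp add: put s lens(2) ns[unfolded lens])
      have o4: "out \<sigma>4 = out \<sigma> @ state_words b vs u"
        using p(11) e by (simp add: put s o3 o2 o1 state_words_def)
      show ?thesis
        by (rule post[OF sm o4], rule bound)
          (use p(3,6,9,12) le in \<open>simp add: lenu s lens e(1)\<close>)
    qed
    done
qed

lemma wp_state:
  assumes l: "loaded \<sigma> vs" and V: "\<sigma> vSTATE 0 = ix vs u" and u: "u \<in> set vs" and b: "b \<longleftrightarrow> \<sigma> vCLASH 0 \<noteq> 0"
    and post: "\<And>\<sigma>' t'. same (writes state_com) \<sigma> \<sigma>' \<Longrightarrow> out \<sigma>' = out \<sigma> @ state_words b vs u \<Longrightarrow>
       t' \<le> t + 1000 * (n + (d + 1) * (d + 1) + m * (d + 1)) \<Longrightarrow> Q \<sigma>' t'"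
  shows "wp state_com Q \<sigma> t"
  unfolding state_com_def wp_Seq
proof (rule wp_suffixes[OF l V u], goal_cases)
  case 1: (1 \<sigma>1 t1)
  have l1: "loaded \<sigma>1 vs" by (rule loaded_same[OF l 1(1)]) auto
  show ?case
  proof (rule wp_reset[OF l1], goal_cases)
    case 2: (1 \<sigma>2 t2)
    have l2: "loaded \<sigma>2 vs" by (rule loaded_same[OF l1 2(1)]) auto
    have c2: "\<sigma>2 vSTATE = \<sigma> vSTATE" "\<sigma>2 vCLASH = \<sigma> vCLASH" "\<sigma>2 aSUFFIX = \<sigma>1 aSUFFIX" "\<sigma>2 aPAIR = \<sigma>1 aPAIR"
      using 1(1) 2(1) by (auto simp: same_def)
    show ?case
    proof (rule wp_levels[OF l2 _ u], goal_cases)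
      case 3: (4 \<sigma>3 t3)
      have l3: "loaded \<sigma>3 vs" by (rule loaded_same[OF l2 3(1)]) auto
      have lv3: "levels_at \<sigma>3 vs b u" using 3(2) by (simp add: levels_at_def b c2)
      have c3: "\<sigma>3 aPAIR = \<sigma>1 aPAIR" "\<sigma>3 aKEYLEV = \<sigma>2 aKEYLEV" "\<sigma>3 aPOSLEV = \<sigma>2 aPOSLEV" "\<sigma>3 aNEGLEV = \<sigma>2 aNEGLEV"
        using 3(1) c2 by (auto simp: same_def)
      show ?case
      proof (rule wp_mark[OF l3 lv3], goal_cases)
        case 4: (2 \<sigma>4 t4)
        have l4: "loaded \<sigma>4 vs" by (rule loaded_same[OF l3 4(1)]) auto
        have lv4: "levels_at \<sigma>4 vs b u" using lv3 4(1) by (simp add: levels_at_def same_def)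
        have mk4: "marked \<sigma>4 (\<sigma>4 aPAIR) b u n" using 4(1,2) by (simp add: same_def)
        show ?case
        proof (rule wp_scan[OF l4 lv4 mk4], goal_cases)
          case 5: (1 \<sigma>5 t5)
          have l5: "loaded \<sigma>5 vs" by (rule loaded_same[OF l4 5(1)]) auto
          have V5: "\<sigma>5 vSTATE 0 = ix vs u" and SN5: "\<forall>k\<le>length u. \<sigma>5 aSUFFIX k = ix vs (drop (length u - k) u)"
            using 1 2(1) 3(1) 4(1) 5(1) V by (auto simp: same_def)
          show ?case
          proof (rule wp_edges[OF l5 V5 u SN5], goal_cases)
            case 6: (1 \<sigma>6 t6)
            have l6: "loaded \<sigma>6 vs" by (rule loaded_same[OF l5 6(1)]) auto
            have V6: "\<sigma>6 vSTATE 0 = ix vs u" using V5 6(1) by (simp add: same_def)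
            have ps: "map (\<sigma>6 aPOS) [0..<\<sigma>6 vNPOS 0] = pos_list b u" "map (\<sigma>6 aNEG) [0..<\<sigma>6 vNNEG 0] = neg_list b u"
              using 5(2,3) 6(1) by (simp_all add: same_def pos_list_def neg_list_def)
            have o: "out \<sigma>6 = out \<sigma>"
              using 1(1) 2(1) 3(1) 4(1) 5(1) 6(1) by (intro out_same) (auto simp: same_def)
            show ?case
            proof (rule wp_emit[OF l6 V6 u ps 6(2,3)], goal_cases)
              case 7: (1 \<sigma>7 t7)
              have "same (writes state_com) \<sigma> \<sigma>7"
                using 1(1) 2(1) 3(1) 4(1) 5(1) 6(1) 7(1) by (auto simp: same_def)
              moreover have "t7 + 6 \<le> t + 1000 * (n + (d + 1) * (d + 1) + m * (d + 1))"
                using 1(3) 2(3) 3(3) 4(3) 5(4) 6(4) 7(3) n_pos by (simp add: algebra_simps)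
              ultimately show ?case using 7(2) o by (intro post) auto
            qed
          qed
        qed
      qed (use 2(2) c3 in auto)
    qed (use 1(2) 2(2) V c2 in auto)
  qed
qed

lemma wp_program:
  assumes I: "\<sigma> = (\<lambda>a. if a = 0 then inp else (\<lambda>_. 0))"
    and post: "\<And>\<sigma>' t' vs b. distinct vs \<Longrightarrow> vs \<noteq> [] \<Longrightarrow> vs ! 0 = [] \<Longrightarrow>
       set vs = {w. \<exists>j<n. prefix w (W j)} \<Longrightarrow> (b \<longleftrightarrow> (\<exists>j<n. \<exists>j'<j. clash j' j)) \<Longrightarrow>
       out \<sigma>' = length vs # 0 # concat (map (state_words b vs) vs) \<Longrightarrow>
       t' \<le> t + 2000 * (n * (d + 1) + length vs * (n + (d + 1) * (d + 1) + m * (d + 1))) \<Longrightarrow> Q \<sigma>' t'"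
  shows "wp program Q \<sigma> t"
  unfolding program_def wp_Seq
proof (rule wp_load[OF I], goal_cases)
  case 1: (1 \<sigma>1 t1 vs)
  have l1: "loaded \<sigma>1 vs" using 1 by (simp add: loaded_def)
  show ?case
  proof (rule wp_check[OF l1], goal_cases)
    case 2: (1 \<sigma>2 t2)
    define b where "b \<longleftrightarrow> \<sigma>2 vCLASH 0 \<noteq> 0"
    have l2: "loaded \<sigma>2 vs" by (rule loaded_same[OF l1 2(1)]) auto
    have o2: "\<sigma>2 vOUT 0 = 0" using 1(1) 2(1) by (simp add: same_def I)
    let ?c = "1100 * (n + (d + 1) * (d + 1) + m * (d + 1))"
    define J where "J k \<sigma>' t' \<longleftrightarrow> \<sigma>' vSTATE 0 = Suc k \<and> t' \<le> t2 + 100 + k * ?c \<and>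
      out \<sigma>' = length vs # 0 # concat (map (state_words b vs) (take k vs))" for k and \<sigma>' :: memory and t'
    show ?case unfolding wp_Store
    proof (rule wp_while[where I = J and n = "length vs"], goal_cases)
      case 1
      show ?case using loadedD(2)[OF l2] by (simp add: J_def out_def o2)
    next
      case (2 k \<sigma>' t')
      have l': "loaded \<sigma>' vs" using 2(2)
        by (intro loaded_same[OF l2, where A = "writes state_com \<union> {vSTATE}"]) (auto simp: same_def)
      have b': "b \<longleftrightarrow> \<sigma>' vCLASH 0 \<noteq> 0" using 2(2) by (simp add: same_def b_def)
      have V: "\<sigma>' vSTATE 0 = ix vs (vs ! k)" using 2(1,3) loadedD(7)[OF l2] by (simp add: J_def ix_nth)
      show ?case
      proof (intro conjI)
        show "val (var vNODES \<oplus> Num 1 \<ominus> var vSTATE) \<sigma>' \<noteq> 0" using 2(1,3) loadedD(2)[OF l'] by (simp add: J_def)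
        show "wp (state_com ;; incr vSTATE) (J (Suc k)) \<sigma>' (t' + Suc (cost (var vNODES \<oplus> Num 1 \<ominus> var vSTATE)))"
          unfolding wp_Seq
        proof (rule wp_state[OF l' V _ b'], goal_cases)
          case 1
          show ?case using 2(1) by simp
        next
          case s: (2 \<sigma>3 t3)
          have "\<sigma>3 vSTATE = \<sigma>' vSTATE" using s(1) by (simp add: same_def)
          moreover have "out (\<sigma>3(vSTATE := x)) = out \<sigma>3" for x by (simp add: out_def)
          ultimately show ?case using s(2,3) 2(1,3) n_pos
            by (simp add: J_def take_Suc_conv_app_nth algebra_simps)
        qed
      qed
    next
      case (3 \<sigma>' t')
      have l': "loaded \<sigma>' vs" using 3(1)
        by (intro loaded_same[OF l2, where A = "writes state_com \<union> {vSTATE}"]) (auto simp: same_def)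
      have vs: "distinct vs" "vs \<noteq> []" "vs ! 0 = []" using l2 by (auto simp: loaded_def trie_def)
      \<comment> \<open>The trie invariant provides closure under deleting one letter only;
        iterating it gives all prefixes.\<close>
      have closed: "w @ v \<in> set vs \<Longrightarrow> w \<in> set vs" for w v
      proof (induction v rule: rev_induct)
        case (snoc i v)
        then show ?case using l2 unfolding loaded_def trie_def by (metis append_assoc)
      qed simp
      have "set vs = {w. \<exists>j<n. prefix w (W j)}"
        using l2 loadedD(4)[OF l2] by (auto simp: loaded_def prefix_def) (metis closed)
      note set_vs = this
      have b: "b \<longleftrightarrow> (\<exists>j<n. \<exists>j'<j. clash j' j)" using 2(2) by (simp add: b_def)
      have o: "out \<sigma>' = length vs # 0 # concat (map (state_words b vs) vs)" and v: "\<sigma>' vSTATE 0 = Suc (length vs)"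
        using 3(2) by (auto simp: J_def)
      have time: "t' + 20 \<le> t + 2000 * (n * (d + 1) + length vs * (n + (d + 1) * (d + 1) + m * (d + 1)))"
      proof -
        \<comment> \<open>With at least one state and one statement, additive constants and the
          terms \<open>length vs\<close> and \<open>n\<close> are absorbed by
          \<open>length vs * n\<close>.\<close>
        have "1 \<le> length vs" using vs(2) by (simp add: Suc_le_eq)
        then have "length vs * 1 \<le> length vs * n" "1 * n \<le> length vs * n"
          using n_pos by (intro mult_le_mono; simp)+
        then show ?thesis
          using 3(2) 1(6) 2(3) vs(2) n_pos by (simp add: J_def algebra_simps)
      qed
      have "Q \<sigma>' t''" if "t'' \<le> t' + 20" for t''
        by (rule post[OF vs set_vs b o]) (use time that in linarith)
      then show ?case using loadedD(2)[OF l'] v by simp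
    qed
  qed
qed

end

section \<open>Correctness of the output\<close>

lemma longest_suffix_props:
  assumes "[] \<in> A"
  shows "longest_suffix A w \<in> A \<and> suffix (longest_suffix A w) w \<and>
    (\<forall>v\<in>A. suffix v w \<longrightarrow> length v \<le> length (longest_suffix A w))"
proof (induction w)
  case (Cons i w)
  then show ?case
    by (auto simp: suffix_Cons dest: suffix_length_le)
qed (use assms in simp)

lemma dss_eq_longest_suffix:
  assumes "[] \<in> db_states m D"
  shows "dss m D w = longest_suffix (db_states m D) w"
  using longest_suffix_props[OF assms, of w] by (intro dss_eqI) auto

lemma paths_snoc:
  assumes "u \<in> paths m"
  shows "u @ [i] \<in> paths m \<longleftrightarrow> i \<in> {1..m} \<and> (u = [] \<or> last u \<noteq> i)"
proof -
  have "(\<forall>k. Suc k < length (u @ [i]) \<longrightarrow> (u @ [i]) ! k \<noteq> (u @ [i]) ! Suc k) \<longleftrightarrow>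
      (\<forall>k. Suc k < length u \<longrightarrow> u ! k \<noteq> u ! Suc k) \<and> (u = [] \<or> last u \<noteq> i)"
    (is "?l \<longleftrightarrow> ?r")
  proof
    assume l: ?l
    have "u ! k \<noteq> u ! Suc k" if "Suc k < length u" for k
      using l that by (auto dest!: spec[of _ k] simp: nth_append)
    moreover have "last u \<noteq> i" if "u \<noteq> []"
      using l that by (auto dest!: spec[of _ "length u - 1"] simp: nth_append last_conv_nth)
    ultimately show ?r by blast
  next
    assume r: ?r
    show ?l
    proof (intro allI impI)
      fix k assume k: "Suc k < length (u @ [i])"
      show "(u @ [i]) ! k \<noteq> (u @ [i]) ! Suc k"
      proof (cases "Suc k = length u")
        case True
        then have "k = length u - 1" "u \<noteq> []" by auto
        then have "last u = u ! k" by (simp add: last_conv_nth)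
        with r True \<open>u \<noteq> []\<close> show ?thesis by (auto simp: nth_append)
      qed (use r k in \<open>auto simp: nth_append\<close>)
    qed
  qed
  with assms show ?thesis by (auto simp: paths_def)
qed

lemma nth_concat_take:
  assumes "j < length xss" "q < length (xss ! j)"
  shows "length (concat (take j xss)) + q < length (concat xss)"
    "concat xss ! (length (concat (take j xss)) + q) = xss ! j ! q"
proof -
  have "concat xss = concat (take j xss) @ xss ! j @ concat (drop (Suc j) xss)"
    using assms(1) by (metis concat.simps(2) concat_append id_take_nth_drop)
  with assms(2) show "length (concat (take j xss)) + q < length (concat xss)"
    "concat xss ! (length (concat (take j xss)) + q) = xss ! j ! q"
    by (simp_all add: nth_append)
qed

lemma finite_depth:
  assumes "finite D" "D \<noteq> {}"
  obtains x where "x \<in> D" "length (path_of x) = depth D"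
proof -
  have "depth D \<in> (\<lambda>\<phi>. length (path_of \<phi>)) ` D"
    unfolding depth_def using assms by (intro Max_in) auto
  then show ?thesis using that by auto
qed

text \<open>A path of length at least two has different neighbouring letters, hence two users. These
  are the side conditions on \<open>m\<close> in \<open>time_bound\<close>.\<close>

lemma depth_users:
  assumes "belief_db m D" "finite D" "D \<noteq> {}"
  shows "depth D \<noteq> 0 \<Longrightarrow> 0 < m" "1 < depth D \<Longrightarrow> 1 < m"
proof -
  obtain x where x: "x \<in> D" "length (path_of x) = depth D" using finite_depth assms by blast
  let ?w = "path_of x"
  have w: "?w \<in> paths m" using x(1) assms(1) by (auto simp: belief_db_def)
  show "0 < m" if "depth D \<noteq> 0"
  proof -
    have "?w ! 0 \<in> set ?w" using that x(2) by (intro nth_mem) simp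
    with w show ?thesis by (auto simp: paths_def)
  qed
  show "1 < m" if "1 < depth D"
  proof -
    have "set ?w \<subseteq> {1..m}" using w by (simp add: paths_def)
    moreover have "?w ! 0 \<in> set ?w" "?w ! 1 \<in> set ?w" using that x(2) by (auto intro: nth_mem)
    moreover have "?w ! 0 \<noteq> ?w ! 1" using w that x(2) by (auto simp: paths_def)
    ultimately have "?w ! 0 \<in> {1..m}" "?w ! 1 \<in> {1..m}" "?w ! 0 \<noteq> ?w ! 1" by blast+
    then show ?thesis by auto
  qed
qed

section \<open>From machine data back to statements\<close>

locale coded_db =
  fixes S :: "('t, 'v) schema" and m :: nat and D :: "'t stmt set" and xs :: "'t stmt list"
    and tc :: "'t \<Rightarrow> nat" and kc :: "'v \<Rightarrow> nat"
  assumes db: "belief_db m D" and nonempty: "D \<noteq> {}" and dist: "distinct xs" and set_xs: "set xs = D"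
    and tc: "inj_on tc (tuple_of ` D)" and kc: "inj_on kc (key_of S ` tuple_of ` D)"
begin

definition input where
  "input k = (if k < length (db_code S tc kc m xs) then db_code S tc kc m xs ! k else 0)"

text \<open>The 2 skips the header, consisting of the number of users and the number of
  statements.\<close>

definition stmt_pos where
  "stmt_pos j = 2 + length (concat (take j (map (stmt_code S tc kc) xs)))"

lemma finite_D: "finite D"
  using set_xs by auto

lemma input_stmt:
  assumes "j < length xs" "q < length (stmt_code S tc kc (xs ! j))"
  shows "input (stmt_pos j + q) = stmt_code S tc kc (xs ! j) ! q"
  using nth_concat_take[of j "map (stmt_code S tc kc) xs" q] assms
  by (simp add: input_def stmt_pos_def db_code_def)

lemma stmt_code_eq:
  "stmt_code S tc kc x = length (path_of x) # path_of x @
     [sign_code (sign_of x), rel_of S (tuple_of x), kc (key_of S (tuple_of x)), tc (tuple_of x)]"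
  by (cases x) simp

sublocale ram_input m "length xs" "depth D" input "\<lambda>j. path_of (xs ! j)"
  "\<lambda>j. sign_code (sign_of (xs ! j))" "\<lambda>j. rel_of S (tuple_of (xs ! j))"
  "\<lambda>j. kc (key_of S (tuple_of (xs ! j)))" "\<lambda>j. tc (tuple_of (xs ! j))" stmt_pos
proof unfold_locales
  show "input 0 = m" "input 1 = length xs" by (simp_all add: input_def db_code_def)
  show "stmt_pos 0 = 2" by (simp add: stmt_pos_def)
  show "0 < length xs" using nonempty set_xs by auto
  fix j assume j: "j < length xs"
  let ?w = "path_of (xs ! j)"
  show "stmt_pos (Suc j) = stmt_pos j + length ?w + 5"
    using j by (simp add: stmt_pos_def take_Suc_conv_app_nth stmt_code_eq)
  note i = input_stmt[OF j, unfolded stmt_code_eq]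
  show "input (stmt_pos j) = length ?w" using i[of 0] by simp
  show "input (stmt_pos j + length ?w + 1) = sign_code (sign_of (xs ! j))"
    using i[of "length ?w + 1"] by (simp add: nth_append)
  show "input (stmt_pos j + length ?w + 2) = rel_of S (tuple_of (xs ! j))"
    using i[of "length ?w + 2"] by (simp add: nth_append nth_Cons' add.assoc)
  show "input (stmt_pos j + length ?w + 3) = kc (key_of S (tuple_of (xs ! j)))"
    using i[of "length ?w + 3"] by (simp add: nth_append nth_Cons' add.assoc)
  show "input (stmt_pos j + length ?w + 4) = tc (tuple_of (xs ! j))"
    using i[of "length ?w + 4"] by (simp add: nth_append nth_Cons' add.assoc)
  have x: "xs ! j \<in> D" using j set_xs by auto
  then show "set ?w \<subseteq> {1..m}" using db by (auto simp: belief_db_def paths_def)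
  show "length ?w \<le> depth D" using finite_D x by (rule length_le_depth)
  fix q assume "q < length ?w"
  then show "input (stmt_pos j + 1 + q) = ?w ! q" using i[of "Suc q"] by (simp add: nth_append)
qed

lemma sign_code_eq_0 [simp]: "sign_code s = 0 \<longleftrightarrow> s = Neg" "0 < sign_code s \<longleftrightarrow> s = Pos"
  by (cases s; simp)+

lemma nth_D: "j < length xs \<Longrightarrow> xs ! j \<in> D"
  using set_xs by auto

lemma tc_eq: "x \<in> D \<Longrightarrow> y \<in> D \<Longrightarrow> tc (tuple_of x) = tc (tuple_of y) \<longleftrightarrow> tuple_of x = tuple_of y"
  using tc by (auto simp: inj_on_def)

lemma kc_eq: "x \<in> D \<Longrightarrow> y \<in> D \<Longrightarrow>
    kc (key_of S (tuple_of x)) = kc (key_of S (tuple_of y)) \<longleftrightarrow> key_of S (tuple_of x) = key_of S (tuple_of y)"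
  using kc by (auto simp: inj_on_def)

lemma conflict_iff:
  "conflict S x y \<longleftrightarrow> path_of x = path_of y \<and>
     (sign_of x = Pos \<and> sign_of y = Pos \<and> key_conflict S (tuple_of x) (tuple_of y) \<or>
      sign_of x \<noteq> sign_of y \<and> tuple_of x = tuple_of y)"
  by (cases x; cases y) simp

lemma blocks_iff:
  "blocks S y x \<longleftrightarrow> length (path_of x) < length (path_of y) \<and>
     (if sign_of x = Neg then tuple_of y = tuple_of x
      else if sign_of y = Neg then tuple_of y = tuple_of x
      else rel_of S (tuple_of y) = rel_of S (tuple_of x) \<and> key_of S (tuple_of y) = key_of S (tuple_of x))"
  by (cases x; cases y; cases "sign_of x"; cases "sign_of y") auto

text \<open>Different positions hold different statements, so equal path and sign force different
  tuples; the inequality required by \<open>key_conflict\<close> is then automatic.\<close>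

lemma clash_iff_conflict:
  assumes "j' < length xs" "j < length xs" "j' \<noteq> j"
  shows "clash j' j \<longleftrightarrow> conflict S (xs ! j') (xs ! j)"
proof -
  have "xs ! j' \<noteq> xs ! j" using assms dist by (simp add: nth_eq_iff_index_eq)
  then have "\<not> (path_of (xs ! j') = path_of (xs ! j) \<and> tuple_of (xs ! j') = tuple_of (xs ! j) \<and>
      sign_of (xs ! j') = sign_of (xs ! j))" by (metis stmt.expand)
  then show ?thesis
    using tc_eq kc_eq nth_D assms(1,2)
    by (cases "sign_of (xs ! j)"; cases "sign_of (xs ! j')")
       (auto simp: clash_def conflict_iff key_conflict_def)
qed

lemma clash_iff_inconsistent:
  "(\<exists>j<length xs. \<exists>j'<j. clash j' j) \<longleftrightarrow> \<not> consistent S m D"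
proof -
  have p: "path_of x \<in> paths m" if "x \<in> D" for x using db that by (auto simp: belief_db_def)
  have irrefl: "\<not> conflict S x x" for x by (simp add: conflict_iff key_conflict_def)
  show ?thesis
  proof
    assume "\<exists>j<length xs. \<exists>j'<j. clash j' j"
    then obtain j j' where j: "j < length xs" "j' < j" "clash j' j" by blast
    then have "conflict S (xs ! j') (xs ! j)" using clash_iff_conflict[of j' j] by simp
    with j p nth_D[of j] nth_D[of j'] show "\<not> consistent S m D" by (auto simp: consistent_iff)
  next
    assume "\<not> consistent S m D"
    then obtain x y where xy: "x \<in> D" "y \<in> D" "conflict S x y" by (auto simp: consistent_iff)
    then obtain i j where ij: "i < length xs" "j < length xs" "x = xs ! i" "y = xs ! j"
      using set_xs by (metis in_set_conv_nth)
    then have "i \<noteq> j" using xy irrefl by auto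
    then consider "i < j" | "j < i" by linarith
    then show "\<exists>j<length xs. \<exists>j'<j. clash j' j"
      using clash_iff_conflict[of i j] clash_iff_conflict[of j i] conflict_sym[OF xy(3)] xy ij
      by cases auto
  qed
qed

text \<open>In the inconsistent case all relevant statements lie at \<open>u\<close> and have the
  same level, so nothing is blocked. Otherwise strict comparison of levels is comparison of path
  lengths among suffixes of \<open>u\<close>.\<close>

lemma live_iff:
  assumes "j < length xs" "u \<in> paths m" and b: "b \<longleftrightarrow> \<not> consistent S m D"
  shows "live b u j \<longleftrightarrow> (if b then path_of (xs ! j) = u else survives S D u (xs ! j))"
proof (cases b)
  case True
  then have ne: "lev b u j \<noteq> 0 \<longleftrightarrow> path_of (xs ! j) = u" by (simp add: lev_def)
  have "lev b u j' \<le> Suc (length u)" for j' using True by (simp add: lev_def)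
  moreover have "lev b u j = Suc (length u)" if "path_of (xs ! j) = u" using that True by (simp add: lev_def)
  ultimately have "\<not> lev b u j < lev b u j'" if "path_of (xs ! j) = u" for j'
    using that by (simp add: not_less)
  with ne True show ?thesis by (auto simp: live_def)
next
  case False
  have "\<not> b" by fact
  have lev: "lev b u j < lev b u j' \<longleftrightarrow>
      suffix (path_of (xs ! j')) u \<and> length (path_of (xs ! j)) < length (path_of (xs ! j'))"
    if "suffix (path_of (xs ! j)) u" for j' using that False by (simp add: lev_def)
  have main: "(\<forall>j'<length xs. lev b u j < lev b u j' \<longrightarrow>
     \<not> (if sign_of (xs ! j) = Neg then tc (tuple_of (xs ! j')) = tc (tuple_of (xs ! j))
        else if sign_of (xs ! j') = Neg then tc (tuple_of (xs ! j')) = tc (tuple_of (xs ! j))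
        else rel_of S (tuple_of (xs ! j')) = rel_of S (tuple_of (xs ! j)) \<and>
          kc (key_of S (tuple_of (xs ! j'))) = kc (key_of S (tuple_of (xs ! j))))) \<longleftrightarrow>
    (\<forall>y\<in>D. suffix (path_of y) u \<longrightarrow> \<not> blocks S y (xs ! j))" (is "?B \<longleftrightarrow> ?D")
    if "suffix (path_of (xs ! j)) u"
    unfolding lev[OF that] set_xs[symmetric] all_set_conv_all_nth blocks_iff
    using tc_eq[OF nth_D nth_D[OF assms(1)]] kc_eq[OF nth_D nth_D[OF assms(1)]] by auto
  have "lev b u j \<noteq> 0 \<longleftrightarrow> suffix (path_of (xs ! j)) u" using False by (simp add: lev_def)
  moreover have "live b u j \<longleftrightarrow> lev b u j \<noteq> 0 \<and> ?B"
    by (simp only: live_def sign_code_eq_0)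
  moreover have "survives S D u (xs ! j) \<longleftrightarrow> suffix (path_of (xs ! j)) u \<and> ?D"
    using nth_D[OF assms(1)] by (simp add: survives_def)
  ultimately show ?thesis unfolding if_not_P[OF False] using main by blast
qed

text \<open>Of two live statements with the same sign and tuple, a strictly deeper one would block
  the other. So their levels agree, which makes the paths equal; hence the printed lists have no
  repetitions.\<close>

lemma live_inj:
  assumes "j < length xs" "j' < length xs" "live b u j" "live b u j'"
    "sign_of (xs ! j) = sign_of (xs ! j')" "tc (tuple_of (xs ! j)) = tc (tuple_of (xs ! j'))"
  shows "j = j'"
proof -
  have t: "tuple_of (xs ! j) = tuple_of (xs ! j')" using tc_eq nth_D assms by blast
  have "\<not> lev b u j < lev b u j'" "\<not> lev b u j' < lev b u j" and ne: "lev b u j \<noteq> 0" "lev b u j' \<noteq> 0"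
    using assms t by (auto simp: live_def split: if_splits)
  then have "lev b u j = lev b u j'" by simp
  then have "path_of (xs ! j) = path_of (xs ! j')"
    using ne by (auto simp: lev_def suffix_def split: if_splits)
  then have "xs ! j = xs ! j'" using t assms(5) by (metis stmt.expand)
  with dist assms(1,2) show ?thesis by (simp add: nth_eq_iff_index_eq)
qed

lemma live_set:
  assumes "u \<in> paths m" and b: "b \<longleftrightarrow> \<not> consistent S m D"
  shows "(\<lambda>j. tc (tuple_of (xs ! j))) ` {j. j < length xs \<and> sign_of (xs ! j) = s \<and> live b u j} =
    tc ` {t. Stmt u t s \<in> theory_of S m D}"
proof -
  have "tuple_of ` (\<lambda>j. xs ! j) ` {j. j < length xs \<and> sign_of (xs ! j) = s \<and> live b u j} =
    {t. \<exists>w. Stmt w t s \<in> D \<and> (if b then w = u else survives S D u (Stmt w t s))}" (is "?A = ?B")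
  proof
    show "?A \<subseteq> ?B"
    proof
      fix t assume "t \<in> ?A"
      then obtain j where j: "j < length xs" "sign_of (xs ! j) = s" "live b u j" "t = tuple_of (xs ! j)" by blast
      then have "xs ! j = Stmt (path_of (xs ! j)) t s" by (metis stmt.collapse)
      with j live_iff[OF j(1) assms] nth_D[OF j(1)] show "t \<in> ?B" by (metis (mono_tags, lifting) mem_Collect_eq)
    qed
    show "?B \<subseteq> ?A"
    proof
      fix t assume "t \<in> ?B"
      then obtain w where w: "Stmt w t s \<in> D" "if b then w = u else survives S D u (Stmt w t s)" by blast
      then obtain j where j: "j < length xs" "xs ! j = Stmt w t s" using set_xs by (metis in_set_conv_nth)
      with w live_iff[OF j(1) assms] have "live b u j" by simp
      with j show "t \<in> ?A" by (intro image_eqI[of _ _ "xs ! j"] image_eqI[of _ _ j]) auto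
    qed
  qed
  also have "?B = {t. Stmt u t s \<in> theory_of S m D}"
  proof (cases b)
    case True
    then show ?thesis using theory_of_inconsistent[of S m D] b by simp
  next
    case False
    then show ?thesis using theory_of_survives[of S m D u _ s] assms by (auto simp: survives_def)
  qed
  finally show ?thesis unfolding image_image by (metis image_image)
qed

lemma state_code_state_words:
  assumes vs: "distinct vs" "set vs = db_states m D" and u: "u \<in> set vs" and b: "b \<longleftrightarrow> \<not> consistent S m D"
  shows "state_code tc (canonical S m D) vs u (state_words b vs u)"
proof -
  have n: "[] \<in> db_states m D" using db nonempty by (rule Nil_in_db_states)
  have up: "u \<in> paths m" using u vs(2) by (auto simp: db_states_def)
  have inj: "distinct (map (\<lambda>j. tc (tuple_of (xs ! j))) (filter (\<lambda>j. sign_of (xs ! j) = s \<and> live b u j) [0..<length xs]))" for s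
    using live_inj by (auto simp: distinct_map intro!: inj_onI)
  have neq: "s \<noteq> Neg \<longleftrightarrow> s = Pos" for s by (cases s) auto
  have ps: "distinct (pos_list b u)" "set (pos_list b u) = tc ` {t. Stmt u t Pos \<in> theory_of S m D}"
    using inj[of Pos] live_set[OF up b, of Pos] by (auto simp: pos_list_def neq)
  have ns: "distinct (neg_list b u)" "set (neg_list b u) = tc ` {t. Stmt u t Neg \<in> theory_of S m D}"
    using inj[of Neg] live_set[OF up b, of Neg] by (auto simp: neg_list_def)
  have es: "distinct (out_edges vs u m)"
    by (auto simp: out_edges_def distinct_map intro!: inj_onI)
  have "set (out_edges vs u m) = {(i, j). j < length vs \<and> (u, vs ! j) \<in> edges (canonical S m D) i}" (is "?A = ?B")
  proof -
    have mem: "longest_suffix (set vs) w \<in> set vs" for w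
      using longest_suffix_props[of "set vs" w] n vs(2) by simp
    \<comment> \<open>Translates between nodes, counted from 1, and positions in \<open>vs\<close>,
      counted from 0.\<close>
    have ix: "j < length vs \<and> vs ! j = w \<longleftrightarrow> j = ix vs w - 1" if "w \<in> set vs" for w j
      using that ix_nth[OF vs(1)] nth_ix[OF that] ix_le[of vs w] ix_eq_0[of vs w]
      by (metis One_nat_def Suc_pred diff_Suc_1 less_le_trans lessI neq0_conv)
    have "(i, j) \<in> ?A \<longleftrightarrow> (i, j) \<in> ?B" for i j
    proof -
      have "(i, j) \<in> ?A \<longleftrightarrow> i \<in> {1..m} \<and> (u = [] \<or> last u \<noteq> i) \<and>
          j = ix vs (longest_suffix (set vs) (u @ [i])) - 1"
        by (auto simp: out_edges_def)
      also have "\<dots> \<longleftrightarrow> u @ [i] \<in> paths m \<and> j < length vs \<and> vs ! j = longest_suffix (set vs) (u @ [i])"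
        using paths_snoc[OF up, of i] ix[OF mem, of j "u @ [i]"] by blast
      also have "\<dots> \<longleftrightarrow> (i, j) \<in> ?B"
        using dss_eq_longest_suffix[OF n] vs(2) u by (auto simp: canonical_def)
      finally show ?thesis .
    qed
    then show ?thesis by auto
  qed
  with es ps ns show ?thesis
    unfolding state_code_def state_words_def
    by (intro exI[of _ "pos_list b u"] exI[of _ "neg_list b u"] exI[of _ "out_edges vs u m"])
       (auto simp: canonical_def world_at_def)
qed

text \<open>The constant is 2000 from \<open>wp_program\<close> times 17 from
  \<open>time_bound\<close>.\<close>

lemma program_correct:
  "\<exists>T ys. runs program (db_code S tc kc m xs) T ys \<and> kripke_code tc (canonical S m D) ys \<and>
     T \<le> 34000 * (m ^ depth D * card D + (if depth D = 0 then m else 0))"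
proof -
  let ?\<sigma> = "\<lambda>a k. if a = 0 \<and> k < length (db_code S tc kc m xs) then db_code S tc kc m xs ! k else 0"
  let ?c = "length xs + (depth D + 1) * (depth D + 1) + m * (depth D + 1)"
  have \<sigma>: "?\<sigma> = (\<lambda>a. if a = 0 then input else (\<lambda>_. 0))" by (intro ext) (simp add: input_def)
  let ?Q = "\<lambda>\<sigma>' t'. \<exists>vs b. distinct vs \<and> vs \<noteq> [] \<and> vs ! 0 = [] \<and>
    set vs = {w. \<exists>j<length xs. prefix w (path_of (xs ! j))} \<and> (b \<longleftrightarrow> \<not> consistent S m D) \<and>
    out \<sigma>' = length vs # 0 # concat (map (state_words b vs) vs) \<and>
    t' \<le> 2000 * (length xs * (depth D + 1) + length vs * ?c)"
  have "wp program ?Q ?\<sigma> 0"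
    by (rule wp_program[OF \<sigma>]) (use clash_iff_inconsistent in auto)
  then obtain T \<sigma>' vs b where ex: "exec program ?\<sigma> T \<sigma>'"
    and vs: "distinct vs" "vs \<noteq> []" "vs ! 0 = []" "set vs = {w. \<exists>j<length xs. prefix w (path_of (xs ! j))}"
    and b: "b \<longleftrightarrow> \<not> consistent S m D"
    and out: "out \<sigma>' = length vs # 0 # concat (map (state_words b vs) vs)"
    and T: "T \<le> 2000 * (length xs * (depth D + 1) + length vs * ?c)"
    unfolding wp_def by auto
  define ys where "ys = length vs # 0 # concat (map (state_words b vs) vs)"
  have states: "set vs = db_states m D"
  proof -
    have "(\<exists>x\<in>D. prefix w (path_of x)) \<longleftrightarrow> (\<exists>j<length xs. prefix w (path_of (xs ! j)))" for w
      unfolding set_xs[symmetric] by (metis in_set_conv_nth)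
    then show ?thesis unfolding vs(4) using db_states_iff[OF db] by auto
  qed
  have "\<sigma>' 1 k = ys ! k" if "k < length ys" for k
  proof -
    have "map (\<sigma>' 1) [0..<\<sigma>' 2 0] = ys" using out by (simp add: out_def ys_def)
    with that show ?thesis by auto
  qed
  with ex have "runs program (db_code S tc kc m xs) T ys" by (auto simp: runs_def)
  moreover have "kripke_code tc (canonical S m D) ys"
  proof -
    have "\<forall>k<length vs. state_code tc (canonical S m D) vs (vs ! k) (map (state_words b vs) vs ! k)"
      using state_code_state_words[OF vs(1) states _ b] by simp
    moreover have "set vs = kripke.states (canonical S m D)" "vs ! 0 = root (canonical S m D)"
      using states vs(3) by (simp_all add: canonical_def)
    ultimately show ?thesis
      unfolding kripke_code_def ys_def using vs(1,2)
      by - (rule exI[of _ vs], rule exI[of _ 0], rule exI[of _ "map (state_words b vs) vs"], simp)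
  qed
  moreover have "T \<le> 34000 * (m ^ depth D * card D + (if depth D = 0 then m else 0))"
  proof -
    have N: "length vs = card (db_states m D)" using vs(1) states distinct_card by metis
    have n: "length xs = card D" using dist set_xs distinct_card by metis
    have "0 < card D" using nonempty finite_D by (simp add: card_gt_0_iff)
    let ?Y = "m ^ depth D * card D + (if depth D = 0 then m else 0)"
    have "length xs * (depth D + 1) + length vs * ?c \<le> 17 * ?Y"
      unfolding N n power2_eq_square[symmetric]
      using \<open>0 < card D\<close> depth_users[OF db finite_D nonempty] card_db_states(2,3)[OF db finite_D nonempty]
      by (rule time_bound)
    then have "2000 * (length xs * (depth D + 1) + length vs * ?c) \<le> 2000 * (17 * ?Y)"
      by (rule mult_le_mono2)
    also have "\<dots> = 34000 * ?Y" by simp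
    finally show ?thesis using T by (rule le_trans[rotated])
  qed
  ultimately show ?thesis by blast
qed

end

text \<open>An empty database has no states, so its structure would lack the root; this is why
  \<open>D\<close> is nonempty. The second claim includes inconsistent databases, for which the
  closure is \<open>D\<close> and the program inherits nothing.\<close>

theorem theorem17:
  fixes S :: "('t, 'v) schema"
  assumes "wf_schema S"
  shows
    "(\<forall>(m::nat) (D :: 't stmt set).
        belief_db m D \<and> D \<noteq> {} \<and> consistent S m D \<longrightarrow>
        (\<forall>w\<in>paths m. \<forall>t s.
           (world_entails S (world_at (theory_of S m D) w) t s
              \<longleftrightarrow> kripke_entails S (canonical S m D) (Stmt w t s)) \<and>
           ((s = Neg \<longrightarrow> \<not> (\<exists>t'. key_conflict S t t' \<and> entails S m D (Stmt w t' Pos))) \<longrightarrow>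
              (entails S m D (Stmt w t s)
                 \<longleftrightarrow> kripke_entails S (canonical S m D) (Stmt w t s)))))
     \<and>
     (\<exists>(p::com) (C::nat).
        \<forall>(m::nat) (D :: 't stmt set) xs (tc :: 't \<Rightarrow> nat) (kc :: 'v \<Rightarrow> nat).
          belief_db m D \<and> D \<noteq> {} \<and> distinct xs \<and> set xs = D \<and>
          inj_on tc (tuple_of ` D) \<and> inj_on kc (key_of S ` tuple_of ` D) \<longrightarrow>
          (\<exists>T ys. runs p (db_code S tc kc m xs) T ys \<and>
             kripke_code tc (canonical S m D) ys \<and>
             T \<le> C * (m ^ depth D * card D + (if depth D = 0 then m else 0))))"
proof (rule conjI, goal_cases)
  case 1
  show ?case
  proof (intro allI impI ballI)
    fix m :: nat and D :: "'t stmt set" and w t s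
    assume "belief_db m D \<and> D \<noteq> {} \<and> consistent S m D" and "w \<in> paths m"
    then show "(world_entails S (world_at (theory_of S m D) w) t s
        \<longleftrightarrow> kripke_entails S (canonical S m D) (Stmt w t s)) \<and>
      ((s = Neg \<longrightarrow> \<not> (\<exists>t'. key_conflict S t t' \<and> entails S m D (Stmt w t' Pos))) \<longrightarrow>
        (entails S m D (Stmt w t s) \<longleftrightarrow> kripke_entails S (canonical S m D) (Stmt w t s)))"
      using kripke_entails_canonical[of S m D w t s] entails_iff_kripke_entails[of S m D w s t] by blast
  qed
next
  case 2
  show ?case
  proof (rule exI[of _ program], rule exI[of _ 34000], intro allI impI)
    fix m :: nat and D :: "'t stmt set" and xs and tc :: "'t \<Rightarrow> nat" and kc :: "'v \<Rightarrow> nat"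
    assume "belief_db m D \<and> D \<noteq> {} \<and> distinct xs \<and> set xs = D \<and>
        inj_on tc (tuple_of ` D) \<and> inj_on kc (key_of S ` tuple_of ` D)"
    then interpret coded_db S m D xs tc kc by unfold_locales auto
    show "\<exists>T ys. runs program (db_code S tc kc m xs) T ys \<and> kripke_code tc (canonical S m D) ys \<and>
        T \<le> 34000 * (m ^ depth D * card D + (if depth D = 0 then m else 0))"
      by (rule program_correct)
  qed
qed

end
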